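(* Let $p$ be an even positive integer and let $\{\alpha_j\}_{j=0}^{p-1}$ be a sequence in $\mathbb{D}^p$ so that the discriminant $\Delta(z,\{\alpha_j\}_{j=0}^{p-1})$ has $k$ open gaps. Then $$\bigl\{\{\beta_j\}_{j=0}^{p-1}\in\mathbb{D}^p\mid\Delta(z,\{\beta_j\}_{j=0}^{p-1})=\Delta(z,\{\alpha_j\}_{j=0}^{p-1})\ \text{(as functions of } z)\bigr\}$$ is a $k$-dimensional torus.
   Context: $\mathbb{D}=\{|z|<1\}$. For $\alpha\in\mathbb{D}$ and $\rho=(1-|\alpha|^2)^{1/2}$ let $A(\alpha,z)=\rho^{-1}\begin{pmatrix}z&-\bar\alpha\\-\alpha z&1\end{pmatrix}$. For $\{\alpha_j\}_{j=0}^{p-1}\in\mathbb{D}^p$ put $T_p(z)=A(\alpha_{p-1},z)A(\alpha_{p-2},z)\cdots A(\alpha_0,z)$ and define the discriminant $\Delta(z,\{\alpha_j\}_{j=0}^{p-1})=z^{-p/2}\operatorname{Tr}(T_p(z))$, which is real for $z\in\partial\mathbb{D}$. The set $\{z\in\partial\mathbb{D}\mid\Delta(z)\in(-2,2)\}$ consists of $p$ disjoint open arcs whose closures can overlap at most in single points. The open gaps are the (nonempty) connected components of $\{z\in\partial\mathbb{D}\mid|\Delta(z)|>2\}$; there are at most $p$ of them. *)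

theory Defs
  imports "HOL-Analysis.Analysis"
begin

definition transfer_step :: "complex \<Rightarrow> complex \<Rightarrow> complex^2^2" where
  "transfer_step a z =
     (1 / sqrt (1 - (cmod a)\<^sup>2)) *\<^sub>R
       vector [vector [z, - cnj a], vector [- a * z, 1]]"

text \<open>The product \<open>A(\<alpha>\<^sub>n\<^sub>-\<^sub>1, z) \<cdots> A(\<alpha>\<^sub>0, z)\<close>: later factors multiply on the left.\<close>

primrec transfer_matrix :: "nat \<Rightarrow> (nat \<Rightarrow> complex) \<Rightarrow> complex \<Rightarrow> complex^2^2" where
  "transfer_matrix 0 \<alpha> z = mat 1"
| "transfer_matrix (Suc n) \<alpha> z = transfer_step (\<alpha> n) z ** transfer_matrix n \<alpha> z"

text \<open>Meaningful only for even \<open>p\<close> (so that \<open>z\<^sup>-\<^sup>p\<^sup>/\<^sup>2\<close> is an integer power) and \<open>z \<noteq> 0\<close>.\<close>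

definition discriminant :: "nat \<Rightarrow> (nat \<Rightarrow> complex) \<Rightarrow> complex \<Rightarrow> complex" where
  "discriminant p \<alpha> z = z powi (- int (p div 2)) * trace (transfer_matrix p \<alpha> z)"

text \<open>On the unit circle the discriminant is real, so \<open>cmod\<close> is its absolute value there.
  There are at most \<open>p\<close> gaps, so \<open>card\<close> counts them.\<close>

definition open_gaps :: "nat \<Rightarrow> (nat \<Rightarrow> complex) \<Rightarrow> complex set set" where
  "open_gaps p \<alpha> = components {z \<in> sphere 0 1. cmod (discriminant p \<alpha> z) > 2}"

text \<open>The power \<open>\<bbbD>\<^sup>p\<close>; points of a \<open>p\<close>-fold power are functions on \<open>{..<p}\<close>, \<open>undefined\<close> elsewhere.\<close>

definition disk_power :: "nat \<Rightarrow> (nat \<Rightarrow> complex) set" where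
  "disk_power p = {..<p} \<rightarrow>\<^sub>E ball 0 1"

definition isospectral_set :: "nat \<Rightarrow> (nat \<Rightarrow> complex) \<Rightarrow> (nat \<Rightarrow> complex) set" where
  "isospectral_set p \<alpha> =
     {\<beta> \<in> disk_power p. \<forall>z. z \<noteq> 0 \<longrightarrow> discriminant p \<beta> z = discriminant p \<alpha> z}"

definition complex_power_topology :: "nat \<Rightarrow> (nat \<Rightarrow> complex) topology" where
  "complex_power_topology p = product_topology (\<lambda>_. euclidean) {..<p}"

text \<open>The standard torus; for \<open>k = 0\<close> it is a single point.\<close>

definition torus_topology :: "nat \<Rightarrow> (nat \<Rightarrow> complex) topology" where
  "torus_topology k = product_topology (\<lambda>_. top_of_set (sphere 0 1)) {..<k}"

definition is_torus :: "nat \<Rightarrow> 'a topology \<Rightarrow> bool" where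
  "is_torus k X \<longleftrightarrow> X homeomorphic_space torus_topology k"

end

theory Submission
  imports Defs "HOL-Complex_Analysis.Complex_Analysis"
    "HOL-Computational_Algebra.Fundamental_Theorem_Algebra"
begin

text \<open>Write the second column of \<open>T\<^sub>p\<close> as \<open>(B, D)\<close>; the first column consists of the reversed
  polynomials. The Szego recursion identifies \<open>\<bbbD>\<^sup>p\<close> with the pairs of polynomials of degree below
  \<open>p\<close> such that \<open>D\<close> has no zero in the closed disk, \<open>D(0) > 0\<close> and \<open>|D|\<^sup>2 - |B|\<^sup>2 = 1\<close> on the circle,
  and \<open>\<Delta> = 2 Re (z\<^sup>-\<^sup>p\<^sup>/\<^sup>2 D)\<close> there. Put \<open>E = B - i D\<close> and \<open>w = Re (z\<^sup>-\<^sup>p\<^sup>/\<^sup>2 E)\<close>. For fixed \<open>\<Delta>\<close> the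
  trigonometric polynomial \<open>w\<close> changes sign from band to band, so it has exactly one zero \<open>\<theta>\<^sub>j\<close> in each
  of the \<open>p\<close> closed gaps (possibly degenerate), and there \<open>v\<^sub>j = Im (z\<^sup>-\<^sup>p\<^sup>/\<^sup>2 B)\<close> satisfies
  \<open>v\<^sub>j\<^sup>2 = \<Delta>\<^sup>2/4 - 1\<close>. The curve \<open>v\<^sup>2 = \<Delta>\<^sup>2/4 - 1\<close> over a closed gap is a circle if the gap is open and a
  point otherwise. Conversely the data \<open>(\<theta>\<^sub>j, v\<^sub>j)\<close> prescribe \<open>E\<close> at \<open>p\<close> points, so Lagrange
  interpolation recovers \<open>E\<close>, and then \<open>B\<close> and \<open>D\<close> from the determinant condition; positivity
  of the interpolation weights keeps \<open>D\<close> zero-free in the disk. The resulting closed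
  bijective relation between the compact isospectral set and the torus is a homeomorphism.\<close>

section \<open>The Szego recursion and its inversion\<close>

text \<open>Write p = 2 n, h = Delta / 2, z^(-n) D = h + i y and z^(-n) B = b + i u on the circle.
  The determinant condition then factors as (y + b) (y - b) = 1 - h^2 + u^2, and E = B - i D is
  chosen because z^(-n) E = w + i (u - h) with w = y + b. This one identity acts four times: at a
  zero of w it puts the point on the curve u^2 = h^2 - 1; at a zero of h it is positive and fixes
  the sign of w; off the zeros of w it determines y from E; and in the reconstruction the cofactor x
  = y - b is a polynomial quotient because the right-hand side vanishes at every node. Zeros exist
  by sign changes; they are unique because a nonzero real trigonometric polynomial of degree n has
  at most 2 n zeros per period. Compactness of the isospectral set comes from D(0): it is the
  product of the 1 / rho(beta_j) and is determined by Delta, so no coefficient can approach the unit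
  circle.\<close>

definition rho :: "complex \<Rightarrow> complex" where
  "rho a = complex_of_real (sqrt (1 - (cmod a)\<^sup>2))"

fun szego_B :: "nat \<Rightarrow> (nat \<Rightarrow> complex) \<Rightarrow> complex poly"
  and szego_D :: "nat \<Rightarrow> (nat \<Rightarrow> complex) \<Rightarrow> complex poly" where
  "szego_B 0 \<beta> = 0"
| "szego_D 0 \<beta> = 1"
| "szego_B (Suc m) \<beta> =
     smult (1 / rho (\<beta> m)) (pCons 0 (szego_B m \<beta>) - smult (cnj (\<beta> m)) (szego_D m \<beta>))"
| "szego_D (Suc m) \<beta> =
     smult (1 / rho (\<beta> m)) (szego_D m \<beta> - smult (\<beta> m) (pCons 0 (szego_B m \<beta>)))"

text \<open>Here \<open>szego_B\<close> and \<open>szego_D\<close> form the second column of the transfer matrix, and the first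
  column is \<open>(creflect m D, creflect m B)\<close> with \<open>creflect m P = z\<^sup>m cnj (P (1 / cnj z))\<close>.\<close>

definition creflect :: "nat \<Rightarrow> complex poly \<Rightarrow> complex poly" where
  "creflect m P = (\<Sum>i\<le>m. monom (cnj (coeff P (m - i))) i)"

text \<open>This is z^(-n) P(z) at z = cis t, with n standing for p / 2. Taking the angle as a real
  variable makes the intermediate value theorem, Rolle's theorem and signs of derivatives
  available.\<close>

definition laurent :: "nat \<Rightarrow> complex poly \<Rightarrow> real \<Rightarrow> complex" where
  "laurent n P t = cis (- (real n * t)) * poly P (cis t)"

definition trig :: "nat \<Rightarrow> complex poly \<Rightarrow> real \<Rightarrow> real" where
  "trig n P t = Re (laurent n P t)"

lemma rho_nonzero: "a \<in> ball 0 1 \<Longrightarrow> rho a \<noteq> 0"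
  by (simp add: rho_def abs_square_less_1 abs_square_eq_1)

lemma rho_square: "a \<in> ball 0 1 \<Longrightarrow> (rho a)\<^sup>2 = 1 - a * cnj a"
  unfolding rho_def complex_norm_square[symmetric]
  by (subst of_real_power[symmetric], subst real_sqrt_pow2) (auto simp: power_le_one)

lemma cmod_rho_square: "a \<in> ball 0 1 \<Longrightarrow> (cmod (rho a))\<^sup>2 = 1 - (cmod a)\<^sup>2"
  unfolding rho_def by (auto simp: power_le_one)

lemma rho_pos:
  assumes "a \<in> ball 0 1"
  obtains r where "r > 0" "r \<le> 1" "rho a = complex_of_real r"
proof
  show "sqrt (1 - (cmod a)\<^sup>2) > 0" using assms by (simp add: abs_square_less_1)
  show "sqrt (1 - (cmod a)\<^sup>2) \<le> 1" by simp
qed (simp add: rho_def)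

text \<open>The matrix with rows (1, -cnj a) and (-a, 1) is rho(a) times an element of SU(1,1), so
  it scales the form |d|^2 - |b|^2 by rho(a)^2.\<close>

lemma hyperbolic_identity:
  "(cmod (d - a * b))\<^sup>2 - (cmod (b - cnj a * d))\<^sup>2 = (1 - (cmod a)\<^sup>2) * ((cmod d)\<^sup>2 - (cmod b)\<^sup>2)"
  unfolding cmod_power2 by (simp add: algebra_simps power2_eq_square)

text \<open>A step multiplies \<open>B\<close> by z and then applies an SU(1,1) matrix, so only the
  shift affects the form.\<close>

lemma szego_step_norm:
  assumes "\<beta> m \<in> ball 0 1"
  shows "(cmod (poly (szego_D (Suc m) \<beta>) z))\<^sup>2 - (cmod (poly (szego_B (Suc m) \<beta>) z))\<^sup>2
       = (cmod (poly (szego_D m \<beta>) z))\<^sup>2 - (cmod z)\<^sup>2 * (cmod (poly (szego_B m \<beta>) z))\<^sup>2"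
proof -
  let ?d = "poly (szego_D m \<beta>) z" and ?b = "z * poly (szego_B m \<beta>) z" and ?a = "\<beta> m"
  have ne: "1 - (cmod ?a)\<^sup>2 \<noteq> 0"
    using assms by (simp add: abs_square_eq_1)
  have 1: "(cmod (poly (szego_D (Suc m) \<beta>) z))\<^sup>2 = (cmod (?d - ?a * ?b))\<^sup>2 / (1 - (cmod ?a)\<^sup>2)"
    by (simp add: norm_mult norm_divide power_mult_distrib power_divide cmod_rho_square[OF assms]
        mult.left_commute)
  have 2: "(cmod (poly (szego_B (Suc m) \<beta>) z))\<^sup>2 = (cmod (?b - cnj ?a * ?d))\<^sup>2 / (1 - (cmod ?a)\<^sup>2)"
    by (simp add: norm_mult norm_divide power_mult_distrib power_divide cmod_rho_square[OF assms]
        mult.left_commute)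
  have "(cmod (?d - ?a * ?b))\<^sup>2 / (1 - (cmod ?a)\<^sup>2) - (cmod (?b - cnj ?a * ?d))\<^sup>2 / (1 - (cmod ?a)\<^sup>2)
     = (cmod ?d)\<^sup>2 - (cmod ?b)\<^sup>2"
    unfolding diff_divide_distrib[symmetric] hyperbolic_identity using ne by simp
  then show ?thesis
    unfolding 1 2 by (simp add: norm_mult power_mult_distrib)
qed

text \<open>For |z| <= 1 the shift can only shrink \<open>B\<close>, so the form |D|^2 - |B|^2 never
  falls below its initial value 1. This is what makes \<open>D\<close> zero-free in the closed
  disk.\<close>

lemma szego_less:
  assumes "\<And>i. i < m \<Longrightarrow> \<beta> i \<in> ball 0 1" and "cmod z \<le> 1"
  shows "cmod (poly (szego_B m \<beta>) z) < cmod (poly (szego_D m \<beta>) z)"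
  using assms(1)
proof (induction m)
  case (Suc m)
  have IH: "cmod (poly (szego_B m \<beta>) z) < cmod (poly (szego_D m \<beta>) z)"
    using Suc by simp
  have "(cmod z)\<^sup>2 * (cmod (poly (szego_B m \<beta>) z))\<^sup>2 \<le> (cmod (poly (szego_B m \<beta>) z))\<^sup>2"
    using assms(2) by (simp add: mult_left_le_one_le power_le_one)
  also have "\<dots> < (cmod (poly (szego_D m \<beta>) z))\<^sup>2"
    using IH by (simp add: power_strict_mono)
  finally have "(cmod (poly (szego_B (Suc m) \<beta>) z))\<^sup>2 < (cmod (poly (szego_D (Suc m) \<beta>) z))\<^sup>2"
    using szego_step_norm[of \<beta> m z] Suc.prems by simp
  then show ?case by (rule power_less_imp_less_base) simp
qed simp

lemma szego_D_nonzero: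
  assumes "\<And>i. i < m \<Longrightarrow> \<beta> i \<in> ball 0 1" and "cmod z \<le> 1"
  shows "poly (szego_D m \<beta>) z \<noteq> 0"
  using szego_less[of m \<beta> z] assms by auto

lemma szego_circle:
  assumes "\<And>i. i < m \<Longrightarrow> \<beta> i \<in> ball 0 1" and "cmod z = 1"
  shows "(cmod (poly (szego_D m \<beta>) z))\<^sup>2 = 1 + (cmod (poly (szego_B m \<beta>) z))\<^sup>2"
  using assms(1)
proof (induction m)
  case (Suc m)
  show ?case
    using szego_step_norm[of \<beta> m z] Suc assms(2) by simp
qed simp

lemma szego_degree: "degree (szego_B m \<beta>) \<le> m - 1 \<and> degree (szego_D m \<beta>) \<le> m - 1"
proof (induction m)
  case (Suc m)
  \<comment> \<open>The bound stays one below the naive count because the recursion starts with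
    \<open>B = 0\<close>, which the shift leaves at 0.\<close>
  have 1: "degree (pCons 0 (szego_B m \<beta>)) \<le> m"
  proof (cases m)
    case (Suc k)
    then show ?thesis using Suc.IH by (intro order_trans[OF degree_pCons_le]) auto
  qed simp
  have 2: "degree (szego_D m \<beta>) \<le> m" using Suc by linarith
  show ?case
    using 1 2 by (auto intro!: degree_diff_le order_trans[OF degree_smult_le])
qed auto

text \<open>The second term of the recursion for \<open>D\<close> vanishes at 0, so D(0) is the
  product of the factors 1 / rho, all of them at least 1. A fixed D(0) therefore keeps every
  coefficient away from the unit circle; compactness later rests on this.\<close>

lemma szego_D_zero:
  assumes "\<And>i. i < m \<Longrightarrow> \<beta> i \<in> ball 0 1"
  shows "\<exists>r>0. coeff (szego_D m \<beta>) 0 = complex_of_real r \<and> (\<forall>i<m. r * sqrt (1 - (cmod (\<beta> i))\<^sup>2) \<ge> 1) \<and> r \<ge> 1"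
  using assms
proof (induction m)
  case 0
  show ?case by (rule exI[of _ 1]) auto
next
  case (Suc m)
  then obtain r where r: "r > 0" "coeff (szego_D m \<beta>) 0 = complex_of_real r" "r \<ge> 1"
     "\<And>i. i < m \<Longrightarrow> r * sqrt (1 - (cmod (\<beta> i))\<^sup>2) \<ge> 1"
    by auto
  define s where "s = sqrt (1 - (cmod (\<beta> m))\<^sup>2)"
  have s: "s > 0" "s \<le> 1"
    using Suc.prems[of m] by (auto simp: s_def abs_square_less_1)
  have "r / s * sqrt (1 - (cmod (\<beta> i))\<^sup>2) \<ge> 1" if "i < Suc m" for i
  proof (cases "i = m")
    case True
    then show ?thesis using s r by (simp add: s_def)
  next
    case False
    then have "1 \<le> r * sqrt (1 - (cmod (\<beta> i))\<^sup>2)" using r that by simp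
    also have "\<dots> \<le> (r * sqrt (1 - (cmod (\<beta> i))\<^sup>2)) / s"
      using s calculation by (simp add: le_divide_eq mult_left_le)
    finally show ?thesis by simp
  qed
  moreover have "coeff (szego_D (Suc m) \<beta>) 0 = complex_of_real (r / s)"
    using r by (simp add: rho_def s_def)
  moreover have "r / s \<ge> 1" using r s by (simp add: le_divide_eq)
  ultimately show ?case using r s by (intro exI[of _ "r / s"]) auto
qed

text \<open>The last coefficient is read off at z = 0, where the shifted \<open>B\<close> vanishes
  and B(0) / D(0) = -cnj (beta_m). Once it is known, the step is a linear map on (z B, D),
  invertible because 1 - |a|^2 is nonzero.\<close>

lemma szego_inj:
  assumes "\<And>i. i < m \<Longrightarrow> \<beta> i \<in> ball 0 1" "\<And>i. i < m \<Longrightarrow> \<gamma> i \<in> ball 0 1"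
    and "szego_B m \<beta> = szego_B m \<gamma>" "szego_D m \<beta> = szego_D m \<gamma>" "i < m"
  shows "\<beta> i = \<gamma> i"
  using assms
proof (induction m)
  case (Suc m)
  have cD: "coeff (szego_D m \<beta>) 0 \<noteq> 0" "coeff (szego_D m \<gamma>) 0 \<noteq> 0"
    using szego_D_zero[of m \<beta>] szego_D_zero[of m \<gamma>] Suc.prems by force+
  have r: "rho (\<beta> m) \<noteq> 0" "rho (\<gamma> m) \<noteq> 0"
    using Suc.prems by (auto intro!: rho_nonzero)
  have 0: "coeff (szego_B (Suc m) \<delta>) 0 = - cnj (\<delta> m) * coeff (szego_D (Suc m) \<delta>) 0" for \<delta>
    by simp
  have ne: "coeff (szego_D (Suc m) \<gamma>) 0 \<noteq> 0" using cD r by simp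
  have "cnj (\<beta> m) = cnj (\<gamma> m)"
    using 0[of \<beta>] 0[of \<gamma>] Suc.prems(3,4) ne
    by (metis mult_right_cancel minus_equation_iff)
  then have eq: "\<beta> m = \<gamma> m" by simp
  define a where "a = \<beta> m"
  have ra: "rho a \<noteq> 0" and a1: "1 - a * cnj a \<noteq> 0"
    using r(1) rho_square[of a] Suc.prems(1)[of m] by (auto simp: a_def)
  define X Y where "X = pCons 0 (szego_B m \<beta>) - pCons 0 (szego_B m \<gamma>)"
    and "Y = szego_D m \<beta> - szego_D m \<gamma>"
  have gen: "p - q = r - s \<Longrightarrow> p - r = q - s" for p q r s :: "complex poly"
    by (simp add: algebra_simps)
  have "pCons 0 (szego_B m \<beta>) - smult (cnj a) (szego_D m \<beta>)
      = pCons 0 (szego_B m \<gamma>) - smult (cnj a) (szego_D m \<gamma>)"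
    using Suc.prems(3) r(1) unfolding szego_B.simps eq[symmetric] a_def
    by (metis smult_cancel divide_eq_0_iff zero_neq_one)
  then have e1: "X = smult (cnj a) Y" unfolding X_def Y_def smult_diff_right by (rule gen)
  have "szego_D m \<beta> - smult a (pCons 0 (szego_B m \<beta>))
      = szego_D m \<gamma> - smult a (pCons 0 (szego_B m \<gamma>))"
    using Suc.prems(4) r(1) unfolding szego_D.simps eq[symmetric] a_def
    by (metis smult_cancel divide_eq_0_iff zero_neq_one)
  then have e2: "Y = smult a X" unfolding X_def Y_def smult_diff_right by (rule gen)
  have "Y = smult (a * cnj a) Y" using e1 e2 by (metis smult_smult)
  then have "smult (1 - a * cnj a) Y = 0" by (simp add: smult_diff_left)
  then have "Y = 0" using a1 by simp
  then have "X = 0" using e1 by simp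
  have "szego_B m \<beta> = szego_B m \<gamma>" "szego_D m \<beta> = szego_D m \<gamma>"
    using \<open>X = 0\<close> \<open>Y = 0\<close> by (auto simp: X_def Y_def)
  then show ?case
    using Suc.IH[OF Suc.prems(1) Suc.prems(2)] eq Suc.prems(5) by (cases "i = m") auto
qed simp


section \<open>Polynomials on the unit circle: identity theorems, reflection, maximum
  principle\<close>

lemma infinite_unit_circle: "infinite (sphere (0::complex) 1)"
proof
  assume fin: "finite (sphere (0::complex) 1)"
  have "inj_on cis {0..1}"
  proof (rule inj_onI)
    fix x y :: real assume "x \<in> {0..1}" "y \<in> {0..1}" "cis x = cis y"
    moreover have "1 \<le> pi" using pi_gt3 by simp
    ultimately show "x = y" using cos_inj_pi[of x y] by (auto simp: complex_eq_iff)
  qed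
  moreover have "cis ` {0..1} \<subseteq> sphere 0 1" by auto
  ultimately have "finite {0..1::real}" using fin by (meson finite_imageD finite_subset)
  then show False using infinite_Icc[of 0 "1::real"] by simp
qed

lemma poly_eq_on_circle:
  fixes P Q :: "complex poly"
  assumes "\<And>z. cmod z = 1 \<Longrightarrow> poly P z = poly Q z"
  shows "P = Q"
proof (rule ccontr)
  assume "P \<noteq> Q"
  then have "finite {z. poly (P - Q) z = 0}" by (intro poly_roots_finite) simp
  moreover have "sphere 0 1 \<subseteq> {z. poly (P - Q) z = 0}" using assms by auto
  ultimately show False using infinite_unit_circle finite_subset by blast
qed

text \<open>The exceptional set absorbs the zeros of a polynomial by which one has to
  divide.\<close>

lemma poly_eq_on_circle_cofinite:
  fixes P Q :: "complex poly"
  assumes "finite F" "\<And>z. cmod z = 1 \<Longrightarrow> z \<notin> F \<Longrightarrow> poly P z = poly Q z"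
  shows "P = Q"
proof (rule ccontr)
  assume "P \<noteq> Q"
  then have "finite {z. poly (P - Q) z = 0}" by (intro poly_roots_finite) simp
  then have "finite ({z. poly (P - Q) z = 0} \<union> F)" using assms(1) by (rule finite_UnI)
  moreover have "sphere 0 1 \<subseteq> {z. poly (P - Q) z = 0} \<union> F" using assms by auto
  ultimately show False using infinite_unit_circle finite_subset by blast
qed

text \<open>If one of the degree bounds is strict, both sides are zero. Top coefficients can thus be
  compared without knowing exact degrees.\<close>

lemma coeff_mult_top:
  fixes P Q :: "'a::comm_semiring_0 poly"
  assumes "degree P \<le> m" "degree Q \<le> k"
  shows "coeff (P * Q) (m + k) = coeff P m * coeff Q k"
proof (cases "degree P = m \<and> degree Q = k")
  case True
  then show ?thesis using coeff_mult_degree_sum[of P Q] by auto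
next
  case False
  then have "degree P < m \<or> degree Q < k" using assms by auto
  then have "coeff P m * coeff Q k = 0" by (auto simp: coeff_eq_0)
  moreover have "degree (P * Q) < m + k"
    using degree_mult_le[of P Q] False assms by linarith
  ultimately show ?thesis by (simp add: coeff_eq_0)
qed

lemma coeff_creflect: "coeff (creflect m P) i = (if i \<le> m then cnj (coeff P (m - i)) else 0)"
  by (simp add: creflect_def coeff_sum)

lemma degree_creflect: "degree (creflect m P) \<le> m"
  by (rule degree_le) (simp add: coeff_creflect)

lemma poly_sum_bound:
  fixes P :: "complex poly"
  assumes "degree P \<le> m"
  shows "poly P z = (\<Sum>i\<le>m. coeff P i * z ^ i)"
  unfolding poly_altdef using assms
  by (intro sum.mono_neutral_left) (auto simp: coeff_eq_0)

lemma poly_creflect: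
  assumes "degree P \<le> m" "z \<noteq> 0"
  shows "poly (creflect m P) z = z ^ m * cnj (poly P (1 / cnj z))"
proof -
  have "poly (creflect m P) z = (\<Sum>i\<le>m. cnj (coeff P (m - i)) * z ^ i)"
    by (simp add: creflect_def poly_sum poly_monom)
  also have "\<dots> = (\<Sum>i\<le>m. cnj (coeff P i) * z ^ (m - i))"
    by (rule sum.reindex_bij_witness[of _ "\<lambda>i. m - i" "\<lambda>i. m - i"]) auto
  also have "\<dots> = (\<Sum>i\<le>m. z ^ m * (cnj (coeff P i) * (1 / z) ^ i))"
    using assms(2) by (intro sum.cong refl) (simp add: power_diff power_one_over divide_simps)
  also have "\<dots> = z ^ m * cnj (poly P (1 / cnj z))"
    using poly_sum_bound[OF assms(1)] by (simp add: sum_distrib_left)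
  finally show ?thesis .
qed

lemma poly_creflect_circle:
  assumes "degree P \<le> m" "cmod z = 1"
  shows "poly (creflect m P) z = z ^ m * cnj (poly P z)"
proof -
  have "z \<noteq> 0" using assms(2) by auto
  moreover have "1 / cnj z = z"
    using assms(2) complex_norm_square[of z] \<open>z \<noteq> 0\<close> by (simp add: divide_eq_eq)
  ultimately show ?thesis using poly_creflect[OF assms(1), of z] by simp
qed

text \<open>The maximum principle for P / Q, which is holomorphic because Q has no zero in the
  closed disk.\<close>

lemma max_modulus_poly:
  fixes P Q :: "complex poly"
  assumes "\<And>z. cmod z \<le> 1 \<Longrightarrow> poly Q z \<noteq> 0"
    and "\<And>z. cmod z = 1 \<Longrightarrow> cmod (poly P z) \<le> M * cmod (poly Q z)" and "cmod z \<le> 1"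
  shows "cmod (poly P z) \<le> M * cmod (poly Q z)"
proof -
  have "cmod (poly P z / poly Q z) \<le> M"
  proof (rule maximum_modulus_frontier[where S = "cball 0 1" and f = "\<lambda>z. poly P z / poly Q z"])
    show "(\<lambda>z. poly P z / poly Q z) holomorphic_on interior (cball 0 1)"
      using assms(1) by (intro holomorphic_intros) auto
    show "continuous_on (closure (cball 0 1)) (\<lambda>z. poly P z / poly Q z)"
      using assms(1) by (intro continuous_intros) auto
    show "cmod (poly P w / poly Q w) \<le> M" if "w \<in> frontier (cball 0 1)" for w
      using that assms(1)[of w] assms(2)[of w] by (simp add: norm_divide divide_le_eq)
  qed (use assms in auto)
  then show ?thesis
    using assms(1)[of z] assms(3) by (simp add: norm_divide divide_le_eq)
qed

text \<open>By compactness the quotient has a maximum below 1 on the circle, and the non-strict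
  bound with that constant suffices.\<close>

lemma max_modulus_poly_strict:
  fixes P Q :: "complex poly"
  assumes "\<And>z. cmod z \<le> 1 \<Longrightarrow> poly Q z \<noteq> 0"
    and "\<And>z. cmod z = 1 \<Longrightarrow> cmod (poly P z) < cmod (poly Q z)" and "cmod z \<le> 1"
  shows "cmod (poly P z) < cmod (poly Q z)"
proof -
  have c: "continuous_on (sphere 0 1) (\<lambda>z. cmod (poly P z / poly Q z))"
    using assms(1) by (intro continuous_intros) auto
  obtain w where w: "w \<in> sphere 0 1"
      "\<And>v. v \<in> sphere 0 1 \<Longrightarrow> cmod (poly P v / poly Q v) \<le> cmod (poly P w / poly Q w)"
    using continuous_attains_sup[OF _ _ c] by auto
  define M where "M = cmod (poly P w / poly Q w)"
  have "M < 1" using assms(1)[of w] assms(2)[of w] w(1) by (simp add: M_def norm_divide divide_less_eq)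
  have "cmod (poly P z) \<le> M * cmod (poly Q z)"
  proof (rule max_modulus_poly[OF assms(1) _ assms(3)])
    fix v :: complex assume "cmod v = 1"
    then show "cmod (poly P v) \<le> M * cmod (poly Q v)"
      using w(2)[of v] assms(1)[of v] by (simp add: M_def norm_divide divide_le_eq)
  qed
  also have "\<dots> < 1 * cmod (poly Q z)"
    using \<open>M < 1\<close> assms(1,3) by (intro mult_strict_right_mono) auto
  finally show ?thesis by simp
qed

section \<open>Surjectivity of the recursion\<close>

lemma szego_cong:
  assumes "\<And>i. i < m \<Longrightarrow> \<beta> i = \<gamma> i"
  shows "szego_B m \<beta> = szego_B m \<gamma> \<and> szego_D m \<beta> = szego_D m \<gamma>"
  using assms by (induction m) auto

text \<open>A Schur algorithm: \<open>a\<close> is forced by B(0) / D(0), has modulus below 1 by the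
  maximum principle, and undoing the step must return a pair of the same kind with degrees lowered
  by one. For \<open>m = 0\<close> truncated subtraction makes the degree bounds too weak to single
  out (0, 1), hence the separate clause.\<close>

lemma szego_surj:
  assumes "degree B \<le> m - 1" "degree D \<le> m - 1" "m = 0 \<Longrightarrow> B = 0 \<and> D = 1"
    and "coeff D 0 = complex_of_real r" "r > 0"
    and "\<And>z. cmod z \<le> 1 \<Longrightarrow> poly D z \<noteq> 0"
    and "\<And>z. cmod z = 1 \<Longrightarrow> (cmod (poly D z))\<^sup>2 = 1 + (cmod (poly B z))\<^sup>2"
  shows "\<exists>\<beta>. (\<forall>i<m. \<beta> i \<in> ball 0 1) \<and> szego_B m \<beta> = B \<and> szego_D m \<beta> = D"
  using assms
proof (induction m arbitrary: B D r)
  case (Suc m)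
  define a where "a = - cnj (coeff B 0 / coeff D 0)"
  have less: "cmod (poly B z) < cmod (poly D z)" if "cmod z \<le> 1" for z
    using Suc.prems(6) _ that
  proof (rule max_modulus_poly_strict)
    fix z :: complex assume "cmod z = 1"
    then have "(cmod (poly B z))\<^sup>2 < (cmod (poly D z))\<^sup>2" using Suc.prems(7) by simp
    then show "cmod (poly B z) < cmod (poly D z)" by (rule power_less_imp_less_base) simp
  qed auto
  have D0: "coeff D 0 \<noteq> 0" using Suc.prems(4,5) by simp
  have "cmod a < 1"
    using less[of 0] D0 by (simp add: a_def norm_divide poly_0_coeff_0 divide_less_eq)
  then have a: "a \<in> ball 0 1" by simp
  obtain \<rho> where \<rho>: "\<rho> > 0" "\<rho> \<le> 1" "rho a = complex_of_real \<rho>" using rho_pos[OF a] by blast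
  have \<rho>2: "(complex_of_real \<rho>)\<^sup>2 = 1 - a * cnj a" using rho_square[OF a] \<rho>(3) by simp
  have c\<rho>2: "\<rho>\<^sup>2 = 1 - (cmod a)\<^sup>2" using cmod_rho_square[OF a] \<rho> by simp
  obtain c q where cq: "B + smult (cnj a) D = pCons c q" by (cases "B + smult (cnj a) D") blast
  \<comment> \<open>The choice of \<open>a\<close> makes B + cnj a D vanish at 0, so that it can be
    divided by z.\<close>
  have "c = coeff (B + smult (cnj a) D) 0" using cq by simp
  also have "\<dots> = 0" using D0 by (simp add: a_def)
  finally have "c = 0" .
  note cq = cq[unfolded this]
  define B1 D1 where "B1 = smult (1 / rho a) q" and "D1 = smult (1 / rho a) (D + smult a B)"
  have degBD: "degree (D + smult a B) \<le> m" "degree (B + smult (cnj a) D) \<le> m"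
    using Suc.prems(1,2) by (auto intro!: degree_add_le order_trans[OF degree_smult_le])
  have degq: "degree q \<le> m - 1"
    using degBD(2) unfolding cq by (simp add: degree_pCons_eq_if split: if_splits)
  have norm1: "(cmod (poly D1 z))\<^sup>2 = 1 + (cmod (poly B1 z))\<^sup>2" if z: "cmod z = 1" for z
  proof -
    have "z * poly q z = poly (B + smult (cnj a) D) z" unfolding cq by simp
    then have "cmod (poly q z) = cmod (poly B z + cnj a * poly D z)"
      using z by (metis norm_mult mult_1 poly_add poly_smult)
    then have 1: "(cmod (poly B1 z))\<^sup>2 = (cmod (poly B z - cnj (-a) * poly D z))\<^sup>2 / \<rho>\<^sup>2"
      using \<rho> by (simp add: B1_def norm_mult norm_divide power_mult_distrib power_divide)
    have 2: "(cmod (poly D1 z))\<^sup>2 = (cmod (poly D z - (-a) * poly B z))\<^sup>2 / \<rho>\<^sup>2"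
      using \<rho> by (simp add: D1_def norm_mult norm_divide power_mult_distrib power_divide)
    have "(cmod (poly D1 z))\<^sup>2 - (cmod (poly B1 z))\<^sup>2
       = (1 - (cmod (-a))\<^sup>2) * ((cmod (poly D z))\<^sup>2 - (cmod (poly B z))\<^sup>2) / \<rho>\<^sup>2"
      unfolding 1 2 diff_divide_distrib[symmetric] hyperbolic_identity ..
    also have "\<dots> = 1" using \<rho>(1) Suc.prems(7)[OF z] by (simp flip: c\<rho>2)
    finally show ?thesis by simp
  qed
  have D10: "coeff D1 0 = complex_of_real (r * \<rho>)"
  proof -
    have "coeff D1 0 * rho a = coeff D 0 + a * coeff B 0"
      using \<rho> by (simp add: D1_def)
    also have "coeff B 0 = - cnj a * coeff D 0" using D0 by (simp add: a_def)
    also have "coeff D 0 + a * (- cnj a * coeff D 0) = coeff D 0 * (1 - a * cnj a)"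
      by (simp add: algebra_simps)
    also have "\<dots> = complex_of_real (r * \<rho>) * rho a"
      unfolding Suc.prems(4) \<rho>2[symmetric] \<rho>(3) by (simp add: power2_eq_square)
    finally show ?thesis using \<rho> by simp
  qed
  \<comment> \<open>Here the degree drops for a less visible reason. The circle condition says that
    D times its reflection of order m minus B times its reflection is z^m; for m > 0 the coefficient
    of z^(2 m) is zero, and this cancels the top coefficient of D + a B.\<close>
  have degD1: "degree (D + smult a B) \<le> m - 1"
  proof (cases m)
    case 0
    then show ?thesis using degBD by simp
  next
    case (Suc m')
    have dBD: "degree B \<le> m" "degree D \<le> m" using Suc.prems(1,2) by auto
    have "D * creflect m D - B * creflect m B = monom 1 m"
    proof (rule poly_eq_on_circle)
      fix z :: complex assume z: "cmod z = 1"
      have "poly (D * creflect m D - B * creflect m B) z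
          = z ^ m * (poly D z * cnj (poly D z) - poly B z * cnj (poly B z))"
        using poly_creflect_circle[OF _ z] dBD by (simp add: algebra_simps)
      also have "poly D z * cnj (poly D z) - poly B z * cnj (poly B z) = 1"
        using Suc.prems(7)[OF z] unfolding complex_norm_square[symmetric]
        by (simp flip: of_real_power of_real_diff)
      finally show "poly (D * creflect m D - B * creflect m B) z = poly (monom 1 m) z"
        by (simp add: poly_monom)
    qed
    then have "coeff (D * creflect m D - B * creflect m B) (m + m) = coeff (monom 1 m) (m + m)"
      by simp
    moreover have "coeff (monom 1 m) (m + m) = (0::complex)" using Suc by simp
    ultimately have "coeff D m * cnj (coeff D 0) = coeff B m * cnj (coeff B 0)"
      using dBD by (simp add: coeff_mult_top degree_creflect coeff_creflect)
    then have "coeff D m + a * coeff B m = 0"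
      using D0 by (simp add: a_def field_simps)
    then have "coeff (D + smult a B) m = 0" by simp
    then have "degree (D + smult a B) \<noteq> m"
      using Suc by (metis degree_0 leading_coeff_0_iff nat.distinct(1))
    then show ?thesis using degBD(1) by simp
  qed
  have "\<exists>\<beta>. (\<forall>i<m. \<beta> i \<in> ball 0 1) \<and> szego_B m \<beta> = B1 \<and> szego_D m \<beta> = D1"
  proof (rule Suc.IH)
    show "degree B1 \<le> m - 1" unfolding B1_def using degq by (rule order_trans[OF degree_smult_le])
    show "degree D1 \<le> m - 1" unfolding D1_def using degD1 by (rule order_trans[OF degree_smult_le])
    show "coeff D1 0 = complex_of_real (r * \<rho>)" by (rule D10)
    show "0 < r * \<rho>" using Suc.prems(5) \<rho> by simp
    show "(cmod (poly D1 z))\<^sup>2 = 1 + (cmod (poly B1 z))\<^sup>2" if "cmod z = 1" for z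
      using norm1 that by blast
    show "poly D1 z \<noteq> 0" if z: "cmod z \<le> 1" for z
    proof -
      have "cmod (a * poly B z) \<le> cmod (poly B z)"
        using \<open>cmod a < 1\<close> by (simp add: norm_mult mult_left_le_one_le)
      also have "\<dots> < cmod (poly D z)" using less z by blast
      finally have "poly D z + a * poly B z \<noteq> 0"
        by (metis add_eq_0_iff norm_minus_cancel less_irrefl)
      then show ?thesis using \<rho> by (simp add: D1_def)
    qed
    assume "m = 0"
    then have "degree (pCons 0 q) = 0" using degBD(2) unfolding cq by simp
    then have "q = 0" by (simp add: degree_pCons_eq_if split: if_splits)
    then have B1: "B1 = 0" by (simp add: B1_def)
    have "degree D1 = 0" using \<open>degree D1 \<le> m - 1\<close> \<open>m = 0\<close> by simp
    then have D1: "D1 = [:complex_of_real (r * \<rho>):]" using D10 by (metis coeff_pCons_0 degree_eq_zeroE)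
    \<comment> \<open>The degree bounds leave a positive constant, and the circle condition with
      \<open>B1 = 0\<close> gives it modulus 1.\<close>
    have "(r * \<rho>)\<^sup>2 = 1" using norm1[of 1] unfolding D1 B1 by (simp add: norm_mult power_mult_distrib)
    then have "r * \<rho> = 1" using mult_pos_pos[OF Suc.prems(5) \<rho>(1)] by (auto simp: power2_eq_1_iff)
    then show "B1 = 0 \<and> D1 = 1" using B1 D1 by (simp add: one_pCons)
  qed
  then obtain \<beta> where \<beta>: "\<forall>i<m. \<beta> i \<in> ball 0 1" "szego_B m \<beta> = B1" "szego_D m \<beta> = D1" by blast
  define \<gamma> where "\<gamma> = \<beta>(m := a)"
  have \<gamma>: "szego_B m \<gamma> = B1" "szego_D m \<gamma> = D1"
    using szego_cong[of m \<gamma> \<beta>] \<beta> by (auto simp: \<gamma>_def)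
  have "pCons 0 B1 = smult (1 / rho a) (B + smult (cnj a) D)" unfolding cq B1_def by simp
  then have pB1: "poly (pCons 0 B1) z = (poly B z + cnj a * poly D z) / rho a" for z by simp
  have pD1: "poly D1 z = (poly D z + a * poly B z) / rho a" for z by (simp add: D1_def)
  have ra: "rho a * rho a = 1 - a * cnj a" "rho a \<noteq> 0"
    using rho_square[OF a] rho_nonzero[OF a] by (auto simp: power2_eq_square)
  have "szego_B (Suc m) \<gamma> = B"
  proof (rule poly_eq_on_circle)
    fix z :: complex
    have "poly (szego_B (Suc m) \<gamma>) z = (poly (pCons 0 B1) z - cnj a * poly D1 z) / rho a"
      unfolding szego_B.simps \<gamma> by (simp add: \<gamma>_def)
    also have "\<dots> = poly B z * (1 - a * cnj a) / (rho a * rho a)"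
      unfolding pB1 pD1 using ra(2) by (simp add: field_simps)
    also have "\<dots> = poly B z" using ra by (metis nonzero_mult_div_cancel_right no_zero_divisors)
    finally show "poly (szego_B (Suc m) \<gamma>) z = poly B z" .
  qed
  moreover have "szego_D (Suc m) \<gamma> = D"
  proof (rule poly_eq_on_circle)
    fix z :: complex
    have "poly (szego_D (Suc m) \<gamma>) z = (poly D1 z - a * poly (pCons 0 B1) z) / rho a"
      unfolding szego_D.simps \<gamma> by (simp add: \<gamma>_def)
    also have "\<dots> = poly D z * (1 - a * cnj a) / (rho a * rho a)"
      unfolding pB1 pD1 using ra(2) by (simp add: field_simps)
    also have "\<dots> = poly D z" using ra by (metis nonzero_mult_div_cancel_right no_zero_divisors)
    finally show "poly (szego_D (Suc m) \<gamma>) z = poly D z" .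
  qed
  moreover have "\<forall>i<Suc m. \<gamma> i \<in> ball 0 1" using \<beta>(1) a by (auto simp: \<gamma>_def less_Suc_eq)
  ultimately show ?case by blast
qed simp

section \<open>Laurent and trigonometric polynomials\<close>

text \<open>The first column is the reflection of the second, written with 1 / cnj z so that it
  holds off the circle as well.\<close>

lemma transfer_matrix_entries:
  assumes "z \<noteq> 0"
  shows "transfer_matrix m \<beta> z $ 1 $ 1 = z ^ m * cnj (poly (szego_D m \<beta>) (1 / cnj z))
    \<and> transfer_matrix m \<beta> z $ 1 $ 2 = poly (szego_B m \<beta>) z
    \<and> transfer_matrix m \<beta> z $ 2 $ 1 = z ^ m * cnj (poly (szego_B m \<beta>) (1 / cnj z))
    \<and> transfer_matrix m \<beta> z $ 2 $ 2 = poly (szego_D m \<beta>) z"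
proof (induction m)
  case 0
  show ?case by (simp add: mat_def)
next
  case (Suc m)
  have cr: "cnj (rho (\<beta> m)) = rho (\<beta> m)" by (simp add: rho_def)
  have s: "transfer_step (\<beta> m) z $ 1 $ 1 = z / rho (\<beta> m)"
    "transfer_step (\<beta> m) z $ 1 $ 2 = - cnj (\<beta> m) / rho (\<beta> m)"
    "transfer_step (\<beta> m) z $ 2 $ 1 = - \<beta> m * z / rho (\<beta> m)"
    "transfer_step (\<beta> m) z $ 2 $ 2 = 1 / rho (\<beta> m)"
    by (simp_all add: transfer_step_def) (simp_all add: scaleR_conv_of_real rho_def)
  have e: "transfer_matrix (Suc m) \<beta> z $ i $ j
    = transfer_step (\<beta> m) z $ i $ 1 * transfer_matrix m \<beta> z $ 1 $ j
    + transfer_step (\<beta> m) z $ i $ 2 * transfer_matrix m \<beta> z $ 2 $ j" for i j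
    by (simp add: matrix_matrix_mult_def sum_2)
  show ?case
    unfolding e s using Suc.IH assms
    by (simp add: cr divide_simps) (auto simp: algebra_simps)
qed

lemma degree_szego_D: "degree (szego_D m \<beta>) \<le> m"
  using szego_degree[of m \<beta>] by linarith

lemma trace_transfer_matrix:
  assumes "z \<noteq> 0"
  shows "trace (transfer_matrix m \<beta> z) = poly (szego_D m \<beta> + creflect m (szego_D m \<beta>)) z"
  using transfer_matrix_entries[OF assms, of m \<beta>] poly_creflect[OF degree_szego_D assms, of m \<beta>]
  by (simp add: trace_def sum_2)

lemma laurent_add: "laurent n (P + Q) t = laurent n P t + laurent n Q t"
  and laurent_diff: "laurent n (P - Q) t = laurent n P t - laurent n Q t"
  and laurent_minus: "laurent n (- P) t = - laurent n P t"
  and laurent_smult: "laurent n (smult c P) t = c * laurent n P t"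
  and laurent_zero: "laurent n 0 t = 0"
  by (simp_all add: laurent_def algebra_simps)

lemmas laurent_linear = laurent_add laurent_diff laurent_minus laurent_smult laurent_zero

lemma norm_laurent: "cmod (laurent n P t) = cmod (poly P (cis t))"
  by (simp add: laurent_def norm_mult)

lemma poly_cis: "poly P (cis t) = cis (real n * t) * laurent n P t"
  by (simp add: laurent_def mult.assoc[symmetric] cis_mult)

lemma laurent_creflect:
  assumes "degree P \<le> 2 * n"
  shows "laurent n (creflect (2 * n) P) t = cnj (laurent n P t)"
proof -
  have e: "cis t ^ (2 * n) = cis (real n * t) * cis (real n * t)"
    by (simp only: Complex.DeMoivre cis_mult) (simp add: algebra_simps)
  show ?thesis
    unfolding laurent_def poly_creflect_circle[OF assms norm_cis] e
    by (simp add: mult.assoc[symmetric] cis_mult cis_cnj mult.commute[of t])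
qed

lemma laurent_self_reflect:
  assumes "degree P \<le> 2 * n"
  shows "laurent n (P + creflect (2 * n) P) t = complex_of_real (2 * trig n P t)"
  unfolding laurent_add laurent_creflect[OF assms] trig_def by (rule complex_add_cnj)

lemma laurent_inj:
  assumes "\<And>t. laurent n P t = laurent n Q t"
  shows "P = Q"
proof (rule poly_eq_on_circle)
  fix z :: complex assume "cmod z = 1"
  then obtain t where "z = cis t" by (metis cis_Arg norm_eq_zero sgn_eq div_by_1 of_real_1 zero_neq_one)
  then show "poly P z = poly Q z" using assms[of t] by (simp add: laurent_def)
qed

lemma discriminant_cis:
  "discriminant (2 * n) \<beta> (cis t) = complex_of_real (2 * trig n (szego_D (2 * n) \<beta>) t)"
proof -
  have "cis t powi - int n = cis (- (real n * t))"
    by (simp add: power_int_minus Complex.DeMoivre)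
  then show ?thesis
    using laurent_self_reflect[OF degree_szego_D, of n \<beta> t]
    by (simp add: discriminant_def trace_transfer_matrix laurent_def)
qed

text \<open>Both discriminants are z^(-n) times a polynomial, so agreement on the circle extends to
  every nonzero z.\<close>

lemma isospectral_iff:
  "(\<forall>z. z \<noteq> 0 \<longrightarrow> discriminant (2 * n) \<beta> z = discriminant (2 * n) \<alpha> z) \<longleftrightarrow>
   (\<forall>t. trig n (szego_D (2 * n) \<beta>) t = trig n (szego_D (2 * n) \<alpha>) t)"
proof
  assume l: "\<forall>z. z \<noteq> 0 \<longrightarrow> discriminant (2 * n) \<beta> z = discriminant (2 * n) \<alpha> z"
  show "\<forall>t. trig n (szego_D (2 * n) \<beta>) t = trig n (szego_D (2 * n) \<alpha>) t"
  proof
    fix t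
    have "complex_of_real (2 * trig n (szego_D (2 * n) \<beta>) t) = complex_of_real (2 * trig n (szego_D (2 * n) \<alpha>) t)"
      unfolding discriminant_cis[symmetric] using l by simp
    then show "trig n (szego_D (2 * n) \<beta>) t = trig n (szego_D (2 * n) \<alpha>) t"
      unfolding of_real_eq_iff by simp
  qed
next
  assume r: "\<forall>t. trig n (szego_D (2 * n) \<beta>) t = trig n (szego_D (2 * n) \<alpha>) t"
  have "szego_D (2 * n) \<beta> + creflect (2 * n) (szego_D (2 * n) \<beta>)
    = szego_D (2 * n) \<alpha> + creflect (2 * n) (szego_D (2 * n) \<alpha>)"
    using r by (intro laurent_inj[of n]) (simp add: laurent_self_reflect degree_szego_D)
  then show "\<forall>z. z \<noteq> 0 \<longrightarrow> discriminant (2 * n) \<beta> z = discriminant (2 * n) \<alpha> z"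
    by (simp add: discriminant_def trace_transfer_matrix del: poly_add)
qed

section \<open>Zero counts and angular derivatives of trigonometric polynomials\<close>

lemma cis_inj:
  assumes "cis s = cis t" "\<bar>s - t\<bar> < 2 * pi"
  shows "s = t"
proof -
  have "sin s = sin t \<and> cos s = cos t" using assms(1) by (auto simp: complex_eq_iff)
  then obtain k :: int where k: "s = t + 2 * pi * of_int k" using sin_cos_eq_iff by blast
  then have "2 * pi * \<bar>of_int k\<bar> < 2 * pi * (1::real)" using assms(2) by (simp add: abs_mult)
  then have "\<bar>real_of_int k\<bar> < 1" by simp
  then have "k = 0" by linarith
  then show ?thesis using k by simp
qed

lemma inj_on_cis:
  assumes "X \<subseteq> {a..<a + 2 * pi}"
  shows "inj_on cis X"
proof (rule inj_onI)
  fix x y assume "x \<in> X" "y \<in> X" "cis x = cis y"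
  moreover have "x \<in> {a..<a + 2 * pi}" "y \<in> {a..<a + 2 * pi}" using calculation assms by auto
  ultimately show "x = y" by (intro cis_inj) auto
qed

text \<open>Twice the real part of z^(-n) P is z^(-n) times a polynomial of degree at most 2 n. The
  uniqueness of critical points and of Dirichlet data rests on this count.\<close>

lemma trig_zero_count:
  assumes "degree P \<le> 2 * n" "X \<subseteq> {a..<a + 2 * pi}" "card X > 2 * n"
    and "\<And>t. t \<in> X \<Longrightarrow> trig n P t = 0"
  shows "trig n P s = 0"
proof -
  let ?Q = "P + creflect (2 * n) P"
  have "?Q = 0"
  proof (rule poly_eqI_degree[where A = "cis ` X"])
    have c: "card (cis ` X) = card X" using assms(2) by (intro card_image inj_on_cis)
    have "degree ?Q \<le> 2 * n" using assms(1) degree_creflect by (rule degree_add_le)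
    then show "degree ?Q < card (cis ` X)" using assms(3) c by linarith
    show "degree (0::complex poly) < card (cis ` X)" using assms(3) c by simp
    fix z assume "z \<in> cis ` X"
    then obtain t where t: "t \<in> X" "z = cis t" by auto
    have "laurent n ?Q t = 0" unfolding laurent_self_reflect[OF assms(1)] using assms(4)[OF t(1)] by simp
    then show "poly ?Q z = poly 0 z" unfolding t(2) poly_cis[of _ _ n] by (simp add: laurent_zero)
  qed
  then have "complex_of_real (2 * trig n P s) = 0"
    using laurent_self_reflect[OF assms(1), of s] by (simp add: laurent_zero)
  then show ?thesis by simp
qed

text \<open>From d/dt (z^(-n) P) = i z^(-n) (z P' - n P) at z = cis t. Derivatives keep the form
  \<open>laurent n\<close> and the degree bound, so the zero count applies to them too.\<close>

definition tderiv :: "nat \<Rightarrow> complex poly \<Rightarrow> complex poly" where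
  "tderiv n P = smult \<i> (pCons 0 (pderiv P) - smult (of_nat n) P)"

lemma degree_tderiv: "degree P \<le> m \<Longrightarrow> degree (tderiv n P) \<le> m"
proof -
  assume a: "degree P \<le> m"
  have "degree (pCons 0 (pderiv P)) \<le> m"
    using a by (cases "pderiv P = 0") (auto simp: degree_pderiv pderiv_eq_0_iff)
  then show ?thesis
    unfolding tderiv_def using a
    by (auto intro!: order_trans[OF degree_smult_le] degree_diff_le)
qed

lemma laurent_tderiv:
  "laurent n (tderiv n P) t = \<i> * (cis (- (real n * t)) * (cis t * poly (pderiv P) (cis t)) - of_nat n * laurent n P t)"
  by (simp add: laurent_def tderiv_def algebra_simps)

lemma laurent_has_vector_derivative:
  "(laurent n P has_vector_derivative laurent n (tderiv n P) t) (at t)"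
proof -
  define f where "f z = exp (- (\<i> * of_nat n * z)) * poly P (exp (\<i> * z))" for z
  have "laurent n P = (\<lambda>x. f (complex_of_real x))"
    by (simp add: fun_eq_iff f_def laurent_def cis_conv_exp mult.assoc)
  moreover have "(f has_field_derivative laurent n (tderiv n P) t) (at (complex_of_real t))"
    unfolding f_def laurent_tderiv
    by (auto intro!: derivative_eq_intros poly_DERIV[THEN DERIV_chain2]
        simp: laurent_def cis_conv_exp algebra_simps)
  ultimately show ?thesis by (simp add: has_vector_derivative_real_field)
qed

lemma trig_has_derivative:
  "(trig n P has_real_derivative trig n (tderiv n P) t) (at t)"
proof -
  have "((\<lambda>x. Re (laurent n P x)) has_vector_derivative Re (laurent n (tderiv n P) t)) (at t)"
    by (rule bounded_linear.has_vector_derivative[OF bounded_linear_Re laurent_has_vector_derivative])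
  then show ?thesis
    by (simp add: trig_def[abs_def] has_real_derivative_iff_has_vector_derivative)
qed

lemma continuous_on_trig: "continuous_on S (trig n P)"
  by (intro continuous_at_imp_continuous_on ballI DERIV_isCont[OF trig_has_derivative])

lemma continuous_on_laurent: "continuous_on S (laurent n P)"
  by (intro continuous_at_imp_continuous_on ballI has_vector_derivative_continuous[OF laurent_has_vector_derivative])

lemma laurent_periodic: "laurent n P (t + 2 * pi) = laurent n P t"
proof -
  have "cis (t + 2 * pi) = cis t" by (simp add: complex_eq_iff)
  moreover have "cis (real n * (t + 2 * pi)) = cis (real n * t)"
    by (simp only: Complex.DeMoivre[symmetric] calculation)
  ultimately show ?thesis by (simp add: laurent_def flip: cis_cnj)
qed

lemma trig_periodic: "trig n P (t + 2 * pi) = trig n P t"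
  by (simp add: trig_def laurent_periodic)

section \<open>Zeros of the discriminant\<close>

text \<open>With q = Re (z cnj a) the real part is (1 - q) / |z - a|^2, while |z - a|^2 = 1 + |a|^2
  - 2 q exceeds 2 (1 - q). It is the share of one exterior root in the angular speed of a
  polynomial.\<close>

lemma Re_mobius_le_half:
  assumes "cmod z = 1" "cmod a > 1"
  shows "Re (z / (z - a)) \<le> 1 / 2"
proof -
  have z: "(Re z)\<^sup>2 + (Im z)\<^sup>2 = 1" using assms(1) by (simp add: cmod_power2[symmetric])
  have a: "(Re a)\<^sup>2 + (Im a)\<^sup>2 > 1" using assms(2) by (simp add: cmod_power2[symmetric] one_less_power)
  have "z \<noteq> a" using assms by auto
  then have p: "(cmod (z - a))\<^sup>2 > 0" by simp
  have e: "(cmod (z - a))\<^sup>2 = 1 + ((Re a)\<^sup>2 + (Im a)\<^sup>2) - 2 * (Re z * Re a + Im z * Im a)"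
    using z unfolding cmod_power2 by (simp add: power2_eq_square algebra_simps)
  have "Re (z / (z - a)) = (Re z * Re (z - a) + Im z * Im (z - a)) / (cmod (z - a))\<^sup>2"
    by (simp add: Re_divide cmod_power2)
  also have "Re z * Re (z - a) + Im z * Im (z - a) = 1 - (Re z * Re a + Im z * Im a)"
    using z by (simp add: power2_eq_square algebra_simps)
  also have "\<dots> / (cmod (z - a))\<^sup>2 \<le> 1 / 2"
    using p e a by (simp add: divide_le_eq)
  finally show ?thesis .
qed

text \<open>Splitting off one root at a time turns z D' / D into a sum of terms z / (z - a), each of
  real part at most 1/2.\<close>

lemma Re_log_derivative_le:
  assumes "degree D \<le> m" "\<And>w. cmod w \<le> 1 \<Longrightarrow> poly D w \<noteq> 0" "cmod z = 1"
  shows "Re (z * poly (pderiv D) z / poly D z) \<le> real m / 2"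
  using assms
proof (induction m arbitrary: D)
  case 0
  then have "pderiv D = 0" by (simp add: pderiv_eq_0_iff)
  then show ?case by simp
next
  case (Suc m)
  show ?case
  proof (cases "degree D = 0")
    case True
    then have "pderiv D = 0" by (simp add: pderiv_eq_0_iff)
    then show ?thesis by simp
  next
    case False
    then obtain a where a: "poly D a = 0"
      using fundamental_theorem_of_algebra[of D] by (auto simp: constant_degree)
    then obtain q where q: "D = [:-a, 1:] * q" by (auto simp: poly_eq_0_iff_dvd dvd_def)
    have "cmod a > 1" using Suc.prems(2)[of a] a by force
    then have az: "z - a \<noteq> 0" using Suc.prems(3) by auto
    have qn: "poly q w \<noteq> 0" if "cmod w \<le> 1" for w using Suc.prems(2)[OF that] q by simp
    have "q \<noteq> 0" using qn[of 0] by auto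
    then have "degree q \<le> m" using Suc.prems(1) by (simp add: q degree_mult_eq del: mult_pCons_left)
    then have IH: "Re (z * poly (pderiv q) z / poly q z) \<le> real m / 2"
      by (rule Suc.IH[OF _ qn Suc.prems(3)])
    have "pderiv D = q + [:-a, 1:] * pderiv q"
      unfolding q pderiv_mult by (simp add: pderiv_pCons)
    then have "poly (pderiv D) z = poly (q + [:-a, 1:] * pderiv q) z" by (rule arg_cong)
    also have "\<dots> = poly q z + (z - a) * poly (pderiv q) z" by (simp add: algebra_simps)
    finally have "poly (pderiv D) z = poly q z + (z - a) * poly (pderiv q) z" .
    moreover have "poly D z = (z - a) * poly q z" unfolding q by (simp add: algebra_simps)
    ultimately have "z * poly (pderiv D) z / poly D z = z / (z - a) + z * poly (pderiv q) z / poly q z"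
      using qn[of z] Suc.prems(3) az by (simp add: add_divide_distrib distrib_left)
    then show ?thesis
      using IH Re_mobius_le_half[OF Suc.prems(3) \<open>cmod a > 1\<close>] by (simp add: field_simps)
  qed
qed

text \<open>The phase of \<open>z\<^sup>-\<^sup>nD\<close> decreases along the circle: its speed is \<open>Re (zD'/D) - n < 0\<close>.\<close>

lemma trig_zero_crossing:
  assumes "n \<ge> 1" "degree D \<le> 2 * n - 1" "\<And>w. cmod w \<le> 1 \<Longrightarrow> poly D w \<noteq> 0" "trig n D t = 0"
  shows "Im (laurent n D t) * trig n (tderiv n D) t > 0"
proof -
  let ?y = "Im (laurent n D t)" and ?q = "cis t * poly (pderiv D) (cis t) / poly D (cis t)"
  have Dn: "poly D (cis t) \<noteq> 0" using assms(3) by simp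
  have L: "laurent n D t = \<i> * ?y" using assms(4) by (simp add: complex_eq_iff trig_def)
  have "?y \<noteq> 0"
  proof
    assume "?y = 0"
    then have "laurent n D t = 0" using assms(4) by (simp add: complex_eq_iff trig_def)
    then show False using norm_laurent[of n D t] Dn by simp
  qed
  have "cis (- (real n * t)) * (cis t * poly (pderiv D) (cis t)) = laurent n D t * ?q"
    using Dn by (simp add: laurent_def)
  then have "laurent n (tderiv n D) t = \<i> * laurent n D t * (?q - of_nat n)"
    unfolding laurent_tderiv by (simp add: algebra_simps)
  also have "\<i> * laurent n D t = complex_of_real (- ?y)"
    by (subst L) (simp add: mult.assoc[symmetric])
  finally have e: "laurent n (tderiv n D) t = complex_of_real (- ?y) * (?q - of_nat n)" .
  have "Re (complex_of_real (- y) * (q - of_nat n)) = y * (real n - Re q)" for y q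
    by (simp add: algebra_simps)
  then have "trig n (tderiv n D) t = ?y * (real n - Re ?q)"
    unfolding trig_def e .
  \<comment> \<open>Degree 2 n - 1 instead of 2 n matters: the bound is n - 1/2, strictly below
    n.\<close>
  moreover have "Re ?q \<le> real (2 * n - 1) / 2"
    using Re_log_derivative_le[OF assms(2,3), of "cis t"] by simp
  then have "real n - Re ?q > 0" using assms(1) by (simp add: of_nat_diff)
  ultimately show ?thesis
    using \<open>?y \<noteq> 0\<close> by (simp add: mult.assoc[symmetric] power2_eq_square[symmetric])
qed

lemma card_roots_rsquarefree:
  fixes P :: "complex poly"
  assumes "rsquarefree P"
  shows "card {z. poly P z = 0} = degree P"
proof -
  have "P \<noteq> 0" using assms by (auto simp: rsquarefree_def)
  then have "degree (smult (lead_coeff P) (\<Prod>z|poly P z = 0. [:-z, 1:])) = card {z. poly P z = 0}"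
    by (simp add: degree_prod_sum_eq)
  then show ?thesis unfolding complex_poly_decompose_rsquarefree[OF assms] by simp
qed

text \<open>Inside the disk the reflection is at most |z| |D| < |D| in modulus, so the sum cannot
  vanish; zeros outside would be mirrored inside; zeros on the circle are simple because Delta
  crosses 0 with nonzero speed. The top coefficient is cnj (D(0)), so the degree and the number of
  zeros are exactly 2 n.\<close>

lemma reflection_sum_roots:
  assumes "n \<ge> 1" "degree D \<le> 2 * n - 1" "\<And>w. cmod w \<le> 1 \<Longrightarrow> poly D w \<noteq> 0"
  shows "poly (D + creflect (2 * n) D) z = 0 \<Longrightarrow> cmod z = 1"
    and "card {z. poly (D + creflect (2 * n) D) z = 0} = 2 * n"
proof -
  let ?P = "D + creflect (2 * n) D"
  have dD: "degree D \<le> 2 * n" using assms(2) by linarith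
  \<comment> \<open>Since \<open>D\<close> has degree below 2 n, its reflection of order 2 n has a
    spare factor z; this gives strictness inside the disk.\<close>
  have refl: "creflect (2 * n) D = pCons 0 (creflect (2 * n - 1) D)"
  proof (rule poly_eqI)
    fix i
    show "coeff (creflect (2 * n) D) i = coeff (pCons 0 (creflect (2 * n - 1) D)) i"
      using assms(1,2) by (cases i) (auto simp: coeff_creflect coeff_eq_0 Suc_diff_le)
  qed
  have inside: "poly ?P w \<noteq> 0" if w: "cmod w < 1" for w
  proof -
    have e: "cmod (poly (creflect (2 * n - 1) D) z) = cmod (poly D z)" if "cmod z = 1" for z
      using that by (subst poly_creflect_circle[OF assms(2)]) (auto simp: norm_mult norm_power)
    have "cmod (poly (creflect (2 * n - 1) D) w) \<le> 1 * cmod (poly D w)"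
      by (rule max_modulus_poly[OF assms(3)])
        (use w e in auto)
    then have "cmod (poly (creflect (2 * n) D) w) \<le> cmod w * cmod (poly D w)"
      by (simp add: refl norm_mult mult_left_mono)
    also have "\<dots> < 1 * cmod (poly D w)"
      using w assms(3)[of w] by (intro mult_strict_right_mono) auto
    finally have "cmod (poly (creflect (2 * n) D) w) < cmod (poly D w)" by simp
    then have "poly (creflect (2 * n) D) w \<noteq> - poly D w" by auto
    then show ?thesis by (simp add: add_eq_0_iff)
  qed
  have sym: "poly ?P w = w ^ (2 * n) * cnj (poly ?P (1 / cnj w))" if "w \<noteq> 0" for w
  proof -
    have "creflect (2 * n) ?P = ?P"
      by (rule poly_eqI) (use dD in \<open>auto simp: coeff_creflect coeff_eq_0\<close>)
    moreover have "degree ?P \<le> 2 * n" using dD degree_creflect by (rule degree_add_le)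
    ultimately show ?thesis using poly_creflect[of ?P "2 * n" w] that by simp
  qed
  have unit: "cmod w = 1" if w: "poly ?P w = 0" for w
  proof (rule ccontr)
    assume "cmod w \<noteq> 1"
    then have g: "cmod w > 1" using inside[of w] w by force
    then have "w \<noteq> 0" by auto
    moreover have "cmod (1 / cnj w) < 1" using g by (simp add: norm_divide divide_less_eq)
    ultimately show False using sym[of w] inside[of "1 / cnj w"] w by (simp del: poly_add)
  qed
  then show "poly ?P z = 0 \<Longrightarrow> cmod z = 1" by blast
  have D0: "coeff D 0 \<noteq> 0" using assms(3)[of 0] by (simp add: poly_0_coeff_0)
  have "coeff ?P (2 * n) = cnj (coeff D 0)"
    using assms(1,2) by (simp add: coeff_creflect coeff_eq_0)
  then have "degree ?P \<ge> 2 * n" using D0 by (intro le_degree) simp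
  moreover have "degree ?P \<le> 2 * n" using dD degree_creflect by (rule degree_add_le)
  ultimately have deg: "degree ?P = 2 * n" by simp
  have "?P \<noteq> 0" using deg assms(1) by auto
  have sf: "rsquarefree ?P"
    unfolding rsquarefree_roots
  proof (intro allI notI, elim conjE)
    fix w assume w: "poly ?P w = 0" "poly (pderiv ?P) w = 0"
    then obtain t where t: "w = cis t" using unit
      by (metis cis_Arg norm_eq_zero sgn_eq div_by_1 of_real_1 zero_neq_one)
    have L: "laurent n ?P t = 0" using w t by (simp add: laurent_def)
    then have tr: "trig n D t = 0" using laurent_self_reflect[OF dD, of t] by simp
    have "laurent n (tderiv n ?P) t = 0"
      unfolding laurent_tderiv using w t L by simp
    moreover have "laurent n ?P = (\<lambda>t. complex_of_real (2 * trig n D t))"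
      using laurent_self_reflect[OF dD] by blast
    then have "((\<lambda>t. complex_of_real (2 * trig n D t)) has_vector_derivative laurent n (tderiv n ?P) t) (at t)"
      using laurent_has_vector_derivative[of n ?P t] by simp
    ultimately have "((\<lambda>t. complex_of_real (2 * trig n D t)) has_vector_derivative 0) (at t)" by simp
    then have "((\<lambda>t. Re (complex_of_real (2 * trig n D t))) has_vector_derivative Re 0) (at t)"
      by (rule bounded_linear.has_vector_derivative[OF bounded_linear_Re])
    then have "((\<lambda>t. 2 * trig n D t) has_real_derivative 0) (at t)"
      by (simp add: has_real_derivative_iff_has_vector_derivative)
    moreover have "((\<lambda>t. 2 * trig n D t) has_real_derivative 2 * trig n (tderiv n D) t) (at t)"
      by (rule DERIV_cmult[OF trig_has_derivative])
    ultimately have "trig n (tderiv n D) t = 0" using DERIV_unique by fastforce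
    then show False using trig_zero_crossing[OF assms tr] by simp
  qed
  show "card {z. poly ?P z = 0} = 2 * n"
    using card_roots_rsquarefree[OF sf] deg by simp
qed

lemma finite_set_strict_enumeration:
  fixes Z :: "'a::linorder set"
  assumes "finite Z"
  shows "\<exists>t. t ` {..<card Z} = Z \<and> (\<forall>i j. i < j \<longrightarrow> j < card Z \<longrightarrow> t i < t j)"
proof (intro exI conjI allI impI)
  let ?xs = "sorted_list_of_set Z"
  have "set ?xs = (!) ?xs ` {..<length ?xs}" by (auto simp: set_conv_nth)
  then show "(!) ?xs ` {..<card Z} = Z" using assms by simp
  show "?xs ! i < ?xs ! j" if "i < j" "j < card Z" for i j
    using that by (intro sorted_wrt_nth_less[OF strict_sorted_list_of_set]) auto
qed

text \<open>The extra point t(2 n) = t(0) + 2 pi closes the period, so the cells between consecutive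
  points cover it. Zeros are listed in [0, 2 pi) and then transported to the window starting at
  t(0).\<close>

lemma trig_zeros_enumerate:
  assumes "n \<ge> 1" "degree D \<le> 2 * n - 1" "\<And>w. cmod w \<le> 1 \<Longrightarrow> poly D w \<noteq> 0"
  obtains t where "\<And>i j. i < j \<Longrightarrow> j \<le> 2 * n \<Longrightarrow> t i < t j" "t (2 * n) = t 0 + 2 * pi"
    "\<And>j. j \<le> 2 * n \<Longrightarrow> trig n D (t j) = 0"
    "\<And>s. t 0 \<le> s \<Longrightarrow> s < t 0 + 2 * pi \<Longrightarrow> trig n D s = 0 \<Longrightarrow> \<exists>j<2*n. s = t j"
proof -
  let ?P = "D + creflect (2 * n) D"
  have dD: "degree D \<le> 2 * n" using assms(2) by linarith
  define Z where "Z = {t \<in> {0..<2*pi}. trig n D t = 0}"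
  have zero_iff: "poly ?P (cis t) = 0 \<longleftrightarrow> trig n D t = 0" for t
    using laurent_self_reflect[OF dD, of t] unfolding poly_cis[of _ _ n] by simp
  have "cis ` Z = {z. poly ?P z = 0}"
  proof (intro equalityI subsetI)
    fix z assume z: "z \<in> {z. poly ?P z = 0}"
    then have "cmod z = 1" using reflection_sum_roots(1)[OF assms] by blast
    then have e: "z = cis (Arg2pi z)" using Arg2pi_eq[of z] by (simp add: cis_conv_exp)
    moreover have "Arg2pi z \<in> Z"
      using z zero_iff[of "Arg2pi z"] e Arg2pi_ge_0[of z] Arg2pi_lt_2pi[of z] by (simp add: Z_def)
    ultimately show "z \<in> cis ` Z" by blast
  next
    fix z assume "z \<in> cis ` Z"
    then show "z \<in> {z. poly ?P z = 0}" using zero_iff by (auto simp: Z_def simp del: poly_add)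
  qed
  moreover have inj: "inj_on cis Z" by (rule inj_on_cis[of _ 0]) (auto simp: Z_def)
  ultimately have cZ: "card Z = 2 * n" using reflection_sum_roots(2)[OF assms] card_image by metis
  then have "finite Z" using assms(1) by (intro card_ge_0_finite) simp
  then obtain t' where t': "t' ` {..<card Z} = Z" "\<And>i j. i < j \<Longrightarrow> j < card Z \<Longrightarrow> t' i < t' j"
    using finite_set_strict_enumeration by metis
  note t' = t'[unfolded cZ]
  define t where "t j = (if j < 2 * n then t' j else t' 0 + 2 * pi)" for j
  have tZ: "t j \<in> Z" if "j < 2 * n" for j using that t'(1) by (auto simp: t_def)
  have t0: "t 0 = t' 0" using assms(1) by (simp add: t_def)
  show ?thesis
  proof
    show "t (2 * n) = t 0 + 2 * pi" using t0 by (simp add: t_def)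
    show "t i < t j" if "i < j" "j \<le> 2 * n" for i j
    proof (cases "j < 2 * n")
      case True
      then show ?thesis using that t'(2) by (simp add: t_def)
    next
      case False
      then have "t j = t 0 + 2 * pi" using t0 by (simp add: t_def)
      moreover have "t i < 2 * pi" "0 \<le> t 0" using tZ[of i] tZ[of 0] that assms(1) by (auto simp: Z_def)
      ultimately show ?thesis by linarith
    qed
    show "trig n D (t j) = 0" if "j \<le> 2 * n" for j
    proof (cases "j < 2 * n")
      case True
      then show ?thesis using tZ by (simp add: Z_def)
    next
      case False
      then have "t j = t 0 + 2 * pi" using t0 by (simp add: t_def)
      then show ?thesis using tZ[of 0] assms(1) by (simp add: Z_def trig_periodic)
    qed
    show "\<exists>j<2*n. s = t j" if s: "t 0 \<le> s" "s < t 0 + 2 * pi" "trig n D s = 0" for s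
    proof (cases "s < 2 * pi")
      case True
      moreover have "t 0 \<ge> 0" using tZ[of 0] assms(1) by (auto simp: Z_def)
      ultimately have "s \<in> Z" using s by (simp add: Z_def)
      then obtain j where "j < 2 * n" "s = t' j" using t'(1) by auto
      then show ?thesis by (intro exI[of _ j]) (simp add: t_def)
    next
      case False
      have "trig n D (s - 2 * pi) = 0" using trig_periodic[of n D "s - 2 * pi"] s(3) by simp
      moreover have "t 0 < 2 * pi" using tZ[of 0] assms(1) by (auto simp: Z_def)
      ultimately have "s - 2 * pi \<in> Z" using False s(2) by (simp add: Z_def)
      then obtain j where "j < 2 * n" "s - 2 * pi = t' j" using t'(1) by auto
      moreover have "t 0 \<le> t' j" using t'(2)[of 0 j] \<open>j < 2 * n\<close> t0 by (cases "j = 0") auto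
      ultimately show ?thesis using s(2) by linarith
    qed
  qed
qed

section \<open>Bands and gaps\<close>

lemma continuous_nonzero_same_sign:
  fixes f :: "real \<Rightarrow> real"
  assumes "continuous_on {a<..<b} f" "\<And>s. a < s \<Longrightarrow> s < b \<Longrightarrow> f s \<noteq> 0"
    and "a < x" "x < b" "f x > 0" "a < y" "y < b"
  shows "f y > 0"
proof (rule ccontr)
  assume "\<not> f y > 0"
  then have y: "f y \<le> 0" by simp
  have "connected (f ` {a<..<b})" using assms(1) by (intro connected_continuous_image) auto
  then have "0 \<in> f ` {a<..<b}"
    using assms(3-7) y by (intro connectedD_interval[of _ "f y" "f x" 0]) auto
  then show False using assms(2) by force
qed

lemma pos_after_zero:
  fixes f :: "real \<Rightarrow> real"
  assumes "(f has_real_derivative d) (at a)" "f a = 0" "d > 0" "a < b"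
    and "continuous_on {a<..<b} f" "\<And>s. a < s \<Longrightarrow> s < b \<Longrightarrow> f s \<noteq> 0" "a < s" "s < b"
  shows "f s > 0"
proof -
  obtain e where e: "e > 0" "\<And>h. h > 0 \<Longrightarrow> h < e \<Longrightarrow> f a < f (a + h)"
    using DERIV_pos_inc_right[OF assms(1,3)] by blast
  define h where "h = min (e / 2) ((b - a) / 2)"
  have h: "h > 0" "h < e" "h < b - a" using e(1) assms(4) by (auto simp: h_def min_less_iff_disj)
  then have "f (a + h) > 0" using e(2)[of h] assms(2) by simp
  then show ?thesis
    using continuous_nonzero_same_sign[OF assms(5,6), of "a + h" s] h assms(7,8) by auto
qed

lemma deriv_nonpos_at_right_zero:
  fixes f :: "real \<Rightarrow> real"
  assumes "(f has_real_derivative d) (at b)" "f b = 0" "a < b"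
    and "\<And>s. a < s \<Longrightarrow> s < b \<Longrightarrow> f s > 0"
  shows "d \<le> 0"
proof (rule ccontr)
  assume "\<not> d \<le> 0"
  then obtain e where e: "e > 0" "\<And>h. h > 0 \<Longrightarrow> h < e \<Longrightarrow> f (b - h) < f b"
    using DERIV_pos_inc_left[OF assms(1)] by (meson not_le)
  define h where "h = min (e / 2) ((b - a) / 2)"
  have h: "h > 0" "h < e" "h < b - a" using e(1) assms(3) by (auto simp: h_def min_less_iff_disj)
  then show False using e(2)[of h] assms(2) assms(4)[of "b - h"] by simp
qed

lemma strict_mono_intervals:
  fixes t :: "nat \<Rightarrow> real"
  assumes "\<And>i j. i < j \<Longrightarrow> j \<le> m \<Longrightarrow> t i < t j" "i \<le> j" "j \<le> m"
  shows "t i \<le> t j"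
  using assms(1)[of i j] assms(2,3) by (cases "i = j") auto

text \<open>Pigeonhole: one zero in each cell already exhausts the 2 n zeros allowed in a period, so
  a second one in some cell would make the trigonometric polynomial vanish identically.\<close>

lemma trig_zero_unique_in_interval:
  fixes t :: "nat \<Rightarrow> real"
  assumes deg: "degree P \<le> 2 * n"
    and mono: "\<And>i j. i < j \<Longrightarrow> j \<le> 2 * n \<Longrightarrow> t i < t j" and per: "t (2 * n) = t 0 + 2 * pi"
    and ex: "\<And>j. j < 2 * n \<Longrightarrow> \<exists>s. t j < s \<and> s < t (Suc j) \<and> trig n P s = 0"
    and nz: "trig n P s0 \<noteq> 0"
    and j: "j < 2 * n" and s: "t j < s" "s < t (Suc j)" "trig n P s = 0"
    and s': "t j < s'" "s' < t (Suc j)" "trig n P s' = 0"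
  shows "s = s'"
proof (rule ccontr)
  assume "s \<noteq> s'"
  obtain c where c: "\<And>j. j < 2 * n \<Longrightarrow> t j < c j \<and> c j < t (Suc j) \<and> trig n P (c j) = 0"
    using ex by metis
  define d where "d i = (if i = j then s else c i)" for i
  have d: "t i < d i \<and> d i < t (Suc i) \<and> trig n P (d i) = 0" if "i < 2 * n" for i
    using c[OF that] s by (auto simp: d_def)
  have dm: "d i < d k" if "i < k" "k < 2 * n" for i k
    using d[of i] d[of k] strict_mono_intervals[of "2 * n" t "Suc i" k, OF mono] that by force
  have "inj_on d {..<2 * n}"
    by (rule inj_onI) (metis dm lessThan_iff less_irrefl nat_neq_iff)
  then have card: "card (d ` {..<2 * n}) = 2 * n" by (simp add: card_image)
  have "s' \<notin> d ` {..<2 * n}"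
  proof
    assume "s' \<in> d ` {..<2 * n}"
    then obtain i where i: "i < 2 * n" "s' = d i" by auto
    consider "i = j" | "i < j" | "j < i" by linarith
    then show False
    proof cases
      case 1
      then show False using i \<open>s \<noteq> s'\<close> by (simp add: d_def)
    next
      case 2
      then show False
        using d[OF i(1)] strict_mono_intervals[of "2 * n" t "Suc i" j, OF mono] j s' i by force
    next
      case 3
      then show False
        using d[OF i(1)] strict_mono_intervals[of "2 * n" t "Suc j" i, OF mono] s' i by force
    qed
  qed
  then have c': "card (insert s' (d ` {..<2 * n})) > 2 * n" using card by simp
  have r: "x \<in> {t 0..<t 0 + 2 * pi}" if "t i < x" "x < t (Suc i)" "i < 2 * n" for x i
    using that strict_mono_intervals[of "2 * n" t 0 i, OF mono]
      strict_mono_intervals[of "2 * n" t "Suc i" "2 * n", OF mono] per by force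
  have "trig n P s0 = 0"
  proof (rule trig_zero_count[OF deg _ c'])
    show "insert s' (d ` {..<2 * n}) \<subseteq> {t 0..<t 0 + 2 * pi}"
      using r[OF s'(1,2) j] r d by blast
    show "trig n P x = 0" if "x \<in> insert s' (d ` {..<2 * n})" for x
      using that d s' by auto
  qed
  then show False using nz by simp
qed

text \<open>A single critical point makes \<open>g\<close> increase and then decrease, so it is at
  least 1 exactly on one interval, possibly a point. With |Delta| / 2 on a cell in the role of
  \<open>g\<close>, this interval is the closed gap.\<close>

lemma bump_superlevel:
  fixes g g' :: "real \<Rightarrow> real"
  assumes ab: "a < b" and der: "\<And>s. (g has_real_derivative g' s) (at s)"
    and cont': "\<And>S. continuous_on S g'"
    and zero: "g a = 0" "g b = 0" and pos: "\<And>s. a < s \<Longrightarrow> s < b \<Longrightarrow> g s > 0"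
    and uniq: "\<And>s s'. a < s \<Longrightarrow> s < b \<Longrightarrow> a < s' \<Longrightarrow> s' < b \<Longrightarrow> g' s = 0 \<Longrightarrow> g' s' = 0 \<Longrightarrow> s = s'"
    and m: "a < m" "m < b" "g m \<ge> 1"
  shows "\<exists>l r. a < l \<and> l \<le> r \<and> r < b \<and> g l = 1 \<and> g r = 1 \<and> (\<forall>s. l < s \<and> s < r \<longrightarrow> g s > 1)
    \<and> (\<forall>s. a \<le> s \<and> s \<le> b \<and> g s \<ge> 1 \<longrightarrow> l \<le> s \<and> s \<le> r)"
proof -
  have cont: "continuous_on S g" for S
    using der by (meson DERIV_isCont continuous_at_imp_continuous_on)
  have "\<exists>c. a < c \<and> c < b \<and> (*) (g' c) = (\<lambda>v. 0)"
    using zero by (intro Rolle_deriv[OF ab _ cont]) (auto simp: der has_field_derivative_imp_has_derivative)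
  then obtain c where c: "a < c" "c < b" "g' c = 0" by (metis mult_1_right)
  have left: "g' s > 0" if s: "a < s" "s < c" for s
  proof -
    obtain x where x: "a < x" "x < c" "g c - g a = (c - a) * g' x"
      using MVT2[OF c(1) der] by blast
    then have "(c - a) * g' x > 0" using pos[OF c(1,2)] zero by simp
    then have "g' x > 0" using c(1) by (simp add: zero_less_mult_iff)
    moreover have "g' u \<noteq> 0" if "a < u" "u < c" for u using uniq[of u c] that c by auto
    ultimately show ?thesis
      using continuous_nonzero_same_sign[OF cont' _ x(1,2) _ s] by blast
  qed
  have right: "g' s < 0" if s: "c < s" "s < b" for s
  proof -
    obtain x where x: "c < x" "x < b" "g b - g c = (b - c) * g' x"
      using MVT2[OF c(2) der] by blast
    then have "(b - c) * g' x < 0" using pos[OF c(1,2)] zero by simp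
    then have "- g' x > 0" using c(2) by (simp add: mult_less_0_iff)
    moreover have "- g' u \<noteq> 0" if "c < u" "u < b" for u using uniq[of u c] that c by auto
    moreover have "continuous_on {c<..<b} (\<lambda>x. - g' x)" using cont' by (intro continuous_intros)
    ultimately have "- g' s > 0"
      using continuous_nonzero_same_sign[of c b "\<lambda>x. - g' x" x s] x(1,2) s by blast
    then show ?thesis by simp
  qed
  have inc: "g s < g s'" if "a \<le> s" "s < s'" "s' \<le> c" for s s'
    using that left der by (intro DERIV_pos_imp_increasing_open[OF that(2) _ cont]) (meson less_le_trans le_less_trans)
  have dec: "g s > g s'" if "c \<le> s" "s < s'" "s' \<le> b" for s s'
    using that right der by (intro DERIV_neg_imp_decreasing_open[OF that(2) _ cont]) (meson less_le_trans le_less_trans)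
  have gc: "g c \<ge> 1"
    using inc[of m c] dec[of c m] m by (cases m c rule: linorder_cases) auto
  obtain l where l: "a \<le> l" "l \<le> c" "g l = 1"
    using IVT'[of g a 1 c] gc zero c cont by auto
  obtain r where r: "c \<le> r" "r \<le> b" "g r = 1"
    using IVT2'[of g b 1 c] gc zero c cont by auto
  have "a \<noteq> l" "r \<noteq> b" using l r zero by auto
  moreover have "g s > 1" if "l < s" "s < r" for s
    using inc[of l s] dec[of s r] that l r by (cases "s \<le> c") auto
  moreover have "l \<le> s \<and> s \<le> r" if "a \<le> s" "s \<le> b" "g s \<ge> 1" for s
    using inc[of s l] dec[of r s] that l r by (smt (verit))
  ultimately show ?thesis using l r by (intro exI[of _ l] exI[of _ r]) force
qed

text \<open>With \<open>trig n A = \<Delta>/2\<close>, the \<open>t j\<close> are the zeros of \<open>\<Delta>\<close> (one in each band) and \<open>[l j, r j]\<close> is the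
  closed gap between \<open>t j\<close> and \<open>t (j + 1)\<close>, degenerate if the gap is closed.\<close>

locale band_structure =
  fixes n :: nat and A :: "complex poly" and t l r :: "nat \<Rightarrow> real" and \<sigma> :: real
  assumes n_pos: "n \<ge> 1" and deg_A: "degree A \<le> 2 * n - 1"
    and A_nonzero: "\<And>w. cmod w \<le> 1 \<Longrightarrow> poly A w \<noteq> 0"
    and A_0: "\<exists>x>0. coeff A 0 = complex_of_real x"
    and t_less: "\<And>i j. i < j \<Longrightarrow> j \<le> 2 * n \<Longrightarrow> t i < t j" and t_period: "t (2 * n) = t 0 + 2 * pi"
    and t_zero: "\<And>j. j \<le> 2 * n \<Longrightarrow> trig n A (t j) = 0"
    and sigma: "\<sigma> = 1 \<or> \<sigma> = -1"
    and t_deriv: "\<And>j. j \<le> 2 * n \<Longrightarrow> \<sigma> * (-1) ^ j * trig n (tderiv n A) (t j) > 0"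
    and sign: "\<And>j s. j < 2 * n \<Longrightarrow> t j < s \<Longrightarrow> s < t (Suc j) \<Longrightarrow> \<sigma> * (-1) ^ j * trig n A s > 0"
    and gap_order: "\<And>j. j < 2 * n \<Longrightarrow> t j < l j \<and> l j \<le> r j \<and> r j < t (Suc j)"
    and gap_edge: "\<And>j. j < 2 * n \<Longrightarrow> \<bar>trig n A (l j)\<bar> = 1 \<and> \<bar>trig n A (r j)\<bar> = 1"
    and gap_inside: "\<And>j s. j < 2 * n \<Longrightarrow> l j < s \<Longrightarrow> s < r j \<Longrightarrow> \<bar>trig n A s\<bar> > 1"
    and gap_maximal: "\<And>j s. j < 2 * n \<Longrightarrow> t j \<le> s \<Longrightarrow> s \<le> t (Suc j) \<Longrightarrow> \<bar>trig n A s\<bar> \<ge> 1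
        \<Longrightarrow> l j \<le> s \<and> s \<le> r j"

text \<open>Beyond zero counting, the point is that |Delta| reaches 2 in each cell: Im (z^(-n) A)
  has opposite signs at consecutive zeros of Delta, hence vanishes in between, and there |Delta| / 2
  = |A| >= 1.\<close>

lemma ex_band_structure:
  assumes n: "n \<ge> 1" and deg: "degree A \<le> 2 * n - 1" and nz: "\<And>w. cmod w \<le> 1 \<Longrightarrow> poly A w \<noteq> 0"
    and A0: "\<exists>x>0. coeff A 0 = complex_of_real x"
    and norm: "\<And>z. cmod z = 1 \<Longrightarrow> cmod (poly A z) \<ge> 1"
  shows "\<exists>t l r \<sigma>. band_structure n A t l r \<sigma>"
proof -
  obtain t where t: "\<And>i j. i < j \<Longrightarrow> j \<le> 2 * n \<Longrightarrow> t i < t j" "t (2 * n) = t 0 + 2 * pi"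
    "\<And>j. j \<le> 2 * n \<Longrightarrow> trig n A (t j) = 0"
    "\<And>s. t 0 \<le> s \<Longrightarrow> s < t 0 + 2 * pi \<Longrightarrow> trig n A s = 0 \<Longrightarrow> \<exists>j<2*n. s = t j"
    using trig_zeros_enumerate[OF n deg nz] by blast
  note tm = strict_mono_intervals[of "2 * n" t, OF t(1)]
  let ?h = "trig n A" and ?h' = "trig n (tderiv n A)"
  have nzI: "?h s \<noteq> 0" if "j < 2 * n" "t j < s" "s < t (Suc j)" for j s
  proof
    assume "?h s = 0"
    moreover have "t 0 \<le> s" "s < t 0 + 2 * pi" using tm[of 0 j] tm[of "Suc j" "2 * n"] that t(2) by auto
    ultimately obtain i where i: "i < 2 * n" "s = t i" using t(4) by blast
    then show False using tm[of i j] tm[of "Suc j" i] that by (cases "i \<le> j") auto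
  qed
  have h'nz: "?h' (t j) \<noteq> 0" if "j \<le> 2 * n" for j
    using trig_zero_crossing[OF n deg nz t(3)[OF that]] by auto
  \<comment> \<open>The slope of Delta alternates along its zeros; \<open>\<sigma>\<close> records
    the sign of the first one.\<close>
  define \<sigma> where "\<sigma> = (if ?h' (t 0) > 0 then 1 else -1 :: real)"
  have step: "(\<forall>s. t j < s \<and> s < t (Suc j) \<longrightarrow> e * ?h s > 0) \<and> - e * ?h' (t (Suc j)) > 0"
    if j: "j < 2 * n" and e: "e * ?h' (t j) > 0" for j e
  proof -
    have lt: "t j < t (Suc j)" using t(1) j by simp
    have d: "((\<lambda>s. e * ?h s) has_real_derivative e * ?h' s) (at s)" for s
      by (rule DERIV_cmult[OF trig_has_derivative])
    have p: "e * ?h s > 0" if "t j < s" "s < t (Suc j)" for s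
      using pos_after_zero[OF d _ e lt _ _ that] t(3)[of j] j nzI e
      by (force intro!: continuous_intros continuous_on_trig)
    then have "e * ?h' (t (Suc j)) \<le> 0"
      using deriv_nonpos_at_right_zero[OF d _ lt] t(3)[of "Suc j"] j by simp
    moreover have "e * ?h' (t (Suc j)) \<noteq> 0" using h'nz[of "Suc j"] j e by auto
    ultimately have "- e * ?h' (t (Suc j)) > 0" by linarith
    then show ?thesis using p by blast
  qed
  have dsign: "j \<le> 2 * n \<Longrightarrow> \<sigma> * (-1) ^ j * ?h' (t j) > 0" for j
  proof (induction j)
    case 0
    then show ?case using h'nz[of 0] by (auto simp: \<sigma>_def)
  next
    case (Suc j)
    then show ?case using step[of j "\<sigma> * (-1) ^ j"] by simp
  qed
  have sgn: "\<sigma> * (-1) ^ j * ?h s > 0" if "j < 2 * n" "t j < s" "s < t (Suc j)" for j s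
    using step[of j "\<sigma> * (-1) ^ j"] dsign[of j] that by simp
  have ysign: "\<sigma> * (-1) ^ j * Im (laurent n A (t j)) > 0" if "j \<le> 2 * n" for j
  proof -
    have "Im (laurent n A (t j)) * ?h' (t j) > 0"
      using trig_zero_crossing[OF n deg nz t(3)[OF that]] .
    then show ?thesis using dsign[OF that] by (simp add: zero_less_mult_iff) (smt (verit))
  qed
  have sq: "\<sigma> * (-1) ^ j = 1 \<or> \<sigma> * (-1) ^ j = -1" for j
    by (cases "even j") (auto simp: \<sigma>_def)
  have big: "\<exists>m. t j < m \<and> m < t (Suc j) \<and> \<bar>?h m\<bar> \<ge> 1" if j: "j < 2 * n" for j
  proof -
    let ?f = "\<lambda>s. \<sigma> * (-1) ^ j * Im (laurent n A s)"
    have "?f (t j) > 0" "?f (t (Suc j)) < 0" using ysign[of j] ysign[of "Suc j"] j by auto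
    moreover have "continuous_on {t j..t (Suc j)} ?f"
      by (intro continuous_intros continuous_on_laurent)
    ultimately obtain m where m: "t j \<le> m" "m \<le> t (Suc j)" "?f m = 0"
      using IVT2'[of ?f "t (Suc j)" 0 "t j"] t(1)[of j "Suc j"] j by force
    then have "m \<noteq> t j" "m \<noteq> t (Suc j)" using \<open>?f (t j) > 0\<close> \<open>?f (t (Suc j)) < 0\<close> by auto
    moreover have "Im (laurent n A m) = 0" using m(3) sq[of j] by auto
    then have "cmod (laurent n A m) = \<bar>?h m\<bar>" by (simp add: cmod_def trig_def)
    then have "\<bar>?h m\<bar> \<ge> 1" using norm[of "cis m"] by (simp add: norm_laurent)
    ultimately show ?thesis using m by (intro exI[of _ m]) auto
  qed
  have dA: "degree (tderiv n A) \<le> 2 * n" using deg by (intro degree_tderiv) simp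
  have rolle: "\<exists>s. t j < s \<and> s < t (Suc j) \<and> ?h' s = 0" if j: "j < 2 * n" for j
  proof -
    have lt: "t j < t (Suc j)" using t(1) j by simp
    have "\<exists>c. t j < c \<and> c < t (Suc j) \<and> (*) (?h' c) = (\<lambda>v. 0)"
      using t(3)[of j] t(3)[of "Suc j"] j
      by (intro Rolle_deriv[OF lt _ continuous_on_trig])
         (auto intro: has_field_derivative_imp_has_derivative[OF trig_has_derivative])
    then show ?thesis by (metis mult_1_right)
  qed
  \<comment> \<open>Rolle gives the derivative a zero in each cell, and the zero count leaves no
    room for another.\<close>
  have uniq: "s = s'" if "j < 2 * n" "t j < s" "s < t (Suc j)" "?h' s = 0"
      "t j < s'" "s' < t (Suc j)" "?h' s' = 0" for j s s'
    using trig_zero_unique_in_interval[OF dA t(1,2) rolle h'nz[of 0] that] by simp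
  have "\<exists>l r. t j < l \<and> l \<le> r \<and> r < t (Suc j) \<and> \<bar>?h l\<bar> = 1 \<and> \<bar>?h r\<bar> = 1
      \<and> (\<forall>s. l < s \<and> s < r \<longrightarrow> \<bar>?h s\<bar> > 1)
      \<and> (\<forall>s. t j \<le> s \<and> s \<le> t (Suc j) \<and> \<bar>?h s\<bar> \<ge> 1 \<longrightarrow> l \<le> s \<and> s \<le> r)" if j: "j < 2 * n" for j
  proof -
    let ?e = "\<sigma> * (-1) ^ j"
    let ?g = "\<lambda>s. ?e * ?h s"
    have lt: "t j < t (Suc j)" using t(1) j by simp
    have z: "?g (t j) = 0" "?g (t (Suc j)) = 0" using t(3)[of j] t(3)[of "Suc j"] j by auto
    have ab: "?g s = \<bar>?h s\<bar>" if "t j \<le> s" "s \<le> t (Suc j)" for s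
    proof -
      have "?g s \<ge> 0" using sgn[OF j, of s] z that by (cases "s = t j \<or> s = t (Suc j)") force+
      moreover have "\<bar>?g s\<bar> = \<bar>?h s\<bar>" using sq[of j] by auto
      ultimately show ?thesis by simp
    qed
    obtain m where m: "t j < m" "m < t (Suc j)" "\<bar>?h m\<bar> \<ge> 1" using big[OF j] by blast
    have "\<exists>l r. t j < l \<and> l \<le> r \<and> r < t (Suc j) \<and> ?g l = 1 \<and> ?g r = 1 \<and> (\<forall>s. l < s \<and> s < r \<longrightarrow> ?g s > 1)
      \<and> (\<forall>s. t j \<le> s \<and> s \<le> t (Suc j) \<and> ?g s \<ge> 1 \<longrightarrow> l \<le> s \<and> s \<le> r)"
    proof (rule bump_superlevel[OF lt, where g' = "\<lambda>s. ?e * ?h' s"])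
      show "(?g has_real_derivative ?e * ?h' s) (at s)" for s
        by (rule DERIV_cmult[OF trig_has_derivative])
      show "continuous_on S (\<lambda>s. ?e * ?h' s)" for S by (intro continuous_intros continuous_on_trig)
      show "?g m \<ge> 1" using m ab by simp
      show "s = s'" if "t j < s" "s < t (Suc j)" "t j < s'" "s' < t (Suc j)"
          "?e * ?h' s = 0" "?e * ?h' s' = 0" for s s'
        using uniq[OF j that(1,2) _ that(3,4)] that sq[of j] by auto
    qed (use z m sgn[OF j] in auto)
    then obtain l r where lr: "t j < l" "l \<le> r" "r < t (Suc j)" "?g l = 1" "?g r = 1"
      "\<And>s. l < s \<Longrightarrow> s < r \<Longrightarrow> ?g s > 1"
      "\<And>s. t j \<le> s \<Longrightarrow> s \<le> t (Suc j) \<Longrightarrow> ?g s \<ge> 1 \<Longrightarrow> l \<le> s \<and> s \<le> r" by blast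
    show ?thesis
    proof (intro exI conjI allI impI)
      show "\<bar>?h l\<bar> = 1" "\<bar>?h r\<bar> = 1" using ab[of l] ab[of r] lr by auto
      show "\<bar>?h s\<bar> > 1" if "l < s \<and> s < r" for s using ab[of s] lr that by force
      show "l \<le> s" "s \<le> r" if "t j \<le> s \<and> s \<le> t (Suc j) \<and> \<bar>?h s\<bar> \<ge> 1" for s
        using ab[of s] lr(7)[of s] that by auto
    qed (use lr in auto)
  qed
  then obtain l r where lr: "\<And>j. j < 2 * n \<Longrightarrow> t j < l j \<and> l j \<le> r j \<and> r j < t (Suc j)
      \<and> \<bar>?h (l j)\<bar> = 1 \<and> \<bar>?h (r j)\<bar> = 1 \<and> (\<forall>s. l j < s \<and> s < r j \<longrightarrow> \<bar>?h s\<bar> > 1)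
      \<and> (\<forall>s. t j \<le> s \<and> s \<le> t (Suc j) \<and> \<bar>?h s\<bar> \<ge> 1 \<longrightarrow> l j \<le> s \<and> s \<le> r j)"
    by metis
  have "band_structure n A t l r \<sigma>"
    by unfold_locales (use n deg nz A0 t dsign sgn lr in \<open>auto simp: \<sigma>_def\<close>)
  then show ?thesis by blast
qed

section \<open>Lagrange interpolation on the circle\<close>

lemma cis_diff: "cis a - cis b = 2 * \<i> * complex_of_real (sin ((a - b) / 2)) * cis ((a + b) / 2)"
proof -
  have "sin ((b - a) / 2) = - sin ((a - b) / 2)"
    by (metis minus_diff_eq minus_divide_left sin_minus)
  then show ?thesis
    by (intro complex_eqI) (simp_all add: cos_diff_cos sin_diff_sin)
qed

lemma Re_cayley_neg:
  assumes "cmod \<zeta> = 1" "cmod z < 1"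
  shows "Re (\<zeta> / (z - \<zeta>)) < 0"
proof -
  have "z \<noteq> \<zeta>" using assms by auto
  then have p: "(cmod (z - \<zeta>))\<^sup>2 > 0" by simp
  have "Re (\<zeta> / (z - \<zeta>)) = (Re \<zeta> * Re (z - \<zeta>) + Im \<zeta> * Im (z - \<zeta>)) / (cmod (z - \<zeta>))\<^sup>2"
    by (simp add: Re_divide cmod_power2)
  moreover have "Re \<zeta> * Re (z - \<zeta>) + Im \<zeta> * Im (z - \<zeta>) = Re (cnj \<zeta> * z) - (cmod \<zeta>)\<^sup>2"
    unfolding cmod_power2 by (simp add: power2_eq_square algebra_simps)
  moreover have "Re (cnj \<zeta> * z) < 1"
    using complex_Re_le_cmod[of "cnj \<zeta> * z"] assms by (simp add: norm_mult)
  ultimately show ?thesis using p assms(1) by (simp add: divide_less_0_iff)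
qed

definition lagr :: "nat \<Rightarrow> (nat \<Rightarrow> real) \<Rightarrow> nat \<Rightarrow> complex poly" where
  "lagr p \<theta> j = (\<Prod>k\<in>{..<p} - {j}. [:- cis (\<theta> k), 1:])"

text \<open>A chord cis a - cis b is 2 i sin ((a - b) / 2) times a phase, so on the circle a
  Lagrange polynomial is this real product times phases; \<open>lagr_const\<close> collects those
  depending on the nodes only. Half angles make the sign depend on the representatives modulo 2 pi,
  hence the ordering assumptions of \<open>circle_points\<close>.\<close>

definition sinprod :: "nat \<Rightarrow> (nat \<Rightarrow> real) \<Rightarrow> nat \<Rightarrow> real \<Rightarrow> real" where
  "sinprod p \<theta> j \<tau> = (\<Prod>k\<in>{..<p} - {j}. sin ((\<tau> - \<theta> k) / 2))"

definition lagr_const :: "nat \<Rightarrow> (nat \<Rightarrow> real) \<Rightarrow> nat \<Rightarrow> complex" where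
  "lagr_const p \<theta> j = (\<Prod>k\<in>{..<p} - {j}. 2 * \<i> * cis (\<theta> k / 2))"

definition interp :: "nat \<Rightarrow> (nat \<Rightarrow> real) \<Rightarrow> (nat \<Rightarrow> complex) \<Rightarrow> complex poly" where
  "interp p \<theta> e = (\<Sum>j<p. smult (e j / poly (lagr p \<theta> j) (cis (\<theta> j))) (lagr p \<theta> j))"

lemma lagr_const_nonzero: "lagr_const p \<theta> j \<noteq> 0"
  by (simp add: lagr_const_def)

lemma poly_lagr_cis:
  assumes "j < p"
  shows "poly (lagr p \<theta> j) (cis \<tau>)
    = lagr_const p \<theta> j * cis (\<tau> / 2) ^ (p - 1) * complex_of_real (sinprod p \<theta> j \<tau>)"
proof -
  have "poly (lagr p \<theta> j) (cis \<tau>) = (\<Prod>k\<in>{..<p} - {j}. cis \<tau> - cis (\<theta> k))"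
    by (simp add: lagr_def poly_prod)
  also have "\<dots> = (\<Prod>k\<in>{..<p} - {j}. (2 * \<i> * cis (\<theta> k / 2)) * cis (\<tau> / 2)
      * complex_of_real (sin ((\<tau> - \<theta> k) / 2)))"
    unfolding cis_diff by (intro prod.cong refl) (simp add: add_divide_distrib cis_mult[symmetric])
  also have "\<dots> = lagr_const p \<theta> j * cis (\<tau> / 2) ^ (p - 1) * complex_of_real (sinprod p \<theta> j \<tau>)"
    using assms by (simp add: lagr_const_def sinprod_def prod.distrib)
  finally show ?thesis .
qed

lemma degree_lagr: "j < p \<Longrightarrow> degree (lagr p \<theta> j) \<le> p - 1"
  by (simp add: lagr_def degree_prod_sum_eq)

lemma degree_interp: "degree (interp p \<theta> e) \<le> p - 1"
  unfolding interp_def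
  by (intro degree_sum_le) (auto intro!: order_trans[OF degree_smult_le] degree_lagr simp del: One_nat_def)

text \<open>Nodes inside one period have half differences in (-pi, pi), where the sine has the sign
  of its argument.\<close>

locale circle_points =
  fixes p :: nat and \<theta> :: "nat \<Rightarrow> real"
  assumes theta_less: "\<And>i j. i < j \<Longrightarrow> j < p \<Longrightarrow> \<theta> i < \<theta> j"
    and theta_window: "\<And>i j. i < p \<Longrightarrow> j < p \<Longrightarrow> \<theta> j < \<theta> i + 2 * pi"
begin

lemma theta_inj: "i < p \<Longrightarrow> j < p \<Longrightarrow> cis (\<theta> i) = cis (\<theta> j) \<Longrightarrow> i = j"
proof -
  assume a: "i < p" "j < p" "cis (\<theta> i) = cis (\<theta> j)"
  then have "\<theta> i = \<theta> j"
    using theta_window[of i j] theta_window[of j i] by (intro cis_inj) auto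
  then show "i = j" using theta_less[of i j] theta_less[of j i] a by (cases i j rule: linorder_cases) auto
qed

lemma card_cis_theta: "card ((\<lambda>j. cis (\<theta> j)) ` {..<p}) = p"
  using theta_inj by (subst card_image) (auto intro!: inj_onI)

text \<open>Exactly the p - 1 - j factors with k > j are negative.\<close>

lemma sinprod_sign:
  assumes "j < p"
  shows "(-1) ^ (p - 1 - j) * sinprod p \<theta> j (\<theta> j) > 0"
proof -
  have e: "{..<p} - {j} = {..<j} \<union> {j<..<p}" using assms by auto
  have "sinprod p \<theta> j (\<theta> j)
      = (\<Prod>k<j. sin ((\<theta> j - \<theta> k) / 2)) * (\<Prod>k\<in>{j<..<p}. sin ((\<theta> j - \<theta> k) / 2))"
    unfolding sinprod_def e by (rule prod.union_disjoint) auto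
  moreover have "(\<Prod>k<j. sin ((\<theta> j - \<theta> k) / 2)) > 0"
    using assms theta_less theta_window by (intro prod_pos ballI sin_gt_zero) (auto simp: algebra_simps)
  moreover have "(\<Prod>k\<in>{j<..<p}. sin ((\<theta> j - \<theta> k) / 2))
      = (\<Prod>k\<in>{j<..<p}. (-1) * sin ((\<theta> k - \<theta> j) / 2))"
    by (intro prod.cong refl) (metis minus_diff_eq minus_divide_left mult_minus1 sin_minus)
  moreover have "\<dots> = (-1) ^ (p - 1 - j) * (\<Prod>k\<in>{j<..<p}. sin ((\<theta> k - \<theta> j) / 2))"
    by (subst prod.distrib) (simp add: diff_commute)
  moreover have "(\<Prod>k\<in>{j<..<p}. sin ((\<theta> k - \<theta> j) / 2)) > 0"
    using assms theta_less theta_window by (intro prod_pos ballI sin_gt_zero) (auto simp: algebra_simps)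
  moreover have "(-1) ^ m * ((-1::real) ^ m * x) = x" for m x
    by (simp add: mult.assoc[symmetric] power_mult_distrib[symmetric])
  ultimately show ?thesis by (simp add: mult.left_commute)
qed

lemma sinprod_nonzero: "j < p \<Longrightarrow> sinprod p \<theta> j (\<theta> j) \<noteq> 0"
  using sinprod_sign[of j] by auto

lemma lagr_self_nonzero: "j < p \<Longrightarrow> poly (lagr p \<theta> j) (cis (\<theta> j)) \<noteq> 0"
  by (simp add: poly_lagr_cis lagr_const_nonzero sinprod_nonzero)

lemma lagr_other_zero: "j < p \<Longrightarrow> k < p \<Longrightarrow> k \<noteq> j \<Longrightarrow> poly (lagr p \<theta> j) (cis (\<theta> k)) = 0"
  by (auto simp: lagr_def poly_prod)

lemma poly_interp: "j < p \<Longrightarrow> poly (interp p \<theta> e) (cis (\<theta> j)) = e j"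
proof -
  assume j: "j < p"
  have "poly (interp p \<theta> e) (cis (\<theta> j))
     = (\<Sum>i<p. e i / poly (lagr p \<theta> i) (cis (\<theta> i)) * poly (lagr p \<theta> i) (cis (\<theta> j)))"
    by (simp add: interp_def poly_sum)
  also have "\<dots> = (\<Sum>i<p. if i = j then e j else 0)"
    using j lagr_self_nonzero lagr_other_zero by (intro sum.cong refl) auto
  finally show ?thesis using j by simp
qed

lemma eq_at_points:
  assumes "degree P \<le> p - 1" "degree Q \<le> p - 1" "p > 0"
    and "\<And>j. j < p \<Longrightarrow> poly P (cis (\<theta> j)) = poly Q (cis (\<theta> j))"
  shows "P = Q"
  by (rule poly_eqI_degree[of "(\<lambda>j. cis (\<theta> j)) ` {..<p}"]) (use assms card_cis_theta in auto)

lemma interp_self: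
  assumes "degree P \<le> p - 1" "p > 0"
  shows "P = interp p \<theta> (\<lambda>j. poly P (cis (\<theta> j)))"
  by (rule eq_at_points[OF assms(1) degree_interp assms(2)]) (simp add: poly_interp)

lemma prod_points_dvd:
  assumes "\<And>j. j < p \<Longrightarrow> poly P (cis (\<theta> j)) = 0"
  shows "(\<Prod>k<p. [:- cis (\<theta> k), 1:]) dvd P"
proof -
  have "m \<le> p \<Longrightarrow> (\<Prod>k<m. [:- cis (\<theta> k), 1:]) dvd P" for m
  proof (induction m)
    case (Suc m)
    then obtain q where q: "P = (\<Prod>k<m. [:- cis (\<theta> k), 1:]) * q" by (auto simp: dvd_def)
    have "cis (\<theta> m) \<noteq> cis (\<theta> k)" if "k < m" for k
      using theta_inj[of m k] that Suc.prems by auto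
    then have "poly (\<Prod>k<m. [:- cis (\<theta> k), 1:]) (cis (\<theta> m)) \<noteq> 0"
      by (auto simp: poly_prod)
    then have "poly q (cis (\<theta> m)) = 0" using assms[of m] Suc.prems q by simp
    then obtain q' where "q = [:- cis (\<theta> m), 1:] * q'" by (auto simp: poly_eq_0_iff_dvd dvd_def)
    then have "P = (\<Prod>k<Suc m. [:- cis (\<theta> k), 1:]) * q'"
      using q by (simp only: prod.lessThan_Suc mult.assoc)
    then show ?case by (rule dvdI)
  qed simp
  then show ?thesis by blast
qed

text \<open>With imaginary data \<open>i a\<^sub>j\<close> at the nodes, the real part of the interpolant is a multiple
  of the trigonometric polynomial having the nodes as its zeros.\<close>

lemma trig_interp:
  assumes p: "p = 2 * n" "n \<ge> 1"
  shows "trig n (interp p \<theta> (\<lambda>j. cis (real n * \<theta> j) * \<i> * complex_of_real (a j))) \<tau>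
    = (\<Prod>k<p. sin ((\<tau> - \<theta> k) / 2)) * (\<Sum>j<p. a j / sinprod p \<theta> j (\<theta> j))"
proof -
  have half: "cis (\<phi> / 2) ^ (p - 1) = cis (real n * \<phi>) * cis (- \<phi> / 2)" for \<phi>
    using p by (simp add: Complex.DeMoivre cis_mult of_nat_diff field_simps)
  \<comment> \<open>In the quotient of Lagrange polynomials \<open>lagr_const\<close> cancels, and
    the phases combine with z^(-n) and the datum to i cis (-(tau - theta_j) / 2). Its real part is
    sin ((tau - theta_j) / 2), just the factor missing from \<open>sinprod\<close>.\<close>
  have summand: "cis (- (real n * \<tau>)) * (cis (real n * \<theta> j) * \<i> * complex_of_real (a j)
        / poly (lagr p \<theta> j) (cis (\<theta> j)) * poly (lagr p \<theta> j) (cis \<tau>))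
      = complex_of_real (a j * sinprod p \<theta> j \<tau> / sinprod p \<theta> j (\<theta> j)) * (\<i> * cis (- (\<tau> - \<theta> j) / 2))"
    if j: "j < p" for j
  proof -
    have c: "cis x * (cis (- x) * y) = y" "cis (- x) * (cis x * y) = y" for x y
      by (simp_all add: mult.assoc[symmetric] cis_mult)
    have "cis (- (\<theta> j) / 2) * cis (\<theta> j / 2) = 1" by (simp add: cis_mult)
    then have i: "1 / cis (- (\<theta> j) / 2) = cis (\<theta> j / 2)" by (simp add: divide_eq_eq mult.commute)
    have "poly (lagr p \<theta> j) (cis \<tau>) / poly (lagr p \<theta> j) (cis (\<theta> j))
        = (cis (real n * \<tau>) * cis (- \<tau> / 2) * complex_of_real (sinprod p \<theta> j \<tau>))
          / (cis (real n * \<theta> j) * cis (- (\<theta> j) / 2) * complex_of_real (sinprod p \<theta> j (\<theta> j)))"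
      unfolding poly_lagr_cis[OF j] half using lagr_const_nonzero[of p \<theta> j] by (simp add: mult.assoc)
    also have "\<dots> = cis (real n * \<tau>) * cis (- \<tau> / 2) * cis (- (real n * \<theta> j)) * cis (\<theta> j / 2)
        * complex_of_real (sinprod p \<theta> j \<tau> / sinprod p \<theta> j (\<theta> j))"
      using sinprod_nonzero[OF j] unfolding i[symmetric]
      by (simp add: field_simps c)
    finally have "cis (- (real n * \<tau>)) * (cis (real n * \<theta> j) * \<i> * complex_of_real (a j)
        / poly (lagr p \<theta> j) (cis (\<theta> j)) * poly (lagr p \<theta> j) (cis \<tau>))
      = cis (- (real n * \<tau>)) * (cis (real n * \<theta> j) * \<i> * complex_of_real (a j)
         * (cis (real n * \<tau>) * cis (- \<tau> / 2) * cis (- (real n * \<theta> j)) * cis (\<theta> j / 2)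
        * complex_of_real (sinprod p \<theta> j \<tau> / sinprod p \<theta> j (\<theta> j))))"
      by (metis times_divide_eq_left times_divide_eq_right mult.assoc)
    also have "\<dots> = complex_of_real (a j * sinprod p \<theta> j \<tau> / sinprod p \<theta> j (\<theta> j))
        * (\<i> * (cis (- \<tau> / 2) * cis (\<theta> j / 2))) * (cis (- (real n * \<tau>)) * cis (real n * \<tau>))
        * (cis (real n * \<theta> j) * cis (- (real n * \<theta> j)))"
      by (simp add: mult_ac)
    also have "\<dots> = complex_of_real (a j * sinprod p \<theta> j \<tau> / sinprod p \<theta> j (\<theta> j)) * (\<i> * cis (- (\<tau> - \<theta> j) / 2))"
      by (simp add: cis_mult diff_divide_distrib)
    finally show ?thesis .
  qed
  have split: "(\<Prod>k<p. sin ((\<tau> - \<theta> k) / 2)) = sin ((\<tau> - \<theta> j) / 2) * sinprod p \<theta> j \<tau>" if "j < p" for j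
    unfolding sinprod_def using that by (subst prod.remove[of _ j]) auto
  have "laurent n (interp p \<theta> (\<lambda>j. cis (real n * \<theta> j) * \<i> * complex_of_real (a j))) \<tau>
     = (\<Sum>j<p. complex_of_real (a j * sinprod p \<theta> j \<tau> / sinprod p \<theta> j (\<theta> j)) * (\<i> * cis (- (\<tau> - \<theta> j) / 2)))"
    unfolding laurent_def interp_def poly_sum poly_smult sum_distrib_left
    by (intro sum.cong refl summand) simp
  then have "trig n (interp p \<theta> (\<lambda>j. cis (real n * \<theta> j) * \<i> * complex_of_real (a j))) \<tau>
     = (\<Sum>j<p. a j * sinprod p \<theta> j \<tau> / sinprod p \<theta> j (\<theta> j) * sin ((\<tau> - \<theta> j) / 2))"
    unfolding trig_def by (simp add: minus_divide_left[symmetric] del: minus_diff_eq minus_divide_left)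
  also have "\<dots> = (\<Sum>j<p. (\<Prod>k<p. sin ((\<tau> - \<theta> k) / 2)) * (a j / sinprod p \<theta> j (\<theta> j)))"
    by (intro sum.cong refl) (simp add: split mult_ac)
  finally show ?thesis by (simp add: sum_distrib_left)
qed

text \<open>Partial fractions: an imaginary \<open>z\<^sup>-\<^sup>nD\<close> with residues of one sign has a quotient by the
  node polynomial lying in a half plane.\<close>

lemma interp_nonzero_in_disk:
  assumes p: "p = 2 * n" "n \<ge> 1" and deg: "degree D \<le> p - 1"
    and node: "\<And>j. j < p \<Longrightarrow> laurent n D (\<theta> j) = \<i> * complex_of_real (y j)"
    and sgn: "\<And>j. j < p \<Longrightarrow> e * (y j / sinprod p \<theta> j (\<theta> j)) > 0"
    and z: "cmod z < 1"
  shows "poly D z \<noteq> 0"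
proof -
  define K where "K = (\<Prod>k<p. 2 * \<i> * cis (\<theta> k / 2))"
  define N where "N = (\<Prod>k<p. z - cis (\<theta> k))"
  have K: "K \<noteq> 0" by (simp add: K_def)
  have ne: "z - cis (\<theta> j) \<noteq> 0" for j using z by auto
  have N: "N \<noteq> 0" using ne by (simp add: N_def)
  \<comment> \<open>The i in the data meets the i of the chord formula, so once a common factor is
    extracted the weights are real.\<close>
  have summand: "poly D (cis (\<theta> j)) / poly (lagr p \<theta> j) (cis (\<theta> j)) * poly (lagr p \<theta> j) z
     = (- 2 / K * N) * (complex_of_real (y j / sinprod p \<theta> j (\<theta> j)) * (cis (\<theta> j) / (z - cis (\<theta> j))))"
    if j: "j < p" for j
  proof -
    have 1: "N = (z - cis (\<theta> j)) * poly (lagr p \<theta> j) z"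
      unfolding N_def lagr_def using j by (subst prod.remove[of _ j]) (auto simp: poly_prod)
    have 2: "K = 2 * \<i> * cis (\<theta> j / 2) * lagr_const p \<theta> j"
      unfolding K_def lagr_const_def using j by (subst prod.remove[of _ j]) auto
    have 3: "cis (\<theta> j / 2) ^ (p - 1) * cis (\<theta> j) = cis (\<theta> j / 2) * cis (real n * \<theta> j)"
      using p by (simp add: Complex.DeMoivre cis_mult of_nat_diff field_simps)
    have 4: "poly D (cis (\<theta> j)) = cis (real n * \<theta> j) * (\<i> * complex_of_real (y j))"
      unfolding poly_cis[of _ _ n] node[OF j] ..
    have "poly (lagr p \<theta> j) (cis (\<theta> j)) * cis (\<theta> j)
        = lagr_const p \<theta> j * (cis (\<theta> j / 2) ^ (p - 1) * cis (\<theta> j)) * complex_of_real (sinprod p \<theta> j (\<theta> j))"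
      unfolding poly_lagr_cis[OF j] by (simp add: mult_ac)
    also have "\<dots> = K / (2 * \<i>) * cis (real n * \<theta> j) * complex_of_real (sinprod p \<theta> j (\<theta> j))"
      unfolding 3 2 by (simp add: mult_ac)
    finally have 5: "poly (lagr p \<theta> j) (cis (\<theta> j))
        = K / (2 * \<i>) * cis (real n * \<theta> j) * complex_of_real (sinprod p \<theta> j (\<theta> j)) / cis (\<theta> j)"
      by (metis nonzero_eq_divide_eq cis_neq_zero)
    have "poly D (cis (\<theta> j)) / poly (lagr p \<theta> j) (cis (\<theta> j))
       = (- 2 / K) * complex_of_real (y j / sinprod p \<theta> j (\<theta> j)) * cis (\<theta> j)"
      unfolding 4 5 using K sinprod_nonzero[OF j] by (simp add: field_simps)
    moreover have "poly (lagr p \<theta> j) z = N / (z - cis (\<theta> j))" using 1 ne by simp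
    ultimately show ?thesis by (simp add: mult_ac)
  qed
  have "poly D z = (\<Sum>j<p. poly D (cis (\<theta> j)) / poly (lagr p \<theta> j) (cis (\<theta> j)) * poly (lagr p \<theta> j) z)"
    by (subst interp_self[OF deg]) (use p in \<open>simp_all add: interp_def poly_sum\<close>)
  also have "\<dots> = (- 2 / K * N) *
      (\<Sum>j<p. complex_of_real (y j / sinprod p \<theta> j (\<theta> j)) * (cis (\<theta> j) / (z - cis (\<theta> j))))"
    unfolding sum_distrib_left by (intro sum.cong refl summand) simp
  finally have D: "poly D z = (- 2 / K * N) *
      (\<Sum>j<p. complex_of_real (y j / sinprod p \<theta> j (\<theta> j)) * (cis (\<theta> j) / (z - cis (\<theta> j))))" .
  have gen: "e * Re w < (\<Sum>j<p. 0) \<Longrightarrow> w \<noteq> 0" for w by auto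
  have re: "Re (complex_of_real c * w) = c * Re w" for c w by simp
  have "e * Re (\<Sum>j<p. complex_of_real (y j / sinprod p \<theta> j (\<theta> j)) * (cis (\<theta> j) / (z - cis (\<theta> j))))
    = (\<Sum>j<p. e * (y j / sinprod p \<theta> j (\<theta> j)) * Re (cis (\<theta> j) / (z - cis (\<theta> j))))"
    by (simp only: Re_sum re sum_distrib_left mult.assoc)
  \<comment> \<open>All weights have the sign of \<open>e\<close> and all Cayley factors have
    negative real part, so nothing cancels.\<close>
  also have "\<dots> < (\<Sum>j<p. 0)"
    using p sgn z
    by (intro sum_strict_mono mult_pos_neg Re_cayley_neg) (auto simp: lessThan_empty_iff)
  finally have "(\<Sum>j<p. complex_of_real (y j / sinprod p \<theta> j (\<theta> j)) * (cis (\<theta> j) / (z - cis (\<theta> j)))) \<noteq> 0"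
    by (rule gen)
  then show ?thesis unfolding D using K N by simp
qed

end

section \<open>Dirichlet data of an isospectral pair\<close>

text \<open>Turns a real trigonometric polynomial back into a polynomial, so that divisibility and
  degree arguments apply to it.\<close>

definition sympart :: "nat \<Rightarrow> complex poly \<Rightarrow> complex poly" where
  "sympart n P = smult (1 / 2) (P + creflect (2 * n) P)"

lemma laurent_sympart:
  "degree P \<le> 2 * n \<Longrightarrow> laurent n (sympart n P) s = complex_of_real (trig n P s)"
  using laurent_self_reflect[of P n s] by (simp add: sympart_def laurent_smult)

lemma degree_sympart: "degree P \<le> 2 * n \<Longrightarrow> degree (sympart n P) \<le> 2 * n"
  unfolding sympart_def
  by (intro order_trans[OF degree_smult_le] degree_add_le degree_creflect)

context band_structure
begin

text \<open>The pairs \<open>(B, D)\<close> arising from Verblunsky coefficients with discriminant \<open>2 trig n A\<close>. The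
  zeros of \<open>pole_fun B D\<close> are the Dirichlet data (poles of the Caratheodory function).\<close>

definition isodata :: "complex poly \<Rightarrow> complex poly \<Rightarrow> bool" where
  "isodata B D \<longleftrightarrow> degree B \<le> 2 * n - 1 \<and> degree D \<le> 2 * n - 1
    \<and> (\<forall>z. cmod z \<le> 1 \<longrightarrow> poly D z \<noteq> 0)
    \<and> (\<forall>z. cmod z = 1 \<longrightarrow> (cmod (poly D z))\<^sup>2 = 1 + (cmod (poly B z))\<^sup>2)
    \<and> (\<exists>x>0. coeff D 0 = complex_of_real x)
    \<and> (\<forall>s. trig n D s = trig n A s)"

definition pole_fun :: "complex poly \<Rightarrow> complex poly \<Rightarrow> real \<Rightarrow> real" where
  "pole_fun B D = trig n (B - smult \<i> D)"

lemma t_le: "i \<le> j \<Longrightarrow> j \<le> 2 * n \<Longrightarrow> t i \<le> t j"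
  by (rule strict_mono_intervals[of "2 * n"]) (rule t_less)

lemma sigma_sign_cases: "\<sigma> * (-1) ^ j = 1 \<or> \<sigma> * (-1) ^ j = -1"
  using sigma by (cases "even j") auto

lemma laurent_pole_fun:
  assumes "isodata B D"
  shows "laurent n (B - smult \<i> D) s
    = complex_of_real (pole_fun B D s) + \<i> * complex_of_real (Im (laurent n B s) - trig n A s)"
  using assms
  by (simp add: complex_eq_iff pole_fun_def trig_def laurent_linear isodata_def)

text \<open>The factored determinant condition: \<open>pole_fun\<close> is w = y + b, and 2 y - w is
  the cofactor y - b.\<close>

lemma pole_fun_identity:
  assumes "isodata B D"
  shows "pole_fun B D s * (2 * Im (laurent n D s) - pole_fun B D s)
    = 1 - (trig n A s)\<^sup>2 + (Im (laurent n B s))\<^sup>2"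
proof -
  have w: "pole_fun B D s = Re (laurent n B s) + Im (laurent n D s)"
    by (simp add: pole_fun_def trig_def laurent_linear)
  have "(cmod (laurent n D s))\<^sup>2 = 1 + (cmod (laurent n B s))\<^sup>2"
    using assms by (simp add: norm_laurent isodata_def)
  moreover have "Re (laurent n D s) = trig n A s"
    using assms by (simp add: isodata_def flip: trig_def)
  ultimately show ?thesis
    unfolding w cmod_power2 by (simp add: power2_eq_square algebra_simps)
qed

text \<open>At a zero of Delta the product in \<open>pole_fun_identity\<close> is positive, so w and
  2 y - w share their sign, which is then that of y. By \<open>trig_zero_crossing\<close> this is
  the sign of the slope of Delta, and it alternates.\<close>

lemma pole_fun_sign:
  assumes "isodata B D" "j \<le> 2 * n"
  shows "\<sigma> * (-1) ^ j * pole_fun B D (t j) > 0"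
proof -
  let ?e = "\<sigma> * (-1) ^ j" and ?y = "Im (laurent n D (t j))"
  have eq: "trig n D = trig n A" using assms by (auto simp: isodata_def)
  \<comment> \<open>Only the functions \<open>trig n D\<close> and \<open>trig n A\<close> agree,
    not the polynomials, so the slopes are compared through uniqueness of derivatives.\<close>
  have "trig n (tderiv n D) (t j) = trig n (tderiv n A) (t j)"
    using trig_has_derivative[of n D "t j"] trig_has_derivative[of n A "t j"]
    unfolding eq by (rule DERIV_unique)
  then have "?y * trig n (tderiv n A) (t j) > 0"
    using trig_zero_crossing[of n D "t j"] assms n_pos t_zero[OF assms(2)] eq
    by (simp add: isodata_def)
  then have "?e * ?y > 0"
    using t_deriv[OF assms(2)] sigma_sign_cases[of j] by (auto simp: zero_less_mult_iff)
  moreover have "pole_fun B D (t j) * (2 * ?y - pole_fun B D (t j)) > 0"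
    unfolding pole_fun_identity[OF assms(1)] t_zero[OF assms(2)] by (simp add: add_pos_nonneg)
  ultimately show ?thesis
    using sigma_sign_cases[of j] by (auto simp: zero_less_mult_iff)
qed

lemma degree_pole_poly: "isodata B D \<Longrightarrow> degree (B - smult \<i> D) \<le> 2 * n - 1"
  by (auto simp: isodata_def intro!: degree_diff_le order_trans[OF degree_smult_le])

lemma pole_fun_zero:
  assumes "isodata B D" "j < 2 * n"
  shows "\<exists>s. t j < s \<and> s < t (Suc j) \<and> pole_fun B D s = 0"
proof -
  let ?f = "\<lambda>s. \<sigma> * (-1) ^ j * pole_fun B D s"
  have p: "?f (t j) > 0" "?f (t (Suc j)) < 0"
    using pole_fun_sign[OF assms(1), of j] pole_fun_sign[OF assms(1), of "Suc j"] assms(2) by auto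
  moreover have "continuous_on {t j..t (Suc j)} ?f"
    unfolding pole_fun_def by (intro continuous_intros continuous_on_trig)
  ultimately obtain s where s: "t j \<le> s" "s \<le> t (Suc j)" "?f s = 0"
    using IVT2'[of ?f "t (Suc j)" 0 "t j"] t_le[of j "Suc j"] assms(2) by force
  then have "s \<noteq> t j" "s \<noteq> t (Suc j)" using p by auto
  then show ?thesis using s sigma by (intro exI[of _ s]) auto
qed

lemma pole_fun_zero_unique:
  assumes "isodata B D" "j < 2 * n" "t j < s" "s < t (Suc j)" "pole_fun B D s = 0"
    "t j < s'" "s' < t (Suc j)" "pole_fun B D s' = 0"
  shows "s = s'"
proof (rule trig_zero_unique_in_interval[where P = "B - smult \<i> D" and n = n and t = t])
  show "degree (B - smult \<i> D) \<le> 2 * n" using degree_pole_poly[OF assms(1)] by simp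
  show "trig n (B - smult \<i> D) (t 0) \<noteq> 0"
    using pole_fun_sign[OF assms(1), of 0] by (auto simp: pole_fun_def)
qed (use assms t_less t_period pole_fun_zero[OF assms(1)] in \<open>auto simp: pole_fun_def\<close>)

lemma pole_fun_zero_value:
  assumes "isodata B D" "pole_fun B D s = 0"
  shows "(Im (laurent n B s))\<^sup>2 = (trig n A s)\<^sup>2 - 1"
  using pole_fun_identity[OF assms(1), of s] assms(2) by simp

lemma pole_fun_zero_in_gap:
  assumes "isodata B D" "j < 2 * n" "t j < s" "s < t (Suc j)" "pole_fun B D s = 0"
  shows "l j \<le> s \<and> s \<le> r j"
proof (rule gap_maximal[OF assms(2)])
  have "(trig n A s)\<^sup>2 \<ge> 1"
    using pole_fun_zero_value[OF assms(1,5)] zero_le_power2[of "Im (laurent n B s)"] by linarith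
  then show "\<bar>trig n A s\<bar> \<ge> 1" using abs_square_less_1[of "trig n A s"] by linarith
qed (use assms in auto)

lemma circle_points_gaps:
  assumes "\<And>j. j < 2 * n \<Longrightarrow> l j \<le> \<theta> j \<and> \<theta> j \<le> r j"
  shows "circle_points (2 * n) \<theta>"
proof
  have b: "t j < \<theta> j" "\<theta> j < t (Suc j)" if "j < 2 * n" for j
    using assms[OF that] gap_order[OF that] by auto
  show "\<theta> i < \<theta> j" if "i < j" "j < 2 * n" for i j
    using b[of i] b[of j] t_le[of "Suc i" j] that by force
  show "\<theta> j < \<theta> i + 2 * pi" if "i < 2 * n" "j < 2 * n" for i j
    using b[of i] b[of j] t_le[of "Suc j" "2 * n"] t_le[of 0 i] that t_period by force
qed

text \<open>The 2 n nodes determine E, of degree at most 2 n - 1, since z^(-n) E = i (u - h) there.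
  E yields w and u everywhere, and the identity yields y wherever w is nonzero, that is at all but
  finitely many points of the circle.\<close>

lemma isodata_unique:
  assumes "isodata B D" "isodata B' D'"
    and \<theta>: "\<And>j. j < 2 * n \<Longrightarrow> l j \<le> \<theta> j \<and> \<theta> j \<le> r j"
    and "\<And>j. j < 2 * n \<Longrightarrow> pole_fun B D (\<theta> j) = 0 \<and> pole_fun B' D' (\<theta> j) = 0"
    and "\<And>j. j < 2 * n \<Longrightarrow> Im (laurent n B (\<theta> j)) = Im (laurent n B' (\<theta> j))"
  shows "B = B' \<and> D = D'"
proof -
  interpret circle_points "2 * n" \<theta> by (rule circle_points_gaps[OF \<theta>])
  let ?E = "B - smult \<i> D" and ?E' = "B' - smult \<i> D'"
  have E: "?E = ?E'"
  proof (rule eq_at_points)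
    fix j assume "j < 2 * n"
    then have "laurent n ?E (\<theta> j) = laurent n ?E' (\<theta> j)"
      using laurent_pole_fun[OF assms(1)] laurent_pole_fun[OF assms(2)] assms(4,5) by simp
    then show "poly ?E (cis (\<theta> j)) = poly ?E' (cis (\<theta> j))" by (simp only: poly_cis[of _ _ n])
  qed (use n_pos assms degree_pole_poly in auto)
  have w: "pole_fun B D s = pole_fun B' D' s" for s using E by (simp add: pole_fun_def)
  have u: "Im (laurent n B s) = Im (laurent n B' s)" for s
    using laurent_pole_fun[OF assms(1), of s] laurent_pole_fun[OF assms(2), of s] w[of s] E
    by (simp add: complex_eq_iff)
  let ?Q = "?E + creflect (2 * n) ?E"
  have dE: "degree ?E \<le> 2 * n" using degree_pole_poly[OF assms(1)] by simp
  have Q0: "poly ?Q (cis s) = 0 \<longleftrightarrow> pole_fun B D s = 0" for s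
    unfolding poly_cis[of _ _ n] laurent_self_reflect[OF dE] pole_fun_def by simp
  have "poly ?Q (cis (t 0)) \<noteq> 0"
    unfolding Q0 using pole_fun_sign[OF assms(1), of 0] by auto
  then have "?Q \<noteq> 0" by (metis poly_0)
  then have fin: "finite {z. poly ?Q z = 0}" by (rule poly_roots_finite)
  have "D = D'"
  proof (rule poly_eq_on_circle_cofinite[OF fin])
    fix z assume z: "cmod z = 1" "z \<notin> {z. poly ?Q z = 0}"
    obtain s where s: "z = cis s" using z(1)
      by (metis cis_Arg norm_eq_zero sgn_eq div_by_1 of_real_1 zero_neq_one)
    have nz: "pole_fun B D s \<noteq> 0" using Q0[of s] z(2) s by simp
    have "pole_fun B' D' s * (2 * Im (laurent n D s) - pole_fun B' D' s)
        = pole_fun B' D' s * (2 * Im (laurent n D' s) - pole_fun B' D' s)"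
      using pole_fun_identity[OF assms(1), of s] pole_fun_identity[OF assms(2), of s]
      unfolding w u by (rule trans[OF _ sym])
    then have "2 * Im (laurent n D s) - pole_fun B' D' s = 2 * Im (laurent n D' s) - pole_fun B' D' s"
      using nz unfolding w by (rule mult_left_cancel[THEN iffD1, rotated])
    then have "Im (laurent n D s) = Im (laurent n D' s)" by simp
    moreover have "Re (laurent n D s) = Re (laurent n D' s)"
      using assms(1,2) by (simp add: isodata_def flip: trig_def)
    ultimately have "laurent n D s = laurent n D' s" by (rule complex_eqI[rotated])
    then show "poly D z = poly D' z" unfolding s poly_cis[of _ _ n] by simp
  qed
  then show ?thesis using E by simp
qed

end

section \<open>Reconstruction from Dirichlet data\<close>

context band_structure
begin

text \<open>The factors with k >= j are negative, and their number 2 n - j has the parity of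
  j.\<close>

lemma exterior_sign:
  assumes "\<And>j. j < 2 * n \<Longrightarrow> l j \<le> \<theta> j \<and> \<theta> j \<le> r j" "j < 2 * n"
  shows "(-1) ^ j * (\<Prod>k<2*n. sin ((t j - \<theta> k) / 2)) > 0"
proof -
  have b: "t k < \<theta> k" "\<theta> k < t (Suc k)" if "k < 2 * n" for k
    using assms(1)[OF that] gap_order[OF that] by auto
  have e: "{..<2 * n} = {..<j} \<union> {j..<2 * n}" using assms(2) by auto
  have "(\<Prod>k<2*n. sin ((t j - \<theta> k) / 2))
      = (\<Prod>k<j. sin ((t j - \<theta> k) / 2)) * (\<Prod>k\<in>{j..<2*n}. sin ((t j - \<theta> k) / 2))"
    unfolding e by (rule prod.union_disjoint) auto
  moreover have "(\<Prod>k<j. sin ((t j - \<theta> k) / 2)) > 0"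
  proof (intro prod_pos ballI sin_gt_zero)
    fix k assume "k \<in> {..<j}"
    then have k: "k < j" by simp
    show "0 < (t j - \<theta> k) / 2" using b[of k] t_le[of "Suc k" j] k assms(2) by simp
    show "(t j - \<theta> k) / 2 < pi"
      using b[of k] t_le[of 0 k] t_less[of j "2 * n"] k assms(2) t_period by simp
  qed
  moreover have "(\<Prod>k\<in>{j..<2*n}. sin ((t j - \<theta> k) / 2)) = (\<Prod>k\<in>{j..<2*n}. (-1) * sin ((\<theta> k - t j) / 2))"
    by (intro prod.cong refl) (metis minus_diff_eq minus_divide_left mult_minus1 sin_minus)
  moreover have "\<dots> = (-1) ^ (2 * n - j) * (\<Prod>k\<in>{j..<2*n}. sin ((\<theta> k - t j) / 2))"
    by (subst prod.distrib) simp
  moreover have "(\<Prod>k\<in>{j..<2*n}. sin ((\<theta> k - t j) / 2)) > 0"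
  proof (intro prod_pos ballI sin_gt_zero)
    fix k assume "k \<in> {j..<2*n}"
    then have k: "j \<le> k" "k < 2 * n" by auto
    show "0 < (\<theta> k - t j) / 2" using b[of k] t_le[of j k] k by simp
    show "(\<theta> k - t j) / 2 < pi"
      using b[of k] t_le[of 0 j] t_le[of "Suc k" "2 * n"] k t_period by simp
  qed
  moreover have "(-1) ^ (2 * n - j) = ((-1) ^ j :: real)"
    using assms(2) by (simp add: uminus_power_if)
  moreover have "(-1) ^ m * ((-1::real) ^ m * x) = x" for m x
    by (simp add: mult.assoc[symmetric] power_mult_distrib[symmetric])
  ultimately show ?thesis by (simp add: mult.left_commute)
qed

text \<open>Interpolation gives E, hence w and u; the missing piece is the cofactor x = (1 - h^2 +
  u^2) / w. Three things are at stake: x has to be a real trigonometric polynomial, the degrees of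
  \<open>B\<close> and \<open>D\<close> have to be at most 2 n - 1, and \<open>D\<close> must have
  no zero in the disk.\<close>

lemma isodata_exists:
  assumes \<theta>: "\<And>j. j < 2 * n \<Longrightarrow> l j \<le> \<theta> j \<and> \<theta> j \<le> r j"
    and v: "\<And>j. j < 2 * n \<Longrightarrow> (v j)\<^sup>2 = (trig n A (\<theta> j))\<^sup>2 - 1"
  shows "\<exists>B D. isodata B D \<and> (\<forall>j<2*n. pole_fun B D (\<theta> j) = 0 \<and> Im (laurent n B (\<theta> j)) = v j)"
proof -
  interpret circle_points "2 * n" \<theta> by (rule circle_points_gaps[OF \<theta>])
  interpret T: circle_points "2 * n" t
  proof
    show "t i < t j" if "i < j" "j < 2 * n" for i j using t_less that by simp
    show "t j < t i + 2 * pi" if "i < 2 * n" "j < 2 * n" for i j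
      using t_less[of j "2 * n"] t_le[of 0 i] that t_period by simp
  qed
  \<comment> \<open>At a node w is to vanish and u is to equal v, so z^(-n) E must be i (v -
    h).\<close>
  define a where "a j = v j - trig n A (\<theta> j)" for j
  define E where "E = interp (2 * n) \<theta> (\<lambda>j. cis (real n * \<theta> j) * \<i> * complex_of_real (a j))"
  define w where "w = trig n E"
  have degE: "degree E \<le> 2 * n - 1" unfolding E_def by (rule degree_interp)
  have LE: "laurent n E (\<theta> j) = \<i> * complex_of_real (a j)" if "j < 2 * n" for j
    unfolding laurent_def E_def poly_interp[OF that] by (simp add: mult.assoc[symmetric] cis_mult)
  define C where "C = (\<Sum>j<2*n. a j / sinprod (2 * n) \<theta> j (\<theta> j))"
  have w: "w s = (\<Prod>k<2*n. sin ((s - \<theta> k) / 2)) * C" for s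
    unfolding w_def E_def C_def using n_pos by (intro trig_interp) auto
  have odd_sign: "(-1) ^ (2 * n - 1 - j) = - ((-1) ^ j :: real)" if "j < 2 * n" for j
    using that n_pos by (simp add: uminus_power_if)
  \<comment> \<open>By |v_j| < |h| the datum a_j has the sign opposite to h, which alternates in
    step with \<open>sinprod\<close> at the nodes. All terms of \<open>C\<close> thus have the sign
    of \<open>\<sigma>\<close>.\<close>
  have "\<sigma> * C > 0"
  proof -
    have "\<sigma> * (a j / sinprod (2 * n) \<theta> j (\<theta> j)) > 0" if j: "j < 2 * n" for j
    proof -
      let ?e = "(-1) ^ j :: real"
      have th: "t j < \<theta> j" "\<theta> j < t (Suc j)" using \<theta>[OF j] gap_order[OF j] by auto
      have h: "\<sigma> * ?e * trig n A (\<theta> j) > 0" by (rule sign[OF j th])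
      have "(v j)\<^sup>2 < (trig n A (\<theta> j))\<^sup>2" using v[OF j] by simp
      then have "\<bar>v j\<bar> < \<bar>trig n A (\<theta> j)\<bar>" by (metis abs_le_square_iff not_le)
      then have "\<sigma> * ?e * a j < 0"
        using h sigma_sign_cases[of j] unfolding a_def by (elim disjE) simp_all
      moreover have "- ?e * sinprod (2 * n) \<theta> j (\<theta> j) > 0"
        using sinprod_sign[OF j] unfolding odd_sign[OF j] .
      moreover have "?e = 1 \<or> ?e = -1" by (cases "even j") auto
      ultimately show ?thesis
        by (elim disjE) (simp_all add: zero_less_divide_iff zero_less_mult_iff mult_less_0_iff)
    qed
    then have "(\<Sum>j<2*n. \<sigma> * (a j / sinprod (2 * n) \<theta> j (\<theta> j))) > 0"
      using n_pos by (intro sum_pos) (auto simp: lessThan_empty_iff)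
    then show ?thesis by (simp add: C_def sum_distrib_left)
  qed
  have wt: "\<sigma> * (-1) ^ j * w (t j) > 0" if j: "j < 2 * n" for j
  proof -
    have "\<sigma> * (-1) ^ j * w (t j) = (\<sigma> * C) * ((-1) ^ j * (\<Prod>k<2*n. sin ((t j - \<theta> k) / 2)))"
      unfolding w by (simp add: mult_ac)
    then show ?thesis using mult_pos_pos[OF \<open>\<sigma> * C > 0\<close> exterior_sign[OF \<theta> j]] by (simp only:)
  qed
  have dA: "degree A \<le> 2 * n" "degree E \<le> 2 * n" "degree (A - smult \<i> E) \<le> 2 * n"
    using deg_A degE by (auto intro!: degree_diff_le order_trans[OF degree_smult_le])
  define H U V where "H = sympart n A" and "U = sympart n (A - smult \<i> E)" and "V = sympart n E"
  define h u where "h = trig n A" and "u = trig n (A - smult \<i> E)"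
  have LH: "laurent n H s = complex_of_real (h s)" for s
    unfolding H_def h_def by (rule laurent_sympart[OF dA(1)])
  have LU: "laurent n U s = complex_of_real (u s)" for s
    unfolding U_def u_def by (rule laurent_sympart[OF dA(3)])
  have LV: "laurent n V s = complex_of_real (w s)" for s
    unfolding V_def w_def by (rule laurent_sympart[OF dA(2)])
  have u: "u s = h s + Im (laurent n E s)" for s
    by (simp add: u_def h_def trig_def laurent_linear)
  have degs: "degree H \<le> 2 * n" "degree U \<le> 2 * n" "degree V \<le> 2 * n"
    unfolding H_def U_def V_def using dA by (auto intro: degree_sympart)
  have uv: "u (\<theta> j) = v j" if "j < 2 * n" for j
    unfolding u LE[OF that] by (simp add: h_def a_def)
  \<comment> \<open>The polynomial form of z^(2 n) (1 - h^2 + u^2).\<close>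
  define M where "M = monom 1 (2 * n) - H * H + U * U"
  have cc: "cis (real n * s) * cis (real n * s) = cis s ^ (2 * n)" for s
    by (simp only: Complex.DeMoivre cis_mult) (simp add: algebra_simps)
  have M: "poly M (cis s) = cis s ^ (2 * n) * complex_of_real (1 - (h s)\<^sup>2 + (u s)\<^sup>2)" for s
    unfolding M_def poly_add poly_diff poly_mult poly_cis[of H _ n] poly_cis[of U _ n] LH LU poly_monom
      cc[symmetric]
    by (simp add: algebra_simps power2_eq_square)
  define N where "N = (\<Prod>k<2*n. [:- cis (\<theta> k), 1:])"
  have degN: "degree N = 2 * n" by (simp add: N_def degree_prod_sum_eq)
  have "N dvd V" unfolding N_def
  proof (rule prod_points_dvd)
    fix j assume "j < 2 * n"
    then have "w (\<theta> j) = 0" unfolding w_def trig_def LE[OF \<open>j < 2 * n\<close>] by simp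
    then show "poly V (cis (\<theta> j)) = 0" unfolding poly_cis[of _ _ n] LV by simp
  qed
  then obtain q where q: "V = N * q" by (auto simp: dvd_def)
  have V0: "V \<noteq> 0"
  proof
    assume "V = 0"
    then have "w (t 0) = 0" using LV[of "t 0"] by (simp add: laurent_zero)
    then show False using wt[of 0] n_pos by simp
  qed
  then have "N \<noteq> 0" "q \<noteq> 0" using q by auto
  then have "degree q = 0" using degs(3) degN unfolding q by (simp add: degree_mult_eq)
  then obtain c where c: "q = [:c:]" by (rule degree_eq_zeroE)
  have "c \<noteq> 0" using \<open>q \<noteq> 0\<close> c by auto
  have degV: "degree V = 2 * n" using \<open>c \<noteq> 0\<close> degN unfolding q c by simp
  \<comment> \<open>The curve equation says that 1 - h^2 + u^2 vanishes at every node. As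
    \<open>V\<close> is a nonzero constant multiple of \<open>N\<close>, it divides
    \<open>M\<close>.\<close>
  have "N dvd M" unfolding N_def
  proof (rule prod_points_dvd)
    fix j assume j: "j < 2 * n"
    show "poly M (cis (\<theta> j)) = 0"
      unfolding M uv[OF j] v[OF j] by (simp add: h_def)
  qed
  then obtain q2 where q2: "M = N * q2" by (auto simp: dvd_def)
  define X where "X = smult (1 / c) q2"
  have MVX: "M = V * X" unfolding q2 q c X_def using \<open>c \<noteq> 0\<close> by simp
  have degM: "degree M \<le> 2 * n + 2 * n"
    unfolding M_def using degs
    by (intro degree_add_le degree_diff_le order_trans[OF degree_mult_le] add_mono
        order_trans[OF degree_monom_le]) auto
  have degX: "degree X \<le> 2 * n"
  proof (cases "X = 0")
    case False
    then show ?thesis using degM degV V0 unfolding MVX by (simp add: degree_mult_eq)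
  qed simp
  have wX: "complex_of_real (w s) * laurent n X s = complex_of_real (1 - (h s)\<^sup>2 + (u s)\<^sup>2)" for s
  proof -
    have "cis s ^ (2 * n) * (complex_of_real (w s) * laurent n X s)
      = cis s ^ (2 * n) * complex_of_real (1 - (h s)\<^sup>2 + (u s)\<^sup>2)"
      unfolding M[symmetric] unfolding MVX poly_mult poly_cis[of V _ n] poly_cis[of X _ n] LV cc[symmetric]
      by (simp add: mult_ac)
    then show ?thesis by simp
  qed
  \<comment> \<open>A quotient of real functions is real where w is nonzero; as a polynomial
    identity this extends to the whole circle.\<close>
  have "X = creflect (2 * n) X"
  proof (rule poly_eq_on_circle_cofinite[OF poly_roots_finite[OF V0]])
    fix z assume z: "cmod z = 1" "z \<notin> {z. poly V z = 0}"
    obtain s where s: "z = cis s" using z(1)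
      by (metis cis_Arg norm_eq_zero sgn_eq div_by_1 of_real_1 zero_neq_one)
    have "w s \<noteq> 0" using z(2) unfolding s by (simp add: poly_cis[of V _ n] LV)
    then have "laurent n X s = complex_of_real ((1 - (h s)\<^sup>2 + (u s)\<^sup>2) / w s)"
      using wX[of s] by (simp add: field_simps)
    then have "laurent n (creflect (2 * n) X) s = laurent n X s"
      unfolding laurent_creflect[OF degX] by simp
    then show "poly X z = poly (creflect (2 * n) X) z" unfolding s poly_cis[of _ _ n] by simp
  qed
  define x where "x = trig n X"
  have LX: "laurent n X s = complex_of_real (x s)" for s
  proof -
    have "cnj (laurent n X s) = laurent n X s"
      using laurent_creflect[OF degX, of s] \<open>X = creflect (2 * n) X\<close> by simp
    then show ?thesis by (simp add: x_def trig_def complex_eq_iff)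
  qed
  have wx: "w s * x s = 1 - (h s)\<^sup>2 + (u s)\<^sup>2" for s
    using wX[of s] unfolding LX of_real_mult[symmetric] of_real_eq_iff .
  define D where "D = H + smult (\<i> / 2) (V + X)"
  define B where "B = smult (1 / 2) (V - X) + smult \<i> U"
  have LD: "laurent n D s = Complex (h s) ((w s + x s) / 2)" for s
    by (simp add: D_def laurent_linear LH LV LX complex_eq_iff)
  have LB: "laurent n B s = Complex ((w s - x s) / 2) (u s)" for s
    by (simp add: B_def laurent_linear LU LV LX complex_eq_iff)
  have BD: "B - smult \<i> D = E"
  proof (rule laurent_inj)
    fix s show "laurent n (B - smult \<i> D) s = laurent n E s"
      unfolding laurent_linear LB LD using u[of s]
      by (simp add: complex_eq_iff w_def trig_def field_simps)
  qed
  have E': "E = V + smult \<i> (U - H)"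
  proof (rule laurent_inj)
    fix s show "laurent n E s = laurent n (V + smult \<i> (U - H)) s"
      unfolding laurent_linear LV LU LH using u[of s]
      by (simp add: complex_eq_iff w_def trig_def)
  qed
  \<comment> \<open>A priori the degrees are one too large. In terms of top coefficients, that of E
    is zero, so V = -i (U - H); comparing M = V X and cancelling V gives X = i (U + H), and with
    these values the top coefficients of \<open>D\<close> and \<open>B\<close> vanish.\<close>
  have top: "coeff D (2 * n) = 0 \<and> coeff B (2 * n) = 0"
  proof -
    let ?V = "coeff V (2 * n)" and ?H = "coeff H (2 * n)" and ?U = "coeff U (2 * n)" and ?X = "coeff X (2 * n)"
    have "coeff E (2 * n) = 0" using degE n_pos by (intro coeff_eq_0) simp
    then have 1: "?V = - \<i> * (?U - ?H)" unfolding E' by (simp add: eq_neg_iff_add_eq_0)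
    have "coeff M (2 * n + 2 * n) = ?U * ?U - ?H * ?H"
      unfolding M_def coeff_add coeff_diff coeff_mult_top[OF degs(1) degs(1)]
        coeff_mult_top[OF degs(2) degs(2)]
      using n_pos by simp
    moreover have "coeff M (2 * n + 2 * n) = ?V * ?X"
      unfolding MVX by (rule coeff_mult_top[OF degs(3) degX])
    ultimately have "?V * ?X = (?U - ?H) * (?U + ?H)" by (simp add: algebra_simps)
    also have "?U - ?H = \<i> * ?V" unfolding 1 by (simp add: algebra_simps)
    finally have "?V * ?X = ?V * (\<i> * (?U + ?H))" by (simp add: mult_ac)
    moreover have "?V \<noteq> 0" using V0 degV leading_coeff_neq_0[of V] by simp
    ultimately have 2: "?X = \<i> * (?U + ?H)" by simp
    have "coeff D (2 * n) = ?H + \<i> / 2 * (?V + ?X)" by (simp add: D_def)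
    also have "\<dots> = 0" unfolding 1 2 by (simp add: algebra_simps)
    finally have D0: "coeff D (2 * n) = 0" .
    have "coeff (B - smult \<i> D) (2 * n) = 0" unfolding BD by (rule \<open>coeff E (2 * n) = 0\<close>)
    then show ?thesis using D0 by simp
  qed
  have "degree D \<le> 2 * n" "degree B \<le> 2 * n"
    unfolding D_def B_def using degs degX
    by (auto intro!: degree_add_le degree_diff_le order_trans[OF degree_smult_le])
  moreover have "degree P \<le> 2 * n - 1" if "degree P \<le> 2 * n" "coeff P (2 * n) = 0" for P :: "complex poly"
  proof (rule degree_le, intro allI impI)
    fix i assume "2 * n - 1 < i"
    then have "i = 2 * n \<or> 2 * n < i" by linarith
    then show "coeff P i = 0" using that by (auto intro: coeff_eq_0)
  qed
  ultimately have degBD: "degree D \<le> 2 * n - 1" "degree B \<le> 2 * n - 1" using top by blast+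
  have norm: "(cmod (poly D z))\<^sup>2 = 1 + (cmod (poly B z))\<^sup>2" if z: "cmod z = 1" for z
  proof -
    obtain s where s: "z = cis s" using z
      by (metis cis_Arg norm_eq_zero sgn_eq div_by_1 of_real_1 zero_neq_one)
    have "(cmod (laurent n D s))\<^sup>2 = 1 + (cmod (laurent n B s))\<^sup>2"
      unfolding LD LB cmod_power2 using wx[of s] by (simp add: power2_eq_square field_simps)
    then show ?thesis by (simp add: norm_laurent s)
  qed
  have trD: "trig n D s = trig n A s" for s by (simp add: trig_def LD h_def[unfolded trig_def])
  have "D + creflect (2 * n) D = A + creflect (2 * n) A"
  proof (rule laurent_inj)
    have d: "degree D \<le> 2 * n" using degBD by simp
    show "laurent n (D + creflect (2 * n) D) s = laurent n (A + creflect (2 * n) A) s" for s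
      unfolding laurent_self_reflect[OF d] laurent_self_reflect[OF dA(1)] trD ..
  qed
  then have "coeff (D + creflect (2 * n) D) 0 = coeff (A + creflect (2 * n) A) 0" by simp
  moreover have "coeff A (2 * n) = 0" using deg_A n_pos by (intro coeff_eq_0) simp
  ultimately have D0: "coeff D 0 = coeff A 0" using top by (simp add: coeff_creflect)
  \<comment> \<open>On the circle |D| >= 1. Inside, the zeros t(j) of Delta serve as nodes: there
    z^(-n) D is imaginary with ordinate (w + x) / 2, and w x > 0 gives it the alternating sign of w,
    matching that of \<open>sinprod\<close>.\<close>
  have Dnz: "poly D z \<noteq> 0" if "cmod z \<le> 1" for z
  proof (cases "cmod z = 1")
    case True
    show ?thesis
    proof
      assume "poly D z = 0"
      then show False using norm[OF True] zero_le_power2[of "cmod (poly B z)"] by simp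
    qed
  next
    case False
    then have z: "cmod z < 1" using that by simp
    show ?thesis
    proof (rule T.interp_nonzero_in_disk[OF refl n_pos degBD(1), where y = "\<lambda>j. (w (t j) + x (t j)) / 2" and e = "- \<sigma>"])
      fix j assume j: "j < 2 * n"
      have ht: "h (t j) = 0" using t_zero[of j] j by (simp add: h_def)
      show "laurent n D (t j) = \<i> * complex_of_real ((w (t j) + x (t j)) / 2)"
        unfolding LD by (simp add: complex_eq_iff ht)
      have "w (t j) * x (t j) > 0" unfolding wx ht by (simp add: add_pos_nonneg)
      then have "\<sigma> * (-1) ^ j * ((w (t j) + x (t j)) / 2) > 0"
        using wt[OF j] sigma_sign_cases[of j] by (auto simp: zero_less_mult_iff)
      moreover have "- ((-1) ^ j) * sinprod (2 * n) t j (t j) > 0"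
        using T.sinprod_sign[OF j] unfolding odd_sign[OF j] .
      moreover have "(-1) ^ j = (1::real) \<or> (-1) ^ j = (-1::real)" by (cases "even j") auto
      ultimately show "- \<sigma> * ((w (t j) + x (t j)) / 2 / sinprod (2 * n) t j (t j)) > 0"
        using sigma
        by (elim disjE) (simp_all add: zero_less_divide_iff zero_less_mult_iff mult_less_0_iff divide_less_0_iff)
    qed (rule z)
  qed
  have "isodata B D"
    unfolding isodata_def using degBD Dnz norm trD A_0 by (auto simp: D0)
  moreover have "pole_fun B D (\<theta> j) = 0 \<and> Im (laurent n B (\<theta> j)) = v j" if "j < 2 * n" for j
    unfolding pole_fun_def BD using LE[OF that] uv[OF that] by (simp add: trig_def LB)
  ultimately show ?thesis by blast
qed

end

section \<open>Counting gaps and parametrising them\<close>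

text \<open>Among finitely many disjoint relatively closed pieces each one is also relatively open,
  hence a maximal connected subset.\<close>

lemma components_of_finite_partition:
  fixes U :: "'a::topological_space set"
  assumes U: "U = (\<Union>j\<in>J. a j)" and J: "finite J"
    and conn: "\<And>j. j \<in> J \<Longrightarrow> connected (a j) \<and> a j \<noteq> {}"
    and clo: "\<And>j. j \<in> J \<Longrightarrow> closedin (top_of_set U) (a j)"
    and disj: "\<And>i j. i \<in> J \<Longrightarrow> j \<in> J \<Longrightarrow> i \<noteq> j \<Longrightarrow> a i \<inter> a j = {}"
  shows "components U = a ` J"
proof -
  have comp: "a j \<in> components U" if j: "j \<in> J" for j
    unfolding in_components_maximal
  proof (intro conjI allI impI)
    have "closedin (top_of_set U) (\<Union>i\<in>J - {j}. a i)"
      using J clo by (intro closedin_Union) auto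
    moreover have "U - a j = (\<Union>i\<in>J - {j}. a i)"
      using disj j unfolding U by blast
    ultimately have "openin (top_of_set U) (a j)"
      using U j by (auto simp: openin_closedin_eq)
    fix D assume D: "D \<noteq> {} \<and> a j \<subseteq> D \<and> D \<subseteq> U \<and> connected D"
    then have "openin (top_of_set D) (a j)" "closedin (top_of_set D) (a j)"
      using \<open>openin (top_of_set U) (a j)\<close> clo[OF j]
      by (meson openin_subset_trans closedin_subset_trans)+
    then show "D = a j"
      using D conn[OF j] connected_clopen[of D] by blast
  qed (use conn[OF j] U j in auto)
  have "C \<in> a ` J" if C: "C \<in> components U" for C
  proof -
    obtain x where "x \<in> C" "x \<in> U" using C in_components_nonempty in_components_subset by blast
    then obtain j where "j \<in> J" "x \<in> a j" using U by blast
    then have "C = a j" using components_eq[OF C comp[of j]] \<open>x \<in> C\<close> by blast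
    then show ?thesis using \<open>j \<in> J\<close> by blast
  qed
  then show ?thesis using comp by blast
qed

lemma partition_interval:
  fixes t :: "nat \<Rightarrow> 'a::linorder"
  assumes "t 0 \<le> s" "s < t m"
  shows "\<exists>j<m. t j \<le> s \<and> s < t (Suc j)"
  using assms
proof (induction m)
  case (Suc m)
  then show ?case by (cases "s < t m") (auto simp: less_Suc_eq)
qed simp

section \<open>Gap arcs as connected components\<close>

context band_structure
begin

definition gap_arc :: "nat \<Rightarrow> complex set" where
  "gap_arc j = cis ` {l j<..<r j}"

definition open_indices :: "nat set" where
  "open_indices = {j. j < 2 * n \<and> l j < r j}"

lemma degree_A_le: "degree A \<le> 2 * n" using deg_A by simp

lemma cmod_reflection_sum: "cmod (poly (A + creflect (2 * n) A) (cis s)) = 2 * \<bar>trig n A s\<bar>"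
  unfolding poly_cis[of _ _ n] laurent_self_reflect[OF degree_A_le] norm_mult norm_of_real by simp

text \<open>Angles are measured from t(0), which makes the window of length 2 pi the union of the
  cells.\<close>

lemma circle_angle:
  assumes "cmod z = 1"
  obtains j s where "j < 2 * n" "t j \<le> s" "s < t (Suc j)" "z = cis s"
proof -
  define s where "s = t 0 + Arg2pi (z / cis (t 0))"
  have "z / cis (t 0) = cis (Arg2pi (z / cis (t 0)))"
    using Arg2pi_eq[of "z / cis (t 0)"] assms by (simp add: cis_conv_exp norm_divide)
  then have "z = cis s" by (simp add: s_def cis_mult[symmetric] field_simps)
  moreover have "t 0 \<le> s" "s < t (2 * n)"
    using Arg2pi_ge_0 Arg2pi_lt_2pi t_period by (auto simp: s_def)
  ultimately show ?thesis using partition_interval[of t s "2 * n"] that by blast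
qed

lemma angle_window: "j < 2 * n \<Longrightarrow> t j \<le> s \<Longrightarrow> s < t (Suc j) \<Longrightarrow> s \<in> {t 0..<t 0 + 2 * pi}"
  using t_le[of 0 j] t_le[of "Suc j" "2 * n"] t_period by auto

lemma cis_inj_window:
  assumes "i < 2 * n" "t i \<le> s" "s < t (Suc i)" "j < 2 * n" "t j \<le> s'" "s' < t (Suc j)" "cis s = cis s'"
  shows "s = s' \<and> i = j"
proof
  have "s \<in> {t 0..<t 0 + 2 * pi}" "s' \<in> {t 0..<t 0 + 2 * pi}"
    using angle_window assms by blast+
  then show e: "s = s'" using cis_inj[OF assms(7)] by auto
  show "i = j"
    using assms e t_le[of "Suc i" j] t_le[of "Suc j" i] by (cases i j rule: linorder_cases) auto
qed

lemma gap_ge_1: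
  assumes "j < 2 * n" "l j \<le> s" "s \<le> r j"
  shows "\<bar>trig n A s\<bar> \<ge> 1"
  using gap_edge[OF assms(1)] gap_inside[OF assms(1), of s] assms by (cases "s = l j \<or> s = r j") auto

lemma gap_interior:
  assumes "j < 2 * n" "t j \<le> s" "s < t (Suc j)" "\<bar>trig n A s\<bar> > 1"
  shows "l j < s \<and> s < r j"
  using gap_maximal[OF assms(1), of s] gap_edge[OF assms(1)] assms by (auto simp: less_le)

lemma components_gap:
  "components {z \<in> sphere 0 1. cmod (poly (A + creflect (2 * n) A) z) > 2} = gap_arc ` open_indices"
proof (rule components_of_finite_partition)
  let ?U = "{z \<in> sphere 0 1. cmod (poly (A + creflect (2 * n) A) z) > 2}"
  have mem: "z \<in> ?U \<longleftrightarrow> (\<exists>j\<in>open_indices. z \<in> gap_arc j)" for z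
  proof
    assume z: "z \<in> ?U"
    then have "cmod z = 1" by simp
    then obtain j s where js: "j < 2 * n" "t j \<le> s" "s < t (Suc j)" "z = cis s" by (rule circle_angle)
    then have "\<bar>trig n A s\<bar> > 1" using z cmod_reflection_sum[of s] by (simp del: poly_add)
    then have "l j < s \<and> s < r j" using gap_interior js by blast
    then show "\<exists>j\<in>open_indices. z \<in> gap_arc j"
      using js by (intro bexI[of _ j]) (auto simp: gap_arc_def open_indices_def)
  next
    assume "\<exists>j\<in>open_indices. z \<in> gap_arc j"
    then obtain j s where "j < 2 * n" "l j < s" "s < r j" "z = cis s"
      by (auto simp: gap_arc_def open_indices_def)
    then show "z \<in> ?U" using gap_inside[of j s] cmod_reflection_sum[of s] by (simp del: poly_add)
  qed
  then show U: "?U = (\<Union>j\<in>open_indices. gap_arc j)" by blast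
  show "finite open_indices" by (simp add: open_indices_def)
  show "connected (gap_arc j) \<and> gap_arc j \<noteq> {}" if "j \<in> open_indices" for j
    using that unfolding gap_arc_def open_indices_def
    by (auto intro!: connected_continuous_image continuous_intros)
  show "gap_arc i \<inter> gap_arc j = {}" if "i \<in> open_indices" "j \<in> open_indices" "i \<noteq> j" for i j
  proof (rule ccontr)
    assume "gap_arc i \<inter> gap_arc j \<noteq> {}"
    then obtain s s' where s: "l i < s" "s < r i" "l j < s'" "s' < r j" "cis s = cis s'"
      by (auto simp: gap_arc_def)
    then have "i = j"
      using cis_inj_window[of i s j s'] gap_order[of i] gap_order[of j] that(1,2)
      by (auto simp: open_indices_def)
    then show False using that by simp
  qed
  show "closedin (top_of_set ?U) (gap_arc j)" if j: "j \<in> open_indices" for j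
  proof -
    have j2: "j < 2 * n" using j by (simp add: open_indices_def)
    \<comment> \<open>The compact image of the closed cell cuts the arc out of the set; the cell
      ends are zeros of Delta and lie outside the set.\<close>
    have "gap_arc j = ?U \<inter> cis ` {t j..t (Suc j)}"
    proof (intro equalityI subsetI IntI)
      fix z assume z: "z \<in> gap_arc j"
      then show "z \<in> ?U" using mem j by blast
      show "z \<in> cis ` {t j..t (Suc j)}" using z gap_order[OF j2] by (auto simp: gap_arc_def)
    next
      fix z assume z: "z \<in> ?U \<inter> cis ` {t j..t (Suc j)}"
      then obtain s where s: "t j \<le> s" "s \<le> t (Suc j)" "z = cis s" by auto
      then have h: "\<bar>trig n A s\<bar> > 1" using z cmod_reflection_sum[of s] by (simp del: poly_add)
      then have "s \<noteq> t (Suc j)" using t_zero[of "Suc j"] j2 by auto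
      then show "z \<in> gap_arc j" using gap_interior[OF j2 s(1) _ h] s by (auto simp: gap_arc_def)
    qed
    moreover have "closed (cis ` {t j..t (Suc j)})"
      by (intro compact_imp_closed compact_continuous_image continuous_intros) simp
    ultimately show ?thesis by (metis closedin_closed_Int)
  qed
qed

lemma card_components_gap:
  "card (components {z \<in> sphere 0 1. cmod (poly (A + creflect (2 * n) A) z) > 2}) = card open_indices"
  unfolding components_gap
proof (rule card_image, rule inj_onI)
  fix i j assume ij: "i \<in> open_indices" "j \<in> open_indices" "gap_arc i = gap_arc j"
  define s where "s = (l i + r i) / 2"
  have s: "l i < s" "s < r i" using ij(1) by (auto simp: s_def open_indices_def)
  then have "cis s \<in> gap_arc j" using ij(3) by (auto simp: gap_arc_def)
  then obtain s' where "l j < s'" "s' < r j" "cis s = cis s'" by (auto simp: gap_arc_def)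
  then show "i = j"
    using cis_inj_window[of i s j s'] gap_order[of i] gap_order[of j] s ij(1,2)
    by (auto simp: open_indices_def)
qed

text \<open>The curve \<open>v\<^sup>2 = \<Delta>\<^sup>2/4 - 1\<close> over a closed gap interval, parametrised by the unit circle: a
  point goes to its scaled abscissa and the branch of the square root given by the half plane.\<close>

definition gap_angle :: "nat \<Rightarrow> complex \<Rightarrow> real" where
  "gap_angle j c = (l j + r j) / 2 + Re c * ((r j - l j) / 2)"

definition gap_value :: "nat \<Rightarrow> complex \<Rightarrow> real" where
  "gap_value j c = (if Im c \<ge> 0 then 1 else -1) * sqrt ((trig n A (gap_angle j c))\<^sup>2 - 1)"

lemma circle_Re_Im: "cmod c = 1 \<Longrightarrow> (Re c)\<^sup>2 + (Im c)\<^sup>2 = 1"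
  by (simp add: cmod_power2[symmetric])

lemma gap_angle_bounds:
  assumes "j < 2 * n" "cmod c = 1"
  shows "l j \<le> gap_angle j c \<and> gap_angle j c \<le> r j"
proof -
  have c: "-1 \<le> Re c" "Re c \<le> 1" using abs_Re_le_cmod[of c] assms(2) by auto
  have d: "(r j - l j) / 2 \<ge> 0" using gap_order[OF assms(1)] by simp
  have "Re c * ((r j - l j) / 2) \<le> 1 * ((r j - l j) / 2)" "-1 * ((r j - l j) / 2) \<le> Re c * ((r j - l j) / 2)"
    by (rule mult_right_mono[OF c(2) d], rule mult_right_mono[OF c(1) d])
  then show ?thesis by (auto simp: gap_angle_def field_simps)
qed

lemma gap_value_square:
  assumes "j < 2 * n" "cmod c = 1"
  shows "(gap_value j c)\<^sup>2 = (trig n A (gap_angle j c))\<^sup>2 - 1"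
proof -
  have "\<bar>trig n A (gap_angle j c)\<bar> \<ge> 1" using gap_ge_1[OF assms(1)] gap_angle_bounds[OF assms] by blast
  then have "(trig n A (gap_angle j c))\<^sup>2 - 1 \<ge> 0" by (simp add: abs_le_square_iff[of 1, simplified])
  then show ?thesis by (simp add: gap_value_def power_mult_distrib)
qed

lemma gap_value_closed:
  assumes "j < 2 * n" "l j = r j"
  shows "gap_angle j c = l j" "gap_value j c = 0"
proof -
  show "gap_angle j c = l j" by (simp add: gap_angle_def assms)
  then show "gap_value j c = 0"
    using gap_edge[OF assms(1)] by (auto simp: gap_value_def abs_square_eq_1)
qed

lemma continuous_gap_angle: "continuous_on S (gap_angle j)"
  unfolding gap_angle_def[abs_def] by (intro continuous_intros)

text \<open>The real points of the circle go to the gap edges, where the root is 0 and its two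
  branches can be glued.\<close>

lemma trig_at_endpoint:
  assumes "j < 2 * n" "cmod c = 1" "Im c = 0"
  shows "(trig n A (gap_angle j c))\<^sup>2 = 1"
proof -
  have "Re c = 1 \<or> Re c = -1" using circle_Re_Im[OF assms(2)] assms(3) by (simp add: power2_eq_1_iff)
  then have "gap_angle j c = r j \<or> gap_angle j c = l j" by (auto simp: gap_angle_def field_simps)
  then show ?thesis using gap_edge[OF assms(1)] by (auto simp: abs_square_eq_1)
qed

lemma continuous_gap_value:
  assumes "j < 2 * n"
  shows "continuous_on (sphere 0 1) (gap_value j)"
proof -
  let ?g = "\<lambda>c. sqrt ((trig n A (gap_angle j c))\<^sup>2 - 1)"
  have g: "continuous_on S ?g" for S
    by (intro continuous_intros continuous_on_compose2[OF continuous_on_trig continuous_gap_angle]) auto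
  have "continuous_on ({c \<in> sphere 0 1. Im c \<ge> 0} \<union> {c \<in> sphere 0 1. Im c \<le> 0})
      (\<lambda>c. if Im c \<ge> 0 then ?g c else - ?g c)"
  proof (rule continuous_on_cases)
    have "{c \<in> sphere 0 1. Im c \<ge> 0} = sphere 0 1 \<inter> {c. Im c \<ge> 0}"
      "{c \<in> sphere 0 1. Im c \<le> 0} = sphere 0 1 \<inter> {c. Im c \<le> 0}" by auto
    then show "closed {c \<in> sphere (0::complex) 1. Im c \<ge> 0}" "closed {c \<in> sphere (0::complex) 1. Im c \<le> 0}"
      by (auto intro!: closed_Int closed_halfspace_Im_ge closed_halfspace_Im_le)
    show "\<forall>c. c \<in> {c \<in> sphere 0 1. 0 \<le> Im c} \<and> \<not> 0 \<le> Im c \<or> c \<in> {c \<in> sphere 0 1. Im c \<le> 0} \<and> 0 \<le> Im c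
        \<longrightarrow> ?g c = - ?g c"
      using trig_at_endpoint[OF assms] by auto
  qed (intro g continuous_intros)+
  moreover have "{c \<in> sphere 0 1. Im c \<ge> 0} \<union> {c \<in> sphere 0 1. Im c \<le> 0} = sphere (0::complex) 1" by auto
  moreover have "gap_value j = (\<lambda>c. if Im c \<ge> 0 then ?g c else - ?g c)"
    by (auto simp: gap_value_def)
  ultimately show ?thesis by simp
qed

text \<open>The abscissa returns Re c because the gap is open. Between the edges the root is
  positive, so the sign of the value returns the half plane; at the edges Im c = 0.\<close>

lemma gap_param_inj:
  assumes j: "j \<in> open_indices" and c: "cmod c = 1" "cmod c' = 1"
    and eq: "gap_angle j c = gap_angle j c'" "gap_value j c = gap_value j c'"
  shows "c = c'"
proof -
  have j2: "j < 2 * n" and lr: "l j < r j" using j by (auto simp: open_indices_def)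
  have re: "Re c = Re c'" using eq(1) lr by (simp add: gap_angle_def)
  then have "(Im c)\<^sup>2 = (Im c')\<^sup>2" using circle_Re_Im[OF c(1)] circle_Re_Im[OF c(2)] by simp
  then have im: "\<bar>Im c\<bar> = \<bar>Im c'\<bar>" by (simp add: power2_eq_iff abs_eq_iff)
  have "Im c = Im c'"
  proof (cases "Im c = 0")
    case False
    then have "(Im c)\<^sup>2 > 0" by simp
    then have "(Re c)\<^sup>2 < 1" using circle_Re_Im[OF c(1)] by linarith
    then have "\<bar>Re c\<bar> < 1" by (simp add: abs_square_less_1)
    then have b: "-1 < Re c" "Re c < 1" by auto
    have d: "(r j - l j) / 2 > 0" using lr by simp
    have "Re c * ((r j - l j) / 2) < 1 * ((r j - l j) / 2)" "-1 * ((r j - l j) / 2) < Re c * ((r j - l j) / 2)"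
      by (rule mult_strict_right_mono[OF b(2) d], rule mult_strict_right_mono[OF b(1) d])
    then have "l j < gap_angle j c" "gap_angle j c < r j" by (auto simp: gap_angle_def field_simps)
    then have "\<bar>trig n A (gap_angle j c)\<bar> > 1" by (rule gap_inside[OF j2])
    then have "(trig n A (gap_angle j c))\<^sup>2 > 1" using abs_square_le_1 not_le by blast
    then have "sqrt ((trig n A (gap_angle j c))\<^sup>2 - 1) > 0" by simp
    then show ?thesis using eq(2) im unfolding gap_value_def eq(1)[symmetric]
      by (auto split: if_splits)
  qed (use im in auto)
  then show ?thesis using re by (rule complex_eqI[rotated])
qed

lemma gap_param_surj:
  assumes j: "j \<in> open_indices" and s: "l j \<le> s" "s \<le> r j" and v: "v\<^sup>2 = (trig n A s)\<^sup>2 - 1"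
  shows "\<exists>c. cmod c = 1 \<and> gap_angle j c = s \<and> gap_value j c = v"
proof -
  have j2: "j < 2 * n" and lr: "l j < r j" using j by (auto simp: open_indices_def)
  \<comment> \<open>The inverse of the affine map from [-1, 1] onto [l j, r j].\<close>
  define x where "x = (2 * s - l j - r j) / (r j - l j)"
  have x: "-1 \<le> x" "x \<le> 1" using s lr by (auto simp: x_def field_simps)
  then have x2: "x\<^sup>2 \<le> 1" by (simp add: abs_square_le_1)
  define c where "c = Complex x ((if v \<ge> 0 then 1 else -1) * sqrt (1 - x\<^sup>2))"
  have c: "cmod c = 1" using x2 by (simp add: c_def cmod_def power_mult_distrib)
  have a: "gap_angle j c = s" using lr by (simp add: gap_angle_def c_def x_def field_simps)
  have "sqrt (v\<^sup>2) = sqrt ((trig n A s)\<^sup>2 - 1)" using v by simp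
  then have av: "\<bar>v\<bar> = sqrt ((trig n A s)\<^sup>2 - 1)" by simp
  have "gap_value j c = v"
  proof (cases "v \<ge> 0")
    case True
    then have "Im c \<ge> 0" using x2 by (simp add: c_def)
    then show ?thesis using True av by (simp add: gap_value_def a)
  next
    case False
    \<comment> \<open>The convention assigns the real axis to the positive branch, so a negative
      value has to avoid it; there v would be 0.\<close>
    have "Im c \<noteq> 0"
    proof
      assume "Im c = 0"
      then have "(trig n A s)\<^sup>2 = 1" using trig_at_endpoint[OF j2 c] a by simp
      then show False using v False by simp
    qed
    moreover have "Im c \<le> 0" using False x2 by (simp add: c_def)
    ultimately have "\<not> Im c \<ge> 0" by simp
    then show ?thesis using False av by (simp add: gap_value_def a)
  qed
  then show ?thesis using c a by blast
qed

end

section \<open>The homeomorphism\<close>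

text \<open>Passes from the product over \<open>I\<close> to the topology of the function type, a
  product over all indices: on extensional functions the other coordinates are constant.\<close>

lemma product_subspace_homeomorphic:
  fixes S :: "('i \<Rightarrow> 'a::topological_space) set"
  assumes "S \<subseteq> extensional I"
  shows "subtopology (product_topology (\<lambda>_. euclidean) I) S homeomorphic_space top_of_set S"
proof -
  let ?X = "subtopology (product_topology (\<lambda>_. euclidean :: 'a topology) I) S"
  have tX: "topspace ?X = S" using assms by (auto simp: topspace_product_topology PiE_def)
  have 1: "continuous_map ?X (top_of_set S) id"
  proof -
    have "continuous_map ?X (product_topology (\<lambda>_. euclidean) UNIV) id"
      unfolding continuous_map_componentwise_UNIV
    proof
      fix k
      show "continuous_map ?X euclidean (\<lambda>x. id x k)"
      proof (cases "k \<in> I")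
        case True
        show ?thesis
          unfolding id_apply
          by (rule continuous_map_from_subtopology[OF continuous_map_product_projection[OF True]])
      next
        case False
        have "continuous_map ?X euclidean (\<lambda>_. undefined :: 'a)" by simp
        then show ?thesis
        proof (rule continuous_map_eq)
          fix x assume "x \<in> topspace ?X"
          then have "x \<in> extensional I" using tX assms by blast
          then show "undefined = id x k" using False by (simp add: extensional_def)
        qed
      qed
    qed
    then show ?thesis
      unfolding euclidean_product_topology using tX by (simp add: continuous_map_in_subtopology)
  qed
  have 2: "continuous_map (top_of_set S) ?X id"
  proof -
    have "continuous_map (top_of_set S) euclidean (\<lambda>x. x k)" for k
      using continuous_on_product_then_coordinatewise[of S "\<lambda>x. x" k] by simp
    then have "continuous_map (top_of_set S) (product_topology (\<lambda>_. euclidean) I) id"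
      using assms by (auto simp: continuous_map_componentwise)
    then show ?thesis by (simp add: continuous_map_in_subtopology)
  qed
  have "homeomorphic_maps ?X (top_of_set S) id id"
    using 1 2 by (simp add: homeomorphic_maps_def)
  then show ?thesis unfolding homeomorphic_space_def by blast
qed

lemma homeomorphic_imp_homeomorphic_space:
  assumes "S homeomorphic T"
  shows "top_of_set S homeomorphic_space top_of_set T"
proof -
  obtain f g where fg: "homeomorphism S T f g" using assms by (auto simp: homeomorphic_def)
  then have "homeomorphic_maps (top_of_set S) (top_of_set T) f g"
    by (auto simp: homeomorphism_def homeomorphic_maps_def continuous_map_in_subtopology)
  then show ?thesis unfolding homeomorphic_space_def by blast
qed

text \<open>The relation is itself compact, and both projections are continuous bijections from it
  onto Hausdorff spaces. Neither induced map has to be shown continuous by hand.\<close>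

lemma homeomorphic_of_closed_bijective_relation:
  fixes S :: "'a::t2_space set" and T :: "'b::t2_space set"
  assumes "compact S" "compact T" and R: "closedin (top_of_set (S \<times> T)) R"
    and l: "\<And>x. x \<in> S \<Longrightarrow> \<exists>!y. (x, y) \<in> R" and r: "\<And>y. y \<in> T \<Longrightarrow> \<exists>!x. (x, y) \<in> R"
  shows "S homeomorphic T"
proof -
  have RS: "R \<subseteq> S \<times> T" using R closedin_subset by fastforce
  have "compact R" using closedin_compact[OF compact_Times[OF assms(1,2)] R] .
  moreover have "fst ` R = S" "snd ` R = T" using RS l r by force+
  moreover have "inj_on fst R" "inj_on snd R"
    using RS l r by (force intro!: inj_onI)+
  ultimately have "R homeomorphic S" "R homeomorphic T"
    by (auto intro!: homeomorphic_compact continuous_on_fst continuous_on_snd continuous_on_id)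
  then show ?thesis using homeomorphic_sym homeomorphic_trans by blast
qed

text \<open>Tychonoff's theorem with {undefined} as the factor at each index outside
  \<open>I\<close>.\<close>

lemma compact_PiE_euclidean:
  fixes Q :: "'i \<Rightarrow> 'a::topological_space set"
  assumes "\<And>i. i \<in> I \<Longrightarrow> compact (Q i)"
  shows "compact (PiE I Q)"
proof -
  have "PiE I Q = PiE UNIV (\<lambda>i. if i \<in> I then Q i else {undefined})"
    by (auto simp: PiE_iff extensional_def split: if_splits)
  moreover have "compactin (product_topology (\<lambda>_. euclidean) UNIV) \<dots>"
    unfolding compactin_PiE using assms by auto
  ultimately show ?thesis by (simp add: euclidean_product_topology)
qed

text \<open>The evaluation point varies as well, since the Dirichlet angles move with the torus
  point.\<close>

lemma continuous_on_szego:
  assumes "\<And>i. i < m \<Longrightarrow> continuous_on X (\<lambda>x. f x i)" and "\<And>x i. x \<in> X \<Longrightarrow> i < m \<Longrightarrow> f x i \<in> ball 0 1"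
    and g: "continuous_on X g"
  shows "continuous_on X (\<lambda>x. poly (szego_B m (f x)) (g x))
    \<and> continuous_on X (\<lambda>x. poly (szego_D m (f x)) (g x))"
  using assms(1,2)
proof (induction m)
  case (Suc m)
  have IH: "continuous_on X (\<lambda>x. poly (szego_B m (f x)) (g x))"
    "continuous_on X (\<lambda>x. poly (szego_D m (f x)) (g x))"
    using Suc by auto
  have f: "continuous_on X (\<lambda>x. f x m)" using Suc.prems by simp
  have r: "continuous_on X (\<lambda>x. rho (f x m))"
    unfolding rho_def by (intro continuous_intros f)
  have r0: "rho (f x m) \<noteq> 0" if "x \<in> X" for x
    using rho_nonzero Suc.prems(2) that by blast
  show ?case
    using IH f r g r0 by (auto intro!: continuous_intros)
qed simp

context band_structure
begin

text \<open>The constant coefficient of z^n Delta is D(0) plus the conjugate of the coefficient of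
  z^(2 n) in \<open>D\<close>, and the latter is zero by the degree bound.\<close>

lemma isodata_coeff_0:
  assumes "isodata B D"
  shows "coeff D 0 = coeff A 0"
proof -
  have d: "degree D \<le> 2 * n" and tr: "\<And>s. trig n D s = trig n A s"
    using assms by (auto simp: isodata_def)
  have "D + creflect (2 * n) D = A + creflect (2 * n) A"
    by (rule laurent_inj[of n]) (simp only: laurent_self_reflect[OF d] laurent_self_reflect[OF degree_A_le] tr)
  then have "coeff (D + creflect (2 * n) D) 0 = coeff (A + creflect (2 * n) A) 0" by simp
  moreover have "coeff A (2 * n) = 0" "coeff D (2 * n) = 0"
    using deg_A n_pos assms by (auto simp: isodata_def intro!: coeff_eq_0)
  ultimately show ?thesis by (simp add: coeff_creflect)
qed

definition iso_set :: "(nat \<Rightarrow> complex) set" where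
  "iso_set = {\<beta> \<in> disk_power (2 * n). \<forall>s. trig n (szego_D (2 * n) \<beta>) s = trig n A s}"

lemma iso_set_ball: "\<beta> \<in> iso_set \<Longrightarrow> i < 2 * n \<Longrightarrow> \<beta> i \<in> ball 0 1"
  by (auto simp: iso_set_def disk_power_def)

lemma iso_set_isodata:
  assumes "\<beta> \<in> iso_set"
  shows "isodata (szego_B (2 * n) \<beta>) (szego_D (2 * n) \<beta>)"
proof -
  note b = iso_set_ball[OF assms]
  obtain x where "x > 0" "coeff (szego_D (2 * n) \<beta>) 0 = complex_of_real x"
    using szego_D_zero[of "2 * n" \<beta>] b by blast
  then show ?thesis
    unfolding isodata_def
    using szego_degree[of "2 * n" \<beta>] szego_D_nonzero[of "2 * n" \<beta>] szego_circle[of "2 * n" \<beta>] b assms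
    by (auto simp: iso_set_def)
qed

lemma isodata_iso_set:
  assumes "isodata B D"
  obtains \<beta> where "\<beta> \<in> iso_set" "szego_B (2 * n) \<beta> = B" "szego_D (2 * n) \<beta> = D"
proof -
  obtain x where x: "coeff D 0 = complex_of_real x" "x > 0" using assms by (auto simp: isodata_def)
  have "\<exists>\<beta>. (\<forall>i<2*n. \<beta> i \<in> ball 0 1) \<and> szego_B (2 * n) \<beta> = B \<and> szego_D (2 * n) \<beta> = D"
    by (rule szego_surj[OF _ _ _ x]) (use assms n_pos in \<open>auto simp: isodata_def\<close>)
  then obtain \<beta> where \<beta>: "\<forall>i<2*n. \<beta> i \<in> ball 0 1" "szego_B (2 * n) \<beta> = B" "szego_D (2 * n) \<beta> = D"
    by blast
  let ?\<beta> = "restrict \<beta> {..<2*n}"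
  have "szego_B (2 * n) ?\<beta> = B" "szego_D (2 * n) ?\<beta> = D"
    using szego_cong[of "2 * n" ?\<beta> \<beta>] \<beta> by auto
  moreover have "?\<beta> \<in> iso_set"
    using \<beta> assms calculation by (auto simp: iso_set_def disk_power_def isodata_def)
  ultimately show ?thesis using that by blast
qed

lemma continuous_on_laurent_szego:
  assumes f: "\<And>i. i < 2 * n \<Longrightarrow> continuous_on X (\<lambda>x. f x i)"
    and ball: "\<And>x i. x \<in> X \<Longrightarrow> i < 2 * n \<Longrightarrow> f x i \<in> ball 0 1" and g: "continuous_on X g"
  shows "continuous_on X (\<lambda>x. laurent n (szego_B (2 * n) (f x)) (g x))"
    "continuous_on X (\<lambda>x. laurent n (szego_D (2 * n) (f x)) (g x))"
proof -
  have c: "continuous_on X (\<lambda>x. cis (g x))" "continuous_on X (\<lambda>x. cis (- (real n * g x)))"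
    by (intro continuous_intros g)+
  show "continuous_on X (\<lambda>x. laurent n (szego_B (2 * n) (f x)) (g x))"
    "continuous_on X (\<lambda>x. laurent n (szego_D (2 * n) (f x)) (g x))"
    using continuous_on_szego[OF f ball c(1)] c(2) unfolding laurent_def
    by (auto intro!: continuous_on_mult)
qed

lemma continuous_on_coordinate: "continuous_on S (\<lambda>x. x i)" for S :: "(nat \<Rightarrow> complex) set"
  using continuous_on_product_then_coordinatewise[of S "\<lambda>x. x" i] by simp

text \<open>All members share D(0) = x, so rho(beta_i) >= 1 / x. The set thus lies in a compact
  product of smaller disks, where it is closed.\<close>

lemma compact_iso_set: "compact iso_set"
proof -
  obtain x where x: "x > 0" "coeff A 0 = complex_of_real x" using A_0 by blast
  \<comment> \<open>The radius at which x sqrt (1 - radius^2) = 1.\<close>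
  define \<rho> where "\<rho> = sqrt (1 - 1 / x\<^sup>2)"
  have \<rho>: "\<rho> < 1" using x(1) by (simp add: \<rho>_def)
  have bound: "cmod (\<beta> i) \<le> \<rho>" if \<beta>: "\<beta> \<in> iso_set" and i: "i < 2 * n" for \<beta> i
  proof -
    have "coeff (szego_D (2 * n) \<beta>) 0 = complex_of_real x"
      using isodata_coeff_0[OF iso_set_isodata[OF \<beta>]] x by simp
    then have "x * sqrt (1 - (cmod (\<beta> i))\<^sup>2) \<ge> 1"
      using szego_D_zero[of "2 * n" \<beta>] iso_set_ball[OF \<beta>] i by (auto simp: of_real_eq_iff)
    then have "1 \<le> (x * sqrt (1 - (cmod (\<beta> i))\<^sup>2))\<^sup>2" by (simp add: one_le_power)
    also have "\<dots> = x\<^sup>2 * (1 - (cmod (\<beta> i))\<^sup>2)"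
      using iso_set_ball[OF \<beta> i] by (simp add: power_mult_distrib power_le_one)
    finally have "(cmod (\<beta> i))\<^sup>2 \<le> 1 - 1 / x\<^sup>2" using x(1) by (simp add: field_simps)
    then show ?thesis unfolding \<rho>_def by (rule real_le_rsqrt)
  qed
  define Q where "Q = PiE {..<2*n} (\<lambda>_. cball (0::complex) \<rho>)"
  have Q: "compact Q" unfolding Q_def by (rule compact_PiE_euclidean) simp
  have Qb: "\<beta> i \<in> ball 0 1" if "\<beta> \<in> Q" "i < 2 * n" for \<beta> i
  proof -
    have "\<beta> i \<in> cball 0 \<rho>" using that unfolding Q_def by blast
    then show ?thesis using \<rho> by simp
  qed
  have "iso_set = (\<Inter>s. {\<beta> \<in> Q. trig n (szego_D (2 * n) \<beta>) s = trig n A s})"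
  proof (intro equalityI subsetI)
    fix \<beta> assume \<beta>: "\<beta> \<in> iso_set"
    then have "\<beta> \<in> Q" using bound[OF \<beta>] by (auto simp: Q_def iso_set_def disk_power_def PiE_iff)
    then show "\<beta> \<in> (\<Inter>s. {\<beta> \<in> Q. trig n (szego_D (2 * n) \<beta>) s = trig n A s})"
      using \<beta> by (simp add: iso_set_def)
  next
    fix \<beta> assume \<beta>: "\<beta> \<in> (\<Inter>s. {\<beta> \<in> Q. trig n (szego_D (2 * n) \<beta>) s = trig n A s})"
    then show "\<beta> \<in> iso_set" using Qb[of \<beta>] by (auto simp: iso_set_def disk_power_def Q_def PiE_iff)
  qed
  moreover have "closedin (top_of_set Q) {\<beta> \<in> Q. trig n (szego_D (2 * n) \<beta>) s = trig n A s}" for s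
    unfolding trig_def
    by (intro continuous_closedin_preimage_constant continuous_intros continuous_on_laurent_szego
        continuous_on_coordinate Qb)
  then have "closedin (top_of_set Q) (\<Inter>s. {\<beta> \<in> Q. trig n (szego_D (2 * n) \<beta>) s = trig n A s})"
    by (intro closedin_INT) auto
  ultimately show ?thesis using closedin_compact[OF Q] by simp
qed

text \<open>The relation \<open>P\<close> says that the torus point encodes the Dirichlet data of
  the coefficients. It is closed by joint continuity; \<open>isodata_exists\<close>,
  \<open>isodata_unique\<close> and the two properties of the gap parametrisation make it
  bijective.\<close>

lemma iso_set_homeomorphic_torus:
  assumes k: "card open_indices = k"
  shows "iso_set homeomorphic (PiE {..<k} (\<lambda>_. sphere (0::complex) 1))"
proof -
  let ?T = "PiE {..<k} (\<lambda>_. sphere (0::complex) 1)"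
  have "finite open_indices" by (simp add: open_indices_def)
  then obtain e0 where e0: "bij_betw e0 open_indices {..<k}"
    using k by (metis bij_betw_iff_card card_lessThan finite_lessThan)
  \<comment> \<open>Torus coordinates belong to the open gaps, relabelled by \<open>e0\<close>. Over
    a closed gap the parametrisation is constant, and the default 1 keeps \<open>c y j\<close> on
    the circle.\<close>
  define c where "c y j = (if j \<in> open_indices then y (e0 j) else 1 :: complex)" for y :: "nat \<Rightarrow> complex" and j
  have cT: "cmod (c y j) = 1" if "y \<in> ?T" for y j
  proof (cases "j \<in> open_indices")
    case True
    then have "e0 j \<in> {..<k}" using e0 bij_betwE by blast
    then have "y (e0 j) \<in> sphere 0 1" using that by blast
    then show ?thesis using True by (simp add: c_def)
  qed (simp add: c_def)
  have contc: "continuous_on S (\<lambda>z. c (snd z) j)" for S :: "((nat \<Rightarrow> complex) \<times> (nat \<Rightarrow> complex)) set" and j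
    using continuous_on_product_then_coordinatewise[OF continuous_on_snd[OF continuous_on_id], of S "e0 j"]
    by (cases "j \<in> open_indices") (simp_all add: c_def)
  let ?B = "szego_B (2 * n)" and ?D = "szego_D (2 * n)"
  define P where "P \<beta> y \<longleftrightarrow> (\<forall>j<2*n. pole_fun (?B \<beta>) (?D \<beta>) (gap_angle j (c y j)) = 0
      \<and> Im (laurent n (?B \<beta>) (gap_angle j (c y j))) = gap_value j (c y j))" for \<beta> y
  define R where "R = {z \<in> iso_set \<times> ?T. P (fst z) (snd z)}"
  have closed: "closedin (top_of_set (iso_set \<times> ?T)) R"
  proof -
    let ?X = "iso_set \<times> ?T"
    let ?th = "\<lambda>j z. gap_angle j (c (snd z) j)"
    have th: "continuous_on ?X (?th j)" for j
      by (rule continuous_on_compose2[OF continuous_gap_angle contc]) auto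
    have vl: "continuous_on ?X (\<lambda>z. gap_value j (c (snd z) j))" if "j < 2 * n" for j
      by (rule continuous_on_compose2[OF continuous_gap_value[OF that] contc]) (use cT in auto)
    have fst: "continuous_on ?X (\<lambda>z. fst z i)" for i
      by (rule continuous_on_product_then_coordinatewise[OF continuous_on_fst[OF continuous_on_id]])
    have L: "continuous_on ?X (\<lambda>z. laurent n (?B (fst z)) (?th j z))"
      "continuous_on ?X (\<lambda>z. laurent n (?D (fst z)) (?th j z))" for j
      by (rule continuous_on_laurent_szego[OF fst _ th]; use iso_set_ball in auto)+
    have 1: "closedin (top_of_set ?X) {z \<in> ?X. pole_fun (?B (fst z)) (?D (fst z)) (?th j z) = 0}" for j
      unfolding pole_fun_def trig_def laurent_linear
      by (intro continuous_closedin_preimage_constant continuous_intros L)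
    have 2: "closedin (top_of_set ?X) {z \<in> ?X. Im (laurent n (?B (fst z)) (?th j z)) - gap_value j (c (snd z) j) = 0}"
      if "j < 2 * n" for j
      by (intro continuous_closedin_preimage_constant continuous_intros L vl[OF that])
    have "closedin (top_of_set ?X) (\<Inter>j\<in>{..<2*n}. {z \<in> ?X. pole_fun (?B (fst z)) (?D (fst z)) (?th j z) = 0}
       \<inter> {z \<in> ?X. Im (laurent n (?B (fst z)) (?th j z)) - gap_value j (c (snd z) j) = 0})"
      using n_pos 1 2 by (intro closedin_INT closedin_Int) (auto simp: lessThan_empty_iff)
    moreover have "R = (\<Inter>j\<in>{..<2*n}. {z \<in> ?X. pole_fun (?B (fst z)) (?D (fst z)) (?th j z) = 0}
       \<inter> {z \<in> ?X. Im (laurent n (?B (fst z)) (?th j z)) - gap_value j (c (snd z) j) = 0})"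
      (is "R = ?I")
    proof (intro equalityI subsetI)
      fix z assume "z \<in> R"
      then show "z \<in> ?I" by (auto simp: R_def P_def)
    next
      fix z assume z: "z \<in> ?I"
      \<comment> \<open>Membership in \<open>?X\<close> is extracted from the intersection through
        one of its indices.\<close>
      have "0 \<in> {..<2 * n}" using n_pos by simp
      then have "z \<in> ?X" using z by blast
      moreover have "P (fst z) (snd z)" unfolding P_def using z by auto
      ultimately show "z \<in> R" by (simp add: R_def)
    qed
    ultimately show ?thesis by simp
  qed
  have total: "\<exists>y\<in>?T. P \<beta> y" if \<beta>: "\<beta> \<in> iso_set" for \<beta>
  proof -
    let ?w = "pole_fun (?B \<beta>) (?D \<beta>)" and ?u = "\<lambda>s. Im (laurent n (?B \<beta>) s)"
    note iso = iso_set_isodata[OF \<beta>]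
    have "\<exists>s. l j \<le> s \<and> s \<le> r j \<and> ?w s = 0" if "j < 2 * n" for j
      using pole_fun_zero[OF iso that] pole_fun_zero_in_gap[OF iso that] by blast
    then obtain s where s: "\<And>j. j < 2 * n \<Longrightarrow> l j \<le> s j \<and> s j \<le> r j \<and> ?w (s j) = 0" by metis
    have v: "(?u (s j))\<^sup>2 = (trig n A (s j))\<^sup>2 - 1" if "j < 2 * n" for j
      using pole_fun_zero_value[OF iso] s[OF that] by blast
    have "\<exists>d. cmod d = 1 \<and> gap_angle j d = s j \<and> gap_value j d = ?u (s j)" if "j \<in> open_indices" for j
      using gap_param_surj[OF that, of "s j" "?u (s j)"] s[of j] v[of j] that
      by (auto simp: open_indices_def)
    then obtain d where d: "\<And>j. j \<in> open_indices \<Longrightarrow> cmod (d j) = 1 \<and> gap_angle j (d j) = s j \<and> gap_value j (d j) = ?u (s j)"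
      by metis
    define y where "y = restrict (\<lambda>i. d (inv_into open_indices e0 i)) {..<k}"
    have inv: "inv_into open_indices e0 i \<in> open_indices" if "i < k" for i
      using that e0 by (metis bij_betw_imp_surj_on inv_into_into lessThan_iff)
    have "y \<in> ?T" using d[OF inv] by (auto simp: y_def)
    moreover have "P \<beta> y" unfolding P_def
    proof (intro allI impI)
      fix j assume j: "j < 2 * n"
      have "gap_angle j (c y j) = s j \<and> gap_value j (c y j) = ?u (s j)"
      proof (cases "j \<in> open_indices")
        case True
        then have "e0 j < k" "inv_into open_indices e0 (e0 j) = j"
          using e0 by (auto simp: bij_betw_def)
        then have "c y j = d j" using True by (simp add: c_def y_def)
        then show ?thesis using d[OF True] by simp
      next
        case False
        \<comment> \<open>In a closed gap the angle has no freedom, and the curve equation forces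
          the value 0.\<close>
        then have lr: "l j = r j" using gap_order[OF j] j by (auto simp: open_indices_def)
        then have sj: "s j = l j" using s[OF j] by simp
        have "(?u (s j))\<^sup>2 = 0" using v[OF j] gap_edge[OF j] by (auto simp: sj abs_square_eq_1)
        then show ?thesis using gap_value_closed[OF j lr] sj by simp
      qed
      then show "?w (gap_angle j (c y j)) = 0 \<and> ?u (gap_angle j (c y j)) = gap_value j (c y j)"
        using s[OF j] by simp
    qed
    ultimately show ?thesis by blast
  qed
  have functional: "y = y'" if \<beta>: "\<beta> \<in> iso_set" and y: "y \<in> ?T" "y' \<in> ?T" "P \<beta> y" "P \<beta> y'" for \<beta> y y'
  proof (rule PiE_ext[OF y(1,2)])
    fix i assume i: "i \<in> {..<k}"
    then obtain j where j: "j \<in> open_indices" "e0 j = i" using e0 by (metis bij_betw_imp_surj_on imageE)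
    have j2: "j < 2 * n" using j by (simp add: open_indices_def)
    note iso = iso_set_isodata[OF \<beta>]
    have b: "t j < gap_angle j (c x j) \<and> gap_angle j (c x j) < t (Suc j)" if "x \<in> ?T" for x
      using gap_angle_bounds[OF j2 cT[OF that]] gap_order[OF j2] by (meson le_less_trans less_le_trans)
    have "gap_angle j (c y j) = gap_angle j (c y' j)"
      by (rule pole_fun_zero_unique[OF iso j2]) (use b y j2 in \<open>auto simp: P_def\<close>)
    moreover have "gap_value j (c y j) = gap_value j (c y' j)"
      using y(3,4) j2 calculation unfolding P_def by metis
    ultimately have "c y j = c y' j" using gap_param_inj[OF j(1) cT[OF y(1)] cT[OF y(2)]] by blast
    then show "y i = y' i" using j by (simp add: c_def)
  qed
  have onto: "\<exists>\<beta>\<in>iso_set. P \<beta> y" if y: "y \<in> ?T" for y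
  proof -
    obtain B D where BD: "isodata B D"
      "\<forall>j<2*n. pole_fun B D (gap_angle j (c y j)) = 0 \<and> Im (laurent n B (gap_angle j (c y j))) = gap_value j (c y j)"
      using isodata_exists[of "\<lambda>j. gap_angle j (c y j)" "\<lambda>j. gap_value j (c y j)"]
        gap_angle_bounds cT[OF y] gap_value_square by blast
    obtain \<beta> where "\<beta> \<in> iso_set" "?B \<beta> = B" "?D \<beta> = D" using isodata_iso_set[OF BD(1)] by blast
    then show ?thesis using BD(2) by (intro bexI[of _ \<beta>]) (auto simp: P_def)
  qed
  have inj: "\<beta> = \<beta>'" if \<beta>: "\<beta> \<in> iso_set" "\<beta>' \<in> iso_set" "P \<beta> y" "P \<beta>' y" and y: "y \<in> ?T" for \<beta> \<beta>' y
  proof -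
    have "?B \<beta> = ?B \<beta>' \<and> ?D \<beta> = ?D \<beta>'"
      by (rule isodata_unique[OF iso_set_isodata[OF \<beta>(1)] iso_set_isodata[OF \<beta>(2)],
            where \<theta> = "\<lambda>j. gap_angle j (c y j)"])
         (use gap_angle_bounds cT[OF y] \<beta>(3,4) in \<open>auto simp: P_def\<close>)
    then have "\<beta> i = \<beta>' i" if "i < 2 * n" for i
      using szego_inj[of "2 * n" \<beta> \<beta>' i] iso_set_ball \<beta>(1,2) that by blast
    moreover have "\<beta> \<in> PiE {..<2*n} (\<lambda>_. ball 0 1)" "\<beta>' \<in> PiE {..<2*n} (\<lambda>_. ball 0 1)"
      using \<beta>(1,2) by (auto simp: iso_set_def disk_power_def)
    ultimately show ?thesis using PiE_ext by (metis lessThan_iff)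
  qed
  show ?thesis
  proof (rule homeomorphic_of_closed_bijective_relation[OF compact_iso_set _ closed])
    show "compact ?T" by (rule compact_PiE_euclidean) simp
    show "\<exists>!y. (\<beta>, y) \<in> R" if "\<beta> \<in> iso_set" for \<beta>
      using total[OF that] functional[OF that] that unfolding R_def by auto
    show "\<exists>!\<beta>. (\<beta>, y) \<in> R" if "y \<in> ?T" for y
      using onto[OF that] inj[OF _ _ _ _ that] that unfolding R_def by auto
  qed
qed

end

theorem theorem5p9:
  fixes p k :: nat and \<alpha> :: "nat \<Rightarrow> complex"
  assumes "p > 0" and "even p"
    and "\<alpha> \<in> disk_power p"
    and "card (open_gaps p \<alpha>) = k"
  shows "is_torus k (subtopology (complex_power_topology p) (isospectral_set p \<alpha>))"
proof -
  obtain n where p: "p = 2 * n" using assms(2) by blast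
  have n: "n \<ge> 1" using assms(1) p by simp
  define A where "A = szego_D p \<alpha>"
  have b: "\<alpha> i \<in> ball 0 1" if "i < p" for i
    using PiE_mem[OF assms(3)[unfolded disk_power_def]] that by simp
  have nz: "poly A w \<noteq> 0" if "cmod w \<le> 1" for w
    unfolding A_def using b that by (intro szego_D_nonzero) auto
  have "cmod (poly A z) \<ge> 1" if "cmod z = 1" for z
  proof -
    have "(cmod (poly A z))\<^sup>2 = 1 + (cmod (poly (szego_B p \<alpha>) z))\<^sup>2"
      unfolding A_def using b that by (intro szego_circle) auto
    then show ?thesis using power2_le_imp_le[of 1 "cmod (poly A z)"] by simp
  qed
  moreover have "\<exists>x>0. coeff A 0 = complex_of_real x"
    using szego_D_zero[of p \<alpha>] b unfolding A_def by blast
  moreover have "degree A \<le> 2 * n - 1" using szego_degree[of p \<alpha>] unfolding A_def p by blast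
  ultimately obtain t l r \<sigma> where "band_structure n A t l r \<sigma>"
    using ex_band_structure[OF n _ nz] by blast
  then interpret band_structure n A t l r \<sigma> .
  \<comment> \<open>The factor z^(-n) has modulus 1 on the circle, so the gaps can be read off the
    polynomial z^n Delta.\<close>
  have "{z \<in> sphere 0 1. cmod (discriminant p \<alpha> z) > 2}
      = {z \<in> sphere 0 1. cmod (poly (A + creflect (2 * n) A) z) > 2}"
  proof (intro Collect_cong conj_cong refl)
    fix z :: complex assume "z \<in> sphere 0 1"
    then obtain s where "z = cis s" by (metis circle_angle mem_sphere_0)
    then show "cmod (discriminant p \<alpha> z) > 2 \<longleftrightarrow> cmod (poly (A + creflect (2 * n) A) z) > 2"
      using cmod_reflection_sum[of s] discriminant_cis[of n \<alpha> s] by (simp add: p A_def norm_mult del: poly_add)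
  qed
  then have "card open_indices = k"
    using assms(4) card_components_gap unfolding open_gaps_def by simp
  then have "iso_set homeomorphic (PiE {..<k} (\<lambda>_. sphere (0::complex) 1))"
    by (rule iso_set_homeomorphic_torus)
  moreover have iso: "isospectral_set p \<alpha> = iso_set"
    unfolding isospectral_set_def iso_set_def unfolding A_def p isospectral_iff ..
  ultimately have h: "top_of_set (isospectral_set p \<alpha>)
      homeomorphic_space top_of_set (PiE {..<k} (\<lambda>_. sphere (0::complex) 1))"
    by (simp add: homeomorphic_imp_homeomorphic_space)
  have 1: "subtopology (complex_power_topology p) (isospectral_set p \<alpha>)
      homeomorphic_space top_of_set (isospectral_set p \<alpha>)"
    unfolding complex_power_topology_def
    by (rule product_subspace_homeomorphic) (auto simp: isospectral_set_def disk_power_def PiE_def)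
  have 2: "torus_topology k homeomorphic_space top_of_set (PiE {..<k} (\<lambda>_. sphere (0::complex) 1))"
    unfolding torus_topology_def subtopology_product_topology[symmetric]
    by (rule product_subspace_homeomorphic) (auto simp: PiE_def)
  show ?thesis
    unfolding is_torus_def
    using 1 h 2 homeomorphic_space_sym homeomorphic_space_trans by blast
qed

end
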